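(* For all $m,n>0$, with constant $b_n\in\mathcal C_n(\mathcal K)$, $b_m\in\mathcal C_m(\mathcal K)$ and $B_m=(\Theta b_m\Theta^{-1})_+$, the quantities $$\mathcal H_n=-\mathrm{Tr}\big(E\,U b_n U^{-1}\big),\qquad Q_{m,n}=\mathrm{Tr}\big([Q_{\mathbf s},B_m]\,U b_n U^{-1}\big)$$ are local (polynomials in the components of $A$ and their $x$-derivatives) and satisfy the conservation law $$\frac{d}{dt_m}\mathcal H_n+\partial_x Q_{m,n}=0 .$$
   Context: Algebra. $\widehat{\mathcal G}$ is an affine Lie algebra, realized by matrices depending on a loop parameter $\lambda$ (no central extension), with an integral gradation $\widehat{\mathcal G}=\bigoplus_{n\in\mathbb Z}\widehat{\mathcal G}_n$ given by a grading operator $Q_{\mathbf s}$: $[Q_{\mathbf s},Y]=nY$ for $Y\in\widehat{\mathcal G}_n$; $[Q_{\mathbf s},\cdot]$ acts as a derivation on products of such matrices. Infinite sums over descending negative grades are allowed. For $Y=\sum_n Y_n$, $Y_n$ of grade $n$, put $(Y)_+=\sum_{n\ge 0}Y_n$, $(Y)_-=\sum_{n<0}Y_n$. $E\in\widehat{\mathcal G}_1$ is a constant semisimple element, so $\widehat{\mathcal G}=\mathcal K\oplus\mathcal M$ with $\mathcal K=\mathrm{Ker}(\mathrm{ad}\,E)$, $\mathcal M=\mathrm{Im}(\mathrm{ad}\,E)$; $\mathcal K_n=\mathcal K\cap\widehat{\mathcal G}_n$, $\mathcal M_n=\mathcal M\cap\widehat{\mathcal G}_n$; $\mathcal C(\mathcal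 K)$ is the center of $\mathcal K$ and $\mathcal C_n(\mathcal K)=\mathcal C(\mathcal K)\cap\mathcal K_n$. "Constant" means independent of $x$ and of all flow parameters. Trace. $\mathrm{Tr}(Y)=\mathrm{tr}\,(Y)_0$: projection on the grade-zero component followed by the ordinary matrix trace. It is cyclic and satisfies $\mathrm{Tr}(Y[Q_{\mathbf s},Z])=-\mathrm{Tr}([Q_{\mathbf s},Y]Z)$. Dressing and flows. $L=D_x+E+A$, with $D_x$ differentiation $\partial_x$ and $A=A(x)\in\mathcal M_0$. $U=\exp\big(\sum_{j\ge1}u^{(-j)}\big)$ with $u^{(-j)}\in\mathcal M_{-j}$ is the element such that $U^{-1}LU=D_x+E+K^-$ with $K^-$ in the negative-grade part of $\mathcal K$ (the $u^{(-j)}$ are determined recursively, grade by grade, from $A$). $S=\exp\big(\sum_{j\ge1}s^{(-j)}\big)$, $s^{(-j)}\in\mathcal K_{-j}$, satisfies $S^{-1}(D_x+E+K^-)S=D_x+E$, and $\Theta=US$, so $\Theta^{-1}L\Theta=D_x+E$. For each $N>0$ for which it exists, fix a constant $b_N\in\mathcal C_N(\mathcal K)$, with $b_1=E$. The isospectral flow of $b_N$ is the derivation with $\frac{d}{dt_N}\Theta=(\Theta b_N\Theta^{-1})_-\Theta=\Theta b_N-B_N\Theta$, vanishing on constant elements and commuting with $[Q_{\mathbf s},\cdot]$; $\frac{d}{dt_1}=\partial_x$. *)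

theory Defs
  imports
    "HOL-Analysis.Analysis"
    "HOL-Computational_Algebra.Formal_Laurent_Series"
    "HOL-Library.Poly_Mapping"
begin

section \<open>Matrices depending on the loop parameter\<close>

text \<open>
  A matrix depending on the loop parameter \<open>\<lambda>\<close>, with infinitely many negative powers of \<open>\<lambda>\<close> allowed,
  is a matrix of formal Laurent series in \<open>\<lambda>\<inverse>\<close>.  The library variable \<^const>\<open>fls_X\<close> is \<open>\<lambda>\<inverse>\<close>, so the
  coefficient of \<open>\<lambda>\<^sup>k\<close> in \<open>f\<close> is \<open>fls_nth f (- k)\<close>.
  The product of matrices is \<open>**\<close>; the class operation \<open>*\<close> on vectors is componentwise and is
  not used for matrices.
\<close>

type_synonym ('r, 'n) loop_mat = "'r fls ^ 'n ^ 'n"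

definition lie :: "'a::ring_1 ^ 'n ^ 'n \<Rightarrow> 'a ^ 'n ^ 'n \<Rightarrow> 'a ^ 'n ^ 'n" where
  "lie X Y = X ** Y - Y ** X"

definition diag_mat :: "('n \<Rightarrow> 'a::zero) \<Rightarrow> 'a ^ 'n ^ 'n" where
  "diag_mat d = (\<chi> i j. if i = j then d i else 0)"

definition mscale :: "complex \<Rightarrow> complex ^ 'n ^ 'n \<Rightarrow> complex ^ 'n ^ 'n" where
  "mscale c X = map_matrix ((*) c) X"

definition loop_scale :: "'r::comm_ring_1 \<Rightarrow> ('r, 'n::finite) loop_mat \<Rightarrow> ('r, 'n) loop_mat" where
  "loop_scale c Y = map_matrix ((*) (fls_const c)) Y"

definition loop_coeff :: "('r::zero, 'n) loop_mat \<Rightarrow> int \<Rightarrow> 'r ^ 'n ^ 'n" where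
  "loop_coeff Y k = map_matrix (\<lambda>f. fls_nth f (- k)) Y"

text \<open>Coefficientwise application of \<open>\<phi>\<close>; only meaningful if \<open>\<phi> 0 = 0\<close>.\<close>

definition fls_map :: "('a::zero \<Rightarrow> 'b::zero) \<Rightarrow> 'a fls \<Rightarrow> 'b fls" where
  "fls_map \<phi> f = Abs_fls (\<lambda>k. \<phi> (fls_nth f k))"

definition loop_map :: "('a::zero \<Rightarrow> 'b::zero) \<Rightarrow> ('a, 'n::finite) loop_mat \<Rightarrow> ('b, 'n) loop_mat" where
  "loop_map \<phi> Y = map_matrix (fls_map \<phi>) Y"


section \<open>Affine Lie algebras as (twisted) loop algebras\<close>

definition lie_subalgebra :: "(complex ^ 'n ^ 'n) set \<Rightarrow> bool" where
  "lie_subalgebra \<gg> \<longleftrightarrow> module.subspace mscale \<gg> \<and> (\<forall>X\<in>\<gg>. \<forall>Y\<in>\<gg>. lie X Y \<in> \<gg>)"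

definition lie_ideal :: "(complex ^ 'n ^ 'n) set \<Rightarrow> (complex ^ 'n ^ 'n) set \<Rightarrow> bool" where
  "lie_ideal J \<gg> \<longleftrightarrow> J \<subseteq> \<gg> \<and> module.subspace mscale J \<and> (\<forall>X\<in>\<gg>. \<forall>Y\<in>J. lie X Y \<in> J)"

definition simple_lie_algebra :: "(complex ^ 'n ^ 'n) set \<Rightarrow> bool" where
  "simple_lie_algebra \<gg> \<longleftrightarrow> lie_subalgebra \<gg> \<and> (\<exists>X\<in>\<gg>. \<exists>Y\<in>\<gg>. lie X Y \<noteq> 0) \<and>
     (\<forall>J. lie_ideal J \<gg> \<longrightarrow> J = {0} \<or> J = \<gg>)"

definition finite_order_automorphism ::
    "(complex ^ 'n ^ 'n) set \<Rightarrow> (complex ^ 'n ^ 'n \<Rightarrow> complex ^ 'n ^ 'n) \<Rightarrow> nat \<Rightarrow> bool" where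
  "finite_order_automorphism \<gg> \<sigma> r \<longleftrightarrow> r > 0 \<and> bij_betw \<sigma> \<gg> \<gg> \<and>
     (\<forall>X\<in>\<gg>. \<forall>Y\<in>\<gg>. \<sigma> (X + Y) = \<sigma> X + \<sigma> Y \<and> \<sigma> (lie X Y) = lie (\<sigma> X) (\<sigma> Y)) \<and>
     (\<forall>c. \<forall>X\<in>\<gg>. \<sigma> (mscale c X) = mscale c (\<sigma> X)) \<and>
     (\<forall>X\<in>\<gg>. (\<sigma> ^^ r) X = X)"

text \<open>
  The centreless affine algebra \<open>\<Oplus>\<^sub>k \<lambda>\<^sup>k \<gg>\<^bsub>k mod r\<^esub>\<close>, where \<open>\<gg>\<^sub>j\<close> is the \<open>exp(2\<pi>ij/r)\<close>-eigenspace of \<open>\<sigma>\<close>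
  (Kac's \<open>L(\<gg>, \<sigma>, r)\<close>); the untwisted case is \<open>\<sigma> = id\<close>, \<open>r = 1\<close>.
\<close>

definition affine_algebra ::
    "(complex ^ 'n ^ 'n) set \<Rightarrow> (complex ^ 'n ^ 'n \<Rightarrow> complex ^ 'n ^ 'n) \<Rightarrow> nat \<Rightarrow> (complex, 'n) loop_mat set"
  where
  "affine_algebra \<gg> \<sigma> r = {Y. finite {k. loop_coeff Y k \<noteq> 0} \<and>
     (\<forall>k. loop_coeff Y k \<in> \<gg> \<and>
          \<sigma> (loop_coeff Y k) = mscale (cis (2 * pi * of_int k / of_nat r)) (loop_coeff Y k))}"


section \<open>Gradation\<close>

text \<open>
  The grading operator is \<open>Q\<^sub>s = \<kappa> \<lambda> d/d\<lambda> + H\<^sub>s\<close> with \<open>H\<^sub>s = diag(h\<^sub>i)\<close> in a Cartan subalgebra, so that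
  \<open>[Q\<^sub>s, Y] = \<kappa> \<lambda> dY/d\<lambda> + [H\<^sub>s, Y]\<close>.  In terms of \<open>X = \<lambda>\<inverse>\<close>, \<open>\<lambda> d/d\<lambda> = - X d/dX\<close>.
  The argument \<open>\<iota>\<close> embeds the complex numbers into the ring of coefficients.
\<close>

definition grading_op ::
    "(complex \<Rightarrow> 'r::comm_ring_1) \<Rightarrow> real \<Rightarrow> ('n::finite \<Rightarrow> real) \<Rightarrow> ('r, 'n) loop_mat \<Rightarrow> ('r, 'n) loop_mat" where
  "grading_op \<iota> \<kappa> h Y =
     loop_scale (\<iota> (of_real \<kappa>)) (map_matrix (\<lambda>f. - (fls_X * fls_deriv f)) Y)
     + lie (diag_mat (\<lambda>i. fls_const (\<iota> (of_real (h i))))) Y"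

definition homog ::
    "real \<Rightarrow> ('n::finite \<Rightarrow> real) \<Rightarrow> (complex, 'n) loop_mat set \<Rightarrow> int \<Rightarrow> (complex, 'n) loop_mat set" where
  "homog \<kappa> h V n = {Y \<in> V. grading_op (\<lambda>c. c) \<kappa> h Y = loop_scale (of_int n) Y}"

text \<open>
  The sum of the subspaces \<open>homog \<kappa> h G n\<close> is automatically direct, since these are eigenspaces for
  distinct eigenvalues.
\<close>

definition integral_gradation :: "real \<Rightarrow> ('n::finite \<Rightarrow> real) \<Rightarrow> (complex, 'n) loop_mat set \<Rightarrow> bool" where
  "integral_gradation \<kappa> h G \<longleftrightarrow>
     (\<forall>Y\<in>G. \<exists>N y. finite N \<and> (\<forall>n\<in>N. y n \<in> homog \<kappa> h G n) \<and> Y = (\<Sum>n\<in>N. y n))"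

text \<open>
  The part of \<open>Y\<close> in the grades \<open>g\<close> satisfying \<open>P g\<close>.  Since \<open>H\<^sub>s\<close> is diagonal, \<open>\<lambda>\<^sup>k\<close> times the matrix
  unit \<open>e\<^bsub>ij\<^esub>\<close> is an eigenvector of \<open>grading_op\<close>, of eigenvalue \<open>\<kappa> k + h\<^sub>i - h\<^sub>j\<close>.
\<close>

definition grade_part ::
    "real \<Rightarrow> ('n::finite \<Rightarrow> real) \<Rightarrow> (real \<Rightarrow> bool) \<Rightarrow> ('r::zero, 'n) loop_mat \<Rightarrow> ('r, 'n) loop_mat" where
  "grade_part \<kappa> h P Y = (\<chi> i j. Abs_fls (\<lambda>l.
     if P (\<kappa> * of_int (- l) + h i - h j) then fls_nth (Y $ i $ j) l else 0))"

text \<open>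
  The matrix trace of the grade-zero part.  For \<open>\<kappa> > 0\<close> the diagonal entries of grade zero contain
  only the power \<open>\<lambda>\<^sup>0\<close>, so that taking the coefficient of \<open>\<lambda>\<^sup>0\<close> loses nothing.
\<close>

definition graded_trace :: "real \<Rightarrow> ('n::finite \<Rightarrow> real) \<Rightarrow> ('r::comm_ring_1, 'n) loop_mat \<Rightarrow> 'r" where
  "graded_trace \<kappa> h Y = fls_nth (trace (grade_part \<kappa> h (\<lambda>g. g = 0) Y)) 0"


section \<open>The semisimple element and the associated decomposition\<close>

definition diagonalizable :: "complex ^ 'n ^ 'n \<Rightarrow> bool" where
  "diagonalizable X \<longleftrightarrow> (\<exists>(P :: complex ^ 'n ^ 'n) d. invertible P \<and> X ** P = P ** diag_mat d)"

definition loop_eval :: "complex \<Rightarrow> (complex, 'n) loop_mat \<Rightarrow> complex ^ 'n ^ 'n" where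
  "loop_eval z Y = (\<Sum>k | loop_coeff Y k \<noteq> 0. mscale (z powi k) (loop_coeff Y k))"

definition semisimple_element :: "(complex, 'n::finite) loop_mat \<Rightarrow> bool" where
  "semisimple_element E \<longleftrightarrow> (\<forall>z. z \<noteq> 0 \<longrightarrow> diagonalizable (loop_eval z E))"

definition ad_ker :: "(complex, 'n::finite) loop_mat set \<Rightarrow> (complex, 'n) loop_mat \<Rightarrow> (complex, 'n) loop_mat set" where
  "ad_ker G E = {Y \<in> G. lie E Y = 0}"

definition ad_im :: "(complex, 'n::finite) loop_mat set \<Rightarrow> (complex, 'n) loop_mat \<Rightarrow> (complex, 'n) loop_mat set" where
  "ad_im G E = lie E ` G"

definition lie_center :: "(complex, 'n::finite) loop_mat set \<Rightarrow> (complex, 'n) loop_mat set" where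
  "lie_center K = {Y \<in> K. \<forall>Z\<in>K. lie Y Z = 0}"


section \<open>Differential coefficient algebra\<close>

text \<open>
  Functions of \<open>x\<close> and of the flow parameters form a commutative complex algebra \<open>'r\<close>, with structure
  map \<open>\<iota>\<close>, whose derivations \<open>\<partial>\<^sub>x\<close> and \<open>d/dt\<^sub>N\<close> annihilate the constants.
\<close>

definition complex_algebra :: "(complex \<Rightarrow> 'r::comm_ring_1) \<Rightarrow> bool" where
  "complex_algebra \<iota> \<longleftrightarrow> \<iota> 1 = 1 \<and> (\<forall>a b. \<iota> (a + b) = \<iota> a + \<iota> b \<and> \<iota> (a * b) = \<iota> a * \<iota> b)"

definition derivation :: "(complex \<Rightarrow> 'r::comm_ring_1) \<Rightarrow> ('r \<Rightarrow> 'r) \<Rightarrow> bool" where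
  "derivation \<iota> D \<longleftrightarrow> (\<forall>a b. D (a + b) = D a + D b \<and> D (a * b) = D a * b + a * D b) \<and>
     (\<forall>c. D (\<iota> c) = 0)"

text \<open>The elements of a graded piece with coefficients in \<open>'r\<close>.\<close>

definition ext_span :: "(complex \<Rightarrow> 'r::comm_ring_1) \<Rightarrow> (complex, 'n::finite) loop_mat set \<Rightarrow> ('r, 'n) loop_mat set" where
  "ext_span \<iota> V = module.span loop_scale (loop_map \<iota> ` V)"

text \<open>
  The infinite sums \<open>\<Sum>\<^bsub>j\<ge>1\<^esub> u\<^bsup>(-j)\<^esup>\<close> with \<open>u\<^bsup>(-j)\<^esup>\<close> in the part of \<open>V\<close> of grade \<open>-j\<close>, coefficients in \<open>'r\<close>.  Here
  and below, \<open>sums\<close> refers to the \<open>\<lambda>\<inverse>\<close>-adic topology on the entries.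
\<close>

definition negative_series ::
    "(complex \<Rightarrow> 'r::comm_ring_1) \<Rightarrow> real \<Rightarrow> ('n::finite \<Rightarrow> real) \<Rightarrow> (complex, 'n) loop_mat set \<Rightarrow> ('r, 'n) loop_mat set"
  where
  "negative_series \<iota> \<kappa> h V = {X. \<exists>u. (\<forall>j\<ge>1. u j \<in> ext_span \<iota> (homog \<kappa> h V (- int j))) \<and>
     (\<lambda>j. u (Suc j)) sums X}"

definition is_exp :: "(complex \<Rightarrow> 'r::comm_ring_1) \<Rightarrow> ('r, 'n::finite) loop_mat \<Rightarrow> ('r, 'n) loop_mat \<Rightarrow> bool" where
  "is_exp \<iota> X U \<longleftrightarrow> (\<lambda>k. loop_scale (\<iota> (1 / fact k)) ((((**) X) ^^ k) (mat 1))) sums U"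

text \<open>The operator \<open>D\<^sub>x + X\<close> on column vectors.\<close>

definition lax_op :: "('r \<Rightarrow> 'r) \<Rightarrow> ('r::comm_ring_1, 'n::finite) loop_mat \<Rightarrow> 'r fls ^ 'n \<Rightarrow> 'r fls ^ 'n" where
  "lax_op D X = (\<lambda>v. (\<chi> i. fls_map D (v $ i)) + X *v v)"

definition conj_op :: "('r::comm_ring_1, 'n::finite) loop_mat \<Rightarrow> ('r fls ^ 'n \<Rightarrow> 'r fls ^ 'n) \<Rightarrow> 'r fls ^ 'n \<Rightarrow> 'r fls ^ 'n"
  where
  "conj_op U L = (\<lambda>v. matrix_inv U *v L (U *v v))"


section \<open>Dressing and isospectral flows\<close>

text \<open>\<open>U\<close>, and the element \<open>K\<^sup>-\<close> (here \<open>Km\<close>) with \<open>U\<inverse> (D\<^sub>x + E + A) U = D\<^sub>x + E + K\<^sup>-\<close>.\<close>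

definition dressing_U ::
    "(complex \<Rightarrow> 'r::comm_ring_1) \<Rightarrow> ('r \<Rightarrow> 'r) \<Rightarrow> real \<Rightarrow> ('n::finite \<Rightarrow> real) \<Rightarrow> (complex, 'n) loop_mat set \<Rightarrow>
     (complex, 'n) loop_mat \<Rightarrow> ('r, 'n) loop_mat \<Rightarrow> ('r, 'n) loop_mat \<Rightarrow> ('r, 'n) loop_mat \<Rightarrow> bool" where
  "dressing_U \<iota> D \<kappa> h G E A U Km \<longleftrightarrow>
     (\<exists>X\<in>negative_series \<iota> \<kappa> h (ad_im G E). is_exp \<iota> X U) \<and>
     Km \<in> negative_series \<iota> \<kappa> h (ad_ker G E) \<and>
     conj_op U (lax_op D (loop_map \<iota> E + A)) = lax_op D (loop_map \<iota> E + Km)"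

definition dressing_S ::
    "(complex \<Rightarrow> 'r::comm_ring_1) \<Rightarrow> ('r \<Rightarrow> 'r) \<Rightarrow> real \<Rightarrow> ('n::finite \<Rightarrow> real) \<Rightarrow> (complex, 'n) loop_mat set \<Rightarrow>
     (complex, 'n) loop_mat \<Rightarrow> ('r, 'n) loop_mat \<Rightarrow> ('r, 'n) loop_mat \<Rightarrow> bool" where
  "dressing_S \<iota> D \<kappa> h G E Km S \<longleftrightarrow>
     (\<exists>X\<in>negative_series \<iota> \<kappa> h (ad_ker G E). is_exp \<iota> X S) \<and>
     conj_op S (lax_op D (loop_map \<iota> E + Km)) = lax_op D (loop_map \<iota> E)"

text \<open>
  The constants \<open>b\<^sub>N\<close>, for \<open>N\<close> in the set \<open>I\<close> of those positive grades for which one has been fixed.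
\<close>

definition flow_constants ::
    "real \<Rightarrow> ('n::finite \<Rightarrow> real) \<Rightarrow> (complex, 'n) loop_mat set \<Rightarrow> (complex, 'n) loop_mat \<Rightarrow>
     nat set \<Rightarrow> (nat \<Rightarrow> (complex, 'n) loop_mat) \<Rightarrow> bool" where
  "flow_constants \<kappa> h G E I b \<longleftrightarrow> 0 \<notin> I \<and> 1 \<in> I \<and> b 1 = E \<and>
     (\<forall>N\<in>I. b N \<in> homog \<kappa> h (lie_center (ad_ker G E)) (int N))"

text \<open>\<open>Y b Y\<inverse>\<close> for a constant element \<open>b\<close>.\<close>

definition dressed ::
    "(complex \<Rightarrow> 'r::comm_ring_1) \<Rightarrow> ('r, 'n::finite) loop_mat \<Rightarrow> (complex, 'n) loop_mat \<Rightarrow> ('r, 'n) loop_mat" where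
  "dressed \<iota> Y b = Y ** loop_map \<iota> b ** matrix_inv Y"

text \<open>
  A flow acts on matrices coefficientwise; as it annihilates the constants, this action commutes with
  \<^const>\<open>grading_op\<close>.
\<close>

definition isospectral_flows ::
    "(complex \<Rightarrow> 'r::comm_ring_1) \<Rightarrow> ('r \<Rightarrow> 'r) \<Rightarrow> real \<Rightarrow> ('n::finite \<Rightarrow> real) \<Rightarrow> nat set \<Rightarrow>
     (nat \<Rightarrow> (complex, 'n) loop_mat) \<Rightarrow> ('r, 'n) loop_mat \<Rightarrow> (nat \<Rightarrow> 'r \<Rightarrow> 'r) \<Rightarrow> bool" where
  "isospectral_flows \<iota> D \<kappa> h I b \<Theta> \<delta> \<longleftrightarrow> \<delta> 1 = D \<and>
     (\<forall>N\<in>I. derivation \<iota> (\<delta> N) \<and>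
        loop_map (\<delta> N) \<Theta> = grade_part \<kappa> h (\<lambda>g. g < 0) (dressed \<iota> \<Theta> (b N)) ** \<Theta>)"


section \<open>Densities, fluxes and locality\<close>

definition conserved_density ::
    "(complex \<Rightarrow> 'r::comm_ring_1) \<Rightarrow> real \<Rightarrow> ('n::finite \<Rightarrow> real) \<Rightarrow> (complex, 'n) loop_mat \<Rightarrow>
     ('r, 'n) loop_mat \<Rightarrow> (complex, 'n) loop_mat \<Rightarrow> 'r" where
  "conserved_density \<iota> \<kappa> h E U bn = - graded_trace \<kappa> h (loop_map \<iota> E ** dressed \<iota> U bn)"

definition conserved_flux ::
    "(complex \<Rightarrow> 'r::comm_ring_1) \<Rightarrow> real \<Rightarrow> ('n::finite \<Rightarrow> real) \<Rightarrow> ('r, 'n) loop_mat \<Rightarrow> ('r, 'n) loop_mat \<Rightarrow>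
     (complex, 'n) loop_mat \<Rightarrow> (complex, 'n) loop_mat \<Rightarrow> 'r" where
  "conserved_flux \<iota> \<kappa> h \<Theta> U bm bn =
     (let Bm = grade_part \<kappa> h (\<lambda>g. g \<ge> 0) (dressed \<iota> \<Theta> bm)
      in graded_trace \<kappa> h (grading_op \<iota> \<kappa> h Bm ** dressed \<iota> U bn))"

text \<open>
  Differential polynomials: the variable \<open>((i, j, k), l)\<close> stands for the \<open>l\<close>-th \<open>x\<close>-derivative of the
  coefficient of \<open>\<lambda>\<^sup>k\<close> in the matrix entry \<open>(i, j)\<close> of \<open>A\<close>.
\<close>

type_synonym 'n diff_poly = "((('n \<times> 'n \<times> int) \<times> nat) \<Rightarrow>\<^sub>0 nat) \<Rightarrow>\<^sub>0 complex"

definition diff_poly_eval ::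
    "(complex \<Rightarrow> 'r::comm_ring_1) \<Rightarrow> ('r \<Rightarrow> 'r) \<Rightarrow> ('r, 'n::finite) loop_mat \<Rightarrow> 'n diff_poly \<Rightarrow> 'r" where
  "diff_poly_eval \<iota> D A p =
     (\<Sum>\<mu>\<in>Poly_Mapping.keys p. \<iota> (Poly_Mapping.lookup p \<mu>) *
        (\<Prod>((i, j, k), l)\<in>Poly_Mapping.keys \<mu>.
           ((D ^^ l) (loop_coeff A k $ i $ j)) ^ Poly_Mapping.lookup \<mu> ((i, j, k), l)))"

end

theory Submission
  imports Defs
begin

text \<open>
  Conservation law: as \<open>S\<close> commutes with the constants \<open>b\<^sub>n\<close>, density and flux only involve
  \<open>W\<^sub>n = \<Theta> b\<^sub>n \<Theta>\<inverse> = U b\<^sub>n U\<inverse>\<close>.  With \<open>L = E + A\<close> and \<open>B = (W\<^sub>m)\<^sub>+\<close> one has \<open>\<partial>\<^sub>x W\<^sub>n = [W\<^sub>n, L]\<close>,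
  \<open>dW\<^sub>n/dt\<^sub>m = - [B, W\<^sub>n]\<close> and, up to a term of grade zero, \<open>\<partial>\<^sub>x B = [B, L]\<close>.  Since \<open>[Q\<^sub>s, L] = E\<close>, the derivation
  property of \<open>[Q\<^sub>s, \<cdot>]\<close> and the cyclicity of the trace turn \<open>\<partial>\<^sub>x Tr([Q\<^sub>s, B] W\<^sub>n)\<close> into \<open>- Tr(E [B, W\<^sub>n])\<close>.

  Locality: write \<open>U = exp X = 1 + X + R\<close>.  The dressing equation becomes \<open>[E, X] - K\<^sup>- = F\<close>, where the part of
  \<open>F\<close> of grade \<open>-n\<close> only involves \<open>A\<close> and the parts of \<open>X\<close> and \<open>K\<^sup>-\<close> that are already known.  A second commutator
  with \<open>E\<close> removes \<open>K\<^sup>-\<close>, and \<open>(ad E)\<^sup>2\<close> is injective on \<open>Im (ad E)\<close> because \<open>E\<close> is diagonalizable at every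
  value of the loop parameter.  So the next part of \<open>X\<close> is a fixed complex-linear function of \<open>[E, F]\<close>.
\<close>

section \<open>Matrices of Laurent series\<close>

text \<open>Two features of the setting shape the proof. Grades are real numbers, since \<kappa> and
  the h_i are real, so integrality is carried along in the support conditions. It matters in the
  conservation law: for N of negative grade and L with grades in {0, 1}, the nonnegative part of
  [N, L] has grade exactly 0 only because fractional grades are excluded. Moreover, the polynomials
  witnessing locality are chosen before the coefficient maps, the field \<open>A\<close> and the
  dressing. Locality is therefore made a property of functions on the set of all dressing data, and
  the recursion may use only numbers common to all data. This is why (ad E)^2 is inverted over the
  complex numbers, where linear algebra provides a left inverse whose entries can be transported by
  \<iota>. Infinite sums are handled by truncation in grade: since \<kappa> > 0, each grade has
  finitely many positions, and an element lying below every grade is 0.\<close>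

abbreviation loop_nth :: "('r::zero, 'n::finite) loop_mat \<Rightarrow> 'n \<Rightarrow> 'n \<Rightarrow> int \<Rightarrow> 'r" where
  "loop_nth Y i j l \<equiv> fls_nth (Y $ i $ j) l"

lemma loop_mat_eqI: "(\<And>i j l. loop_nth X i j l = loop_nth Y i j l) \<Longrightarrow> X = Y"
  by (simp add: vec_eq_iff fls_eq_iff)

text \<open>The bounds \<open>a\<close> and \<open>b\<close> stand in for the subdegrees. A
  summation range independent of the factors can be shared by the terms of a product rule or by a
  whole family of matrices.\<close>

lemma fls_times_nth_bounded:
  fixes f g :: "'r::comm_ring_1 fls"
  assumes f: "\<And>k. k < a \<Longrightarrow> fls_nth f k = 0" and g: "\<And>k. k < b \<Longrightarrow> fls_nth g k = 0"
  shows "fls_nth (f * g) n = (\<Sum>k=a..n-b. fls_nth f k * fls_nth g (n - k))"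
proof -
  define J where "J = {fls_subdegree f..n - fls_subdegree g}"
  have "fls_nth f k * fls_nth g (n - k) = 0" if "k \<notin> {a..n-b}" for k
    using that f[of k] g[of "n - k"] by fastforce
  moreover have "fls_nth f k * fls_nth g (n - k) = 0" if "k \<notin> J" for k
    using that fls_eq0_below_subdegree[of k f] fls_eq0_below_subdegree[of "n - k" g]
    unfolding J_def by fastforce
  ultimately have "(\<Sum>k\<in>J. fls_nth f k * fls_nth g (n - k)) = (\<Sum>k=a..n-b. fls_nth f k * fls_nth g (n - k))"
    by (intro sum.mono_neutral_cong) (auto simp: J_def)
  then show ?thesis by (simp add: fls_times_nth(2) J_def)
qed

lemma loop_nth_bounded_below:
  fixes Y :: "('r::zero, 'n::finite) loop_mat"
  obtains a where "\<And>i j l. l < a \<Longrightarrow> loop_nth Y i j l = 0"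
proof
  show "loop_nth Y i j l = 0" if "l < Min ((\<lambda>(i, j). fls_subdegree (Y $ i $ j)) ` UNIV)" for i j l
  proof -
    have "Min ((\<lambda>(i, j). fls_subdegree (Y $ i $ j)) ` UNIV) \<le> fls_subdegree (Y $ i $ j)"
      by (rule Min_le) (auto intro!: image_eqI[of _ _ "(i, j)"])
    with that show ?thesis by simp
  qed
qed

lemma loop_nth_mult:
  fixes X Y :: "('r::comm_ring_1, 'n::finite) loop_mat"
  assumes "\<And>i j l. l < a \<Longrightarrow> loop_nth X i j l = 0" "\<And>i j l. l < b \<Longrightarrow> loop_nth Y i j l = 0"
  shows "loop_nth (X ** Y) i j l = (\<Sum>k\<in>UNIV. \<Sum>l'=a..l-b. loop_nth X i k l' * loop_nth Y k j (l - l'))"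
  by (simp add: matrix_matrix_mult_def fls_nth_sum fls_times_nth_bounded[of a _ b] assms)

lemma loop_nth_mult_nonzero:
  fixes X Y :: "('r::comm_ring_1, 'n::finite) loop_mat"
  assumes "loop_nth (X ** Y) i j l \<noteq> 0"
  obtains k l' where "loop_nth X i k l' \<noteq> 0" "loop_nth Y k j (l - l') \<noteq> 0"
proof -
  obtain a where a: "\<And>i j l. l < a \<Longrightarrow> loop_nth X i j l = 0" using loop_nth_bounded_below[of X] by blast
  obtain b where b: "\<And>i j l. l < b \<Longrightarrow> loop_nth Y i j l = 0" using loop_nth_bounded_below[of Y] by blast
  have "(\<Sum>k\<in>UNIV. \<Sum>l'=a..l-b. loop_nth X i k l' * loop_nth Y k j (l - l')) \<noteq> 0"
    using assms loop_nth_mult[of a X b Y i j l, OF a b] by simp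
  then obtain k where "(\<Sum>l'=a..l-b. loop_nth X i k l' * loop_nth Y k j (l - l')) \<noteq> 0"
    by (auto elim: sum.not_neutral_contains_not_neutral)
  then obtain l' where "loop_nth X i k l' * loop_nth Y k j (l - l') \<noteq> 0"
    by (auto elim: sum.not_neutral_contains_not_neutral)
  then show thesis
    by (intro that[of k l']) auto
qed

section \<open>Noncommutative matrix identities\<close>

lemma matrix_diff_ldistrib: "A ** (B - C) = A ** B - A ** (C :: 'a::ring_1 ^ 'p ^ 'n)"
  by (vector matrix_matrix_mult_def sum_subtractf[symmetric] right_diff_distrib)

lemma matrix_diff_rdistrib: "(A - B) ** C = A ** C - B ** (C :: 'a::ring_1 ^ 'p ^ 'n)"
  by (vector matrix_matrix_mult_def sum_subtractf[symmetric] left_diff_distrib)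

lemma matrix_add_rdistrib: "(A + B) ** C = A ** C + B ** (C :: 'a::ring_1 ^ 'p ^ 'n)"
  by (vector matrix_matrix_mult_def sum.distrib[symmetric] distrib_right)

lemma matrix_minus_left: "(- A) ** C = - (A ** (C :: 'a::ring_1 ^ 'p ^ 'n))"
  by (vector matrix_matrix_mult_def sum_negf[symmetric])

lemma matrix_minus_right: "A ** (- C) = - (A ** (C :: 'a::ring_1 ^ 'p ^ 'n))"
  by (vector matrix_matrix_mult_def sum_negf[symmetric])

lemma matrix_sum_ldistrib: "A ** (\<Sum>k\<in>S. B k) = (\<Sum>k\<in>S. A ** (B k :: 'a::ring_1 ^ 'p ^ 'n))"
  by (induction S rule: infinite_finite_induct) (auto simp: matrix_add_ldistrib)

lemma matrix_sum_rdistrib: "(\<Sum>k\<in>S. B k) ** A = (\<Sum>k\<in>S. B k ** (A :: 'a::ring_1 ^ 'p ^ 'n))"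
  by (induction S rule: infinite_finite_induct) (auto simp: matrix_add_rdistrib)

lemmas matrix_ring_simps = matrix_add_ldistrib matrix_add_rdistrib matrix_diff_ldistrib
  matrix_diff_rdistrib matrix_minus_left matrix_minus_right matrix_mul_assoc

lemma lie_add_right: "lie X (Y + Z) = lie X Y + lie X Z"
  and lie_diff_right: "lie X (Y - Z) = lie X Y - lie X Z"
  and lie_add_left: "lie (X + Y) Z = lie X Z + lie Y Z"
  and lie_diff_left: "lie (X - Y) Z = lie X Z - lie Y Z"
  and lie_anticomm: "lie X Y = - lie Y X"
  by (simp_all add: lie_def matrix_ring_simps)

lemma matrix_inv_eqI:
  fixes A :: "'a::semiring_1 ^ 'n ^ 'n"
  assumes "A ** B = mat 1" "B ** A = mat 1"
  shows "matrix_inv A = B"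
proof -
  have "A ** matrix_inv A = mat 1 \<and> matrix_inv A ** A = mat 1"
    unfolding matrix_inv_def by (rule someI[of _ B]) (use assms in simp)
  then show ?thesis
    by (metis assms(1) matrix_mul_assoc matrix_mul_lid matrix_mul_rid)
qed

lemma fls_nth_map:
  assumes "\<phi> 0 = 0" shows "fls_nth (fls_map \<phi> f) l = \<phi> (fls_nth f l)"
proof -
  obtain N where "\<forall>n<N. fls_nth f n = 0"
    using fls_eq0_below_subdegree by blast
  then show ?thesis
    by (simp add: fls_map_def nth_Abs_fls_lower_bound[of N] assms)
qed

lemma loop_nth_map: "\<phi> 0 = 0 \<Longrightarrow> loop_nth (loop_map \<phi> Y) i j l = \<phi> (loop_nth Y i j l)"
  by (simp add: loop_map_def fls_nth_map)

lemma loop_nth_scale: "loop_nth (loop_scale c Y) i j l = c * loop_nth Y i j l"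
  by (simp add: loop_scale_def)

lemma loop_scale_mult_left: "loop_scale c X ** Y = loop_scale c (X ** Y)"
  by (simp add: loop_scale_def vec_eq_iff matrix_matrix_mult_def sum_distrib_left mult.assoc)

lemma loop_scale_mult_right: "X ** loop_scale c Y = loop_scale c (X ** Y)"
  by (simp add: loop_scale_def vec_eq_iff matrix_matrix_mult_def sum_distrib_left mult.left_commute)

interpretation loop_module: module "loop_scale :: 'r::comm_ring_1 \<Rightarrow> ('r, 'n::finite) loop_mat \<Rightarrow> _"
  by unfold_locales (rule loop_mat_eqI, simp add: loop_nth_scale algebra_simps)+

interpretation loop_space: vector_space "loop_scale :: complex \<Rightarrow> (complex, 'n::finite) loop_mat \<Rightarrow> _"
  by unfold_locales (rule loop_mat_eqI, simp add: loop_nth_scale algebra_simps)+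

section \<open>Extension of scalars from the complex numbers\<close>

locale algebra_hom =
  fixes \<iota> :: "complex \<Rightarrow> 'r::comm_ring_1"
  assumes complex_algebra: "complex_algebra \<iota>"
begin

lemma hom_one: "\<iota> 1 = 1" and hom_add: "\<iota> (a + b) = \<iota> a + \<iota> b" and hom_mult: "\<iota> (a * b) = \<iota> a * \<iota> b"
  using complex_algebra unfolding complex_algebra_def by blast+

lemma hom_zero [simp]: "\<iota> 0 = 0" using hom_add[of 0 0] by (metis add_cancel_right_right)

lemma hom_minus: "\<iota> (- a) = - \<iota> a" using hom_add[of "- a" a] by (simp add: eq_neg_iff_add_eq_0)

lemma hom_diff: "\<iota> (a - b) = \<iota> a - \<iota> b" using hom_add[of a "-b"] by (simp add: hom_minus)

lemma hom_sum: "\<iota> (sum f S) = (\<Sum>x\<in>S. \<iota> (f x))"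
  by (induction S rule: infinite_finite_induct) (auto simp: hom_add)

lemma hom_of_nat: "\<iota> (of_nat n) = of_nat n" by (induction n) (auto simp: hom_add hom_one)

lemma hom_of_int: "\<iota> (of_int n) = of_int n" by (cases n) (auto simp: hom_of_nat hom_minus hom_diff hom_one simp del: of_nat_Suc)

lemma loop_map_mult:
  fixes X Y :: "(complex, 'n::finite) loop_mat"
  shows "loop_map \<iota> (X ** Y) = loop_map \<iota> X ** loop_map \<iota> Y"
proof (rule loop_mat_eqI)
  fix i j l
  obtain a where a: "\<And>i j l. l < a \<Longrightarrow> loop_nth X i j l = 0" using loop_nth_bounded_below[of X] by blast
  obtain b where b: "\<And>i j l. l < b \<Longrightarrow> loop_nth Y i j l = 0" using loop_nth_bounded_below[of Y] by blast
  note ab = a b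
  show "loop_nth (loop_map \<iota> (X ** Y)) i j l = loop_nth (loop_map \<iota> X ** loop_map \<iota> Y) i j l"
    by (subst loop_nth_mult[of a _ b])
      (auto simp: ab loop_nth_map loop_nth_mult[of a _ b] hom_sum hom_mult)
qed

lemma loop_map_diff: "loop_map \<iota> (X - Y) = loop_map \<iota> X - loop_map \<iota> (Y :: (complex, 'n::finite) loop_mat)"
  by (rule loop_mat_eqI) (simp add: loop_nth_map hom_diff)

lemma loop_map_zero: "loop_map \<iota> (0 :: (complex, 'n::finite) loop_mat) = 0"
  by (rule loop_mat_eqI) (simp add: loop_nth_map)

lemma loop_map_lie: "loop_map \<iota> (lie X Y) = lie (loop_map \<iota> X) (loop_map \<iota> (Y :: (complex, 'n::finite) loop_mat))"
  by (simp add: lie_def loop_map_diff loop_map_mult)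

end

section \<open>Coefficientwise derivations\<close>

locale algebra_derivation = algebra_hom \<iota> for \<iota> :: "complex \<Rightarrow> 'a::comm_ring_1" +
  fixes D :: "'a \<Rightarrow> 'a"
  assumes derivation: "derivation \<iota> D"
begin

lemma D_add: "D (a + b) = D a + D b" and D_mult: "D (a * b) = D a * b + a * D b" and D_const [simp]: "D (\<iota> c) = 0"
  using derivation unfolding derivation_def by blast+

lemma D_zero [simp]: "D 0 = 0" using D_add[of 0 0] by (metis add_cancel_right_right)
lemma D_one [simp]: "D 1 = 0" using D_const[of 1] by (simp add: hom_one)

lemma D_minus: "D (- a) = - D a" using D_add[of "- a" a] by (simp add: eq_neg_iff_add_eq_0)
lemma D_diff: "D (a - b) = D a - D b" using D_add[of a "-b"] by (simp add: D_minus)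

lemma D_sum: "D (sum f S) = (\<Sum>x\<in>S. D (f x))"
  by (induction S rule: infinite_finite_induct) (auto simp: D_add)

abbreviation "DD \<equiv> loop_map D"

lemma DD_diff: "DD (X - Y) = DD X - DD (Y :: ('a, 'n::finite) loop_mat)"
  by (rule loop_mat_eqI) (simp add: loop_nth_map D_diff)

lemma DD_const: "DD (loop_map \<iota> X) = (0 :: ('a, 'n::finite) loop_mat)"
  by (rule loop_mat_eqI) (simp add: loop_nth_map)

lemma DD_one: "DD (mat 1 :: ('a, 'n::finite) loop_mat) = 0"
  by (rule loop_mat_eqI) (simp add: loop_nth_map mat_def)

text \<open>\<open>D\<close> may annihilate leading coefficients and so raise subdegrees. The bounds
  of X and Y remain valid for their derivatives, so all three products are expanded over the same
  range.\<close>

lemma DD_mult: "DD (X ** Y) = DD X ** Y + X ** DD (Y :: ('a, 'n::finite) loop_mat)"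
proof (rule loop_mat_eqI)
  fix i j l
  obtain a where a: "\<And>i j l. l < a \<Longrightarrow> loop_nth X i j l = 0" using loop_nth_bounded_below[of X] by blast
  obtain b where b: "\<And>i j l. l < b \<Longrightarrow> loop_nth Y i j l = 0" using loop_nth_bounded_below[of Y] by blast
  note ab = a b
  show "loop_nth (DD (X ** Y)) i j l = loop_nth (DD X ** Y + X ** DD Y) i j l"
    by (simp add: loop_nth_map loop_nth_mult[of a _ b] ab D_sum D_mult sum.distrib)
qed

lemma DD_inverse:
  fixes T V :: "('a, 'n::finite) loop_mat"
  assumes "T ** V = mat 1" "V ** T = mat 1"
  shows "DD V = - (V ** DD T ** V)"
proof -
  have "DD T ** V + T ** DD V = 0" using DD_mult[of T V] by (simp add: assms DD_one)
  then have "V ** (DD T ** V) + V ** (T ** DD V) = 0" by (metis matrix_add_ldistrib times0_right)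
  then show ?thesis by (simp add: matrix_mul_assoc assms eq_neg_iff_add_eq_0 add.commute)
qed

text \<open>Both \<partial>_x and the flows act on \<Theta> by left multiplication, so this one
  computation yields both Lax equations of the conservation law.\<close>

lemma DD_conjugate:
  fixes T V :: "('a, 'n::finite) loop_mat"
  assumes "T ** V = mat 1" "V ** T = mat 1" "DD T = M ** T"
  shows "DD (T ** loop_map \<iota> c ** V) = lie M (T ** loop_map \<iota> c ** V)"
proof -
  have "V ** (M ** T) ** V = V ** M" by (simp add: matrix_mul_assoc[symmetric] assms)
  then show ?thesis
    by (simp add: DD_mult DD_const DD_inverse[OF assms(1,2)] assms(3) lie_def matrix_ring_simps)
qed

end

section \<open>Gradation\<close>

text \<open>Bridge from the metric behind \<open>sums\<close> to coefficients;
  \<open>sums_graded_series\<close> builds on it, and later arguments work with grades only.\<close>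

lemma fls_tendsto_nth:
  fixes f :: "nat \<Rightarrow> 'r::comm_ring_1 fls"
  assumes "f \<longlonglongrightarrow> F"
  shows "\<forall>\<^sub>F n in sequentially. fls_nth (f n) l = fls_nth F l"
proof -
  \<comment> \<open>A distance below 2^(-|l|), which is at most 1, forces a nonnegative subdegree
    larger than |l|, hence larger than l; the absolute value covers both signs of l.\<close>
  have "\<forall>\<^sub>F n in sequentially. dist (f n) F < inverse (2 ^ nat \<bar>l\<bar>)"
    using assms by (rule tendstoD) simp
  then show ?thesis
  proof eventually_elim
    case (elim n)
    have "fls_nth (f n - F) l = 0"
    proof (cases "f n = F")
      case False
      have "fls_subdegree (f n - F) > l"
      proof (cases "fls_subdegree (f n - F) \<ge> 0")
        case True
        with elim False have "inverse (2 ^ nat (fls_subdegree (f n - F))) < (inverse (2 ^ nat \<bar>l\<bar>) :: real)"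
          by (simp add: dist_fls_def)
        then have "(2::real) ^ nat \<bar>l\<bar> < 2 ^ nat (fls_subdegree (f n - F))"
          by (rule inverse_less_imp_less) simp
        then have "nat \<bar>l\<bar> < nat (fls_subdegree (f n - F))"
          by (rule power_less_imp_less_exp[rotated]) simp
        then show ?thesis by linarith
      next
        case neg: False
        have "(1::real) \<le> 2 ^ nat (- fls_subdegree (f n - F))" by simp
        also have "\<dots> < inverse (2 ^ nat \<bar>l\<bar>)"
          using elim neg False by (simp add: dist_fls_def)
        also have "\<dots> \<le> 1" by (simp add: inverse_le_1_iff)
        finally show ?thesis by simp
      qed
      then show ?thesis by (rule fls_eq0_below_subdegree)
    qed simp
    then show ?case by simp
  qed
qed

section \<open>Weights, supports and series in descending grades\<close>

locale loop_grading =
  fixes \<kappa> :: real and h :: "'n::finite \<Rightarrow> real"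
  assumes kappa_pos: "\<kappa> > 0"
begin

definition weight :: "'n \<Rightarrow> 'n \<Rightarrow> int \<Rightarrow> real" where
  "weight i j l = \<kappa> * of_int (- l) + h i - h j"

text \<open>A predicate on weights rather than a set of integers: homogeneity, bounds and
  integrality then all obey the single product rule \<open>supp_mult\<close>.\<close>

definition supp :: "(real \<Rightarrow> bool) \<Rightarrow> ('r::zero, 'n) loop_mat \<Rightarrow> bool" where
  "supp P Y \<longleftrightarrow> (\<forall>i j l. loop_nth Y i j l \<noteq> 0 \<longrightarrow> P (weight i j l))"

lemma weight_add: "weight i k l' + weight k j (l - l') = weight i j l"
  by (simp add: weight_def algebra_simps)

lemma weight_diag [simp]: "weight i i 0 = 0"
  by (simp add: weight_def)

lemma suppI: "(\<And>i j l. loop_nth Y i j l \<noteq> 0 \<Longrightarrow> P (weight i j l)) \<Longrightarrow> supp P Y"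
  and suppD: "supp P Y \<Longrightarrow> loop_nth Y i j l \<noteq> 0 \<Longrightarrow> P (weight i j l)"
  and supp_nth_zero: "supp P Y \<Longrightarrow> \<not> P (weight i j l) \<Longrightarrow> loop_nth Y i j l = 0"
  by (auto simp: supp_def)

lemma supp_iff: "supp P Y \<longleftrightarrow> (\<forall>i j l. \<not> P (weight i j l) \<longrightarrow> loop_nth Y i j l = 0)"
  by (auto simp: supp_def)

lemma supp_mono: "supp P Y \<Longrightarrow> (\<And>g. P g \<Longrightarrow> Q g) \<Longrightarrow> supp Q Y"
  by (auto simp: supp_def)

lemma supp_conj: "supp P Y \<Longrightarrow> supp Q Y \<Longrightarrow> supp (\<lambda>g. P g \<and> Q g) Y"
  by (auto simp: supp_def)

lemma supp_zero [simp]: "supp P 0"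
  by (simp add: supp_def)

lemma supp_mult:
  fixes X Y :: "('r::comm_ring_1, 'n) loop_mat"
  assumes "supp P X" "supp Q Y" "\<And>a b. P a \<Longrightarrow> Q b \<Longrightarrow> R (a + b)"
  shows "supp R (X ** Y)"
proof (rule suppI)
  fix i j l assume "loop_nth (X ** Y) i j l \<noteq> 0"
  then obtain k l' where "loop_nth X i k l' \<noteq> 0" "loop_nth Y k j (l - l') \<noteq> 0"
    by (rule loop_nth_mult_nonzero)
  with assms suppD show "R (weight i j l)"
    by (metis weight_add)
qed

lemma supp_add: "supp P X \<Longrightarrow> supp P Y \<Longrightarrow> supp P (X + (Y :: ('r::comm_ring_1, 'n) loop_mat))"
  and supp_diff: "supp P X \<Longrightarrow> supp P Y \<Longrightarrow> supp P (X - (Y :: ('r::comm_ring_1, 'n) loop_mat))"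
  and supp_minus: "supp P X \<Longrightarrow> supp P (- (X :: ('r::comm_ring_1, 'n) loop_mat))"
  and supp_scale: "supp P X \<Longrightarrow> supp P (loop_scale c (X :: ('r::comm_ring_1, 'n) loop_mat))"
  and supp_map: "\<phi> 0 = 0 \<Longrightarrow> supp P Z \<Longrightarrow> supp P (loop_map \<phi> Z)"
  and supp_one: "P 0 \<Longrightarrow> supp P (mat 1 :: ('r::comm_ring_1, 'n) loop_mat)"
  unfolding supp_iff by (auto simp: loop_nth_scale loop_nth_map mat_def weight_diag)

lemma supp_sum: "(\<And>k. k \<in> S \<Longrightarrow> supp P (y k)) \<Longrightarrow> supp P (\<Sum>k\<in>S. (y k :: ('r::comm_ring_1, 'n) loop_mat))"
  by (induction S rule: infinite_finite_induct) (auto intro: supp_add)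

lemma supp_lie:
  fixes X Y :: "('r::comm_ring_1, 'n) loop_mat"
  assumes "supp P X" "supp Q Y" "\<And>a b. P a \<Longrightarrow> Q b \<Longrightarrow> R (a + b)"
  shows "supp R (lie X Y)"
  unfolding lie_def
proof (rule supp_diff)
  show "supp R (X ** Y)" by (rule supp_mult[where P = P and Q = Q]) fact+
  show "supp R (Y ** X)"
    by (rule supp_mult[where P = Q and Q = P]) (use assms in \<open>auto, metis add.commute\<close>)
qed

lemma supp_bounded_above: "\<exists>c. supp (\<lambda>g. g \<le> c) Y"
proof -
  obtain a where a: "\<And>i j l. l < a \<Longrightarrow> loop_nth Y i j l = 0" using loop_nth_bounded_below[of Y] by blast
  define M where "M = Max (range (\<lambda>(i, j). h i - h j))"
  have M: "h i - h j \<le> M" for i j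
    unfolding M_def by (rule Max_ge) (auto intro!: image_eqI[of _ _ "(i, j)"])
  have "supp (\<lambda>g. g \<le> \<kappa> * of_int (- a) + M) Y"
  proof (rule suppI)
    fix i j l assume "loop_nth Y i j l \<noteq> 0"
    then have "a \<le> l" using a not_le by blast
    then have "\<kappa> * of_int (- l) \<le> \<kappa> * of_int (- a)"
      using kappa_pos by simp
    then show "weight i j l \<le> \<kappa> * of_int (- a) + M"
      using M[of i j] by (simp add: weight_def)
  qed
  then show ?thesis by blast
qed

text \<open>Since \<kappa> > 0 and the h_i - h_j take finitely many values, weight and exponent
  control each other, in opposite directions because \<open>l\<close> counts powers of
  \<lambda>^(-1). Hence the positions in one grade are finite in number, and summation bounds can be
  common to a family.\<close>

lemma weight_bounded_below: "\<exists>a. \<forall>i j l. c \<le> weight i j l \<longrightarrow> l \<le> a"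
  and weight_bounded_above: "\<exists>a. \<forall>i j l. weight i j l \<le> c \<longrightarrow> a \<le> l"
proof -
  define M where "M = Max (range (\<lambda>(i, j). h i - h j))"
  have M: "h i - h j \<le> M" for i j
    unfolding M_def by (rule Max_ge) (auto intro!: image_eqI[of _ _ "(i, j)"])
  have "l \<le> \<lceil>(M - c) / \<kappa>\<rceil>" if "c \<le> weight i j l" for i j l
  proof -
    have "of_int l * \<kappa> \<le> M - c"
      using that M[of i j] by (simp add: weight_def algebra_simps)
    then have "of_int l \<le> (M - c) / \<kappa>" using kappa_pos by (simp add: pos_le_divide_eq)
    then show ?thesis by linarith
  qed
  then show "\<exists>a. \<forall>i j l. c \<le> weight i j l \<longrightarrow> l \<le> a" by blast
  have "\<lfloor>(- M - c) / \<kappa>\<rfloor> \<le> l" if "weight i j l \<le> c" for i j l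
  proof -
    have "- M - c \<le> of_int l * \<kappa>"
      using that M[of j i] by (simp add: weight_def algebra_simps)
    then have "(- M - c) / \<kappa> \<le> of_int l" using kappa_pos by (simp add: pos_divide_le_eq)
    then show ?thesis by linarith
  qed
  then show "\<exists>a. \<forall>i j l. weight i j l \<le> c \<longrightarrow> a \<le> l" by blast
qed

text \<open>Separatedness of the grade filtration. It turns agreement of truncations to every order
  into an equality.\<close>

lemma supp_all_zero:
  assumes "\<And>N::nat. supp (\<lambda>g. g \<le> c - real N) Z"
  shows "Z = 0"
proof (rule loop_mat_eqI)
  fix i j l
  obtain N where "c - weight i j l < real N" using reals_Archimedean2 by blast
  then show "loop_nth Z i j l = loop_nth 0 i j l"
    using supp_nth_zero[OF assms[of N], of i j l] by simp
qed

lemma loop_nth_grade_part: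
  "loop_nth (grade_part \<kappa> h P Y) i j l = (if P (weight i j l) then loop_nth Y i j l else 0)"
  unfolding grade_part_def weight_def
  by (auto simp: nth_Abs_fls_lower_bound[of "fls_subdegree (Y $ i $ j)"])

lemma grade_part_supp: "supp P (grade_part \<kappa> h P Y)"
  by (rule suppI) (simp add: loop_nth_grade_part split: if_splits)

lemma supp_grade_part: "supp Q Y \<Longrightarrow> supp Q (grade_part \<kappa> h P Y)"
  by (auto simp: supp_def loop_nth_grade_part split: if_splits)

lemma grade_part_id: "supp P Y \<Longrightarrow> grade_part \<kappa> h P Y = Y"
  by (rule loop_mat_eqI) (auto simp: supp_def loop_nth_grade_part)

lemma grade_part_add: "grade_part \<kappa> h P (X + Y) = grade_part \<kappa> h P X + grade_part \<kappa> h P (Y :: ('r::comm_ring_1, 'n) loop_mat)"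
  by (rule loop_mat_eqI) (simp add: loop_nth_grade_part)

lemma grade_part_map: "\<phi> 0 = 0 \<Longrightarrow> grade_part \<kappa> h P (loop_map \<phi> Y) = loop_map \<phi> (grade_part \<kappa> h P Y)"
  by (rule loop_mat_eqI) (simp add: loop_nth_grade_part loop_nth_map)

lemma grade_part_nonneg_plus_neg:
  "grade_part \<kappa> h (\<lambda>g. g \<ge> 0) Y + grade_part \<kappa> h (\<lambda>g. g < 0) Y = (Y :: ('r::comm_ring_1, 'n) loop_mat)"
  by (rule loop_mat_eqI) (simp add: loop_nth_grade_part)

text \<open>Coefficient 0 of a diagonal entry has weight 0, so the projection does not change it.
  Cyclicity is then that of the ordinary trace over the commutative ring of Laurent series.\<close>

lemma graded_trace_eq: "graded_trace \<kappa> h Y = (\<Sum>i\<in>UNIV. loop_nth Y i i 0)"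
  by (simp add: graded_trace_def trace_def fls_nth_sum loop_nth_grade_part)

lemma graded_trace_trace: "graded_trace \<kappa> h Y = fls_nth (trace Y) 0"
  by (simp add: graded_trace_eq trace_def fls_nth_sum)

lemma graded_trace_add: "graded_trace \<kappa> h (X + Y) = graded_trace \<kappa> h X + graded_trace \<kappa> h (Y :: ('r::comm_ring_1, 'n) loop_mat)"
  and graded_trace_diff: "graded_trace \<kappa> h (X - Y) = graded_trace \<kappa> h X - graded_trace \<kappa> h (Y :: ('r::comm_ring_1, 'n) loop_mat)"
  and graded_trace_minus: "graded_trace \<kappa> h (- X) = - graded_trace \<kappa> h (X :: ('r::comm_ring_1, 'n) loop_mat)"
  unfolding graded_trace_eq by (simp_all add: sum.distrib sum_subtractf sum_negf)

lemma graded_trace_commute: "graded_trace \<kappa> h (X ** Y) = graded_trace \<kappa> h (Y ** (X :: ('r::comm_ring_1, 'n) loop_mat))"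
  unfolding graded_trace_trace by (subst trace_mul_sym) (rule refl)

text \<open>Invariance of the trace form: both sides contain X Y Z, and the remaining terms Y X Z
  and X Z Y are cyclic rotations of each other.\<close>

lemma graded_trace_lie:
  "graded_trace \<kappa> h (lie X Y ** Z) = graded_trace \<kappa> h (X ** lie Y (Z :: ('r::comm_ring_1, 'n) loop_mat))"
proof -
  have "graded_trace \<kappa> h (Y ** (X ** Z)) = graded_trace \<kappa> h (X ** Z ** Y)"
    by (rule graded_trace_commute)
  then show ?thesis
    unfolding lie_def matrix_ring_simps graded_trace_diff by (rule arg_cong)
qed

text \<open>Convergence measured by grade instead of by powers of \<lambda>. Unlike
  \<open>sums\<close>, its error estimate can be fed directly into \<open>supp_mult\<close>.\<close>

definition graded_series :: "(nat \<Rightarrow> ('r::comm_ring_1, 'n) loop_mat) \<Rightarrow> ('r, 'n) loop_mat \<Rightarrow> bool" where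
  "graded_series y Y \<longleftrightarrow> (\<forall>N. supp (\<lambda>g. g \<le> - real N) (Y - (\<Sum>k<N. y k)))"

lemma graded_series_nth:
  assumes "graded_series y Y" "- real N < weight i j l"
  shows "loop_nth Y i j l = (\<Sum>k<N. loop_nth (y k) i j l)"
proof -
  have "loop_nth (Y - (\<Sum>k<N. y k)) i j l = 0"
    using assms supp_nth_zero[of "\<lambda>g. g \<le> - real N" "Y - (\<Sum>k<N. y k)" i j l]
    by (auto simp: graded_series_def)
  then show ?thesis by (simp add: fls_nth_sum)
qed

lemma graded_series_supp:
  assumes "graded_series y Y" "\<And>k. supp P (y k)"
  shows "supp P Y"
proof (rule suppI)
  fix i j l assume nz: "loop_nth Y i j l \<noteq> 0"
  obtain N where "- weight i j l < real N" using reals_Archimedean2 by blast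
  with graded_series_nth[OF assms(1), of N i j l] nz have "loop_nth (\<Sum>k<N. y k) i j l \<noteq> 0"
    by (simp add: fls_nth_sum)
  then show "P (weight i j l)"
    by (rule suppD[OF supp_sum, rotated]) (rule assms(2))
qed

text \<open>At each position the limit agrees with a late partial sum, and terms of index at least
  \<open>N\<close> do not reach weights above -N.\<close>

lemma sums_graded_series:
  assumes "y sums Y" "\<And>k. supp (\<lambda>g. g \<le> - real k) (y k)"
  shows "graded_series y Y"
  unfolding graded_series_def
proof (intro allI suppI)
  fix N i j l assume nz: "loop_nth (Y - (\<Sum>k<N. y k)) i j l \<noteq> 0"
  show "weight i j l \<le> - real N"
  proof (rule ccontr)
    assume w: "\<not> weight i j l \<le> - real N"
    have "(\<lambda>n. (\<Sum>k<n. y k) $ i $ j) \<longlonglongrightarrow> Y $ i $ j"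
      using assms(1) unfolding sums_def by (intro tendsto_vec_nth)
    then have "\<forall>\<^sub>F n in sequentially. loop_nth (\<Sum>k<n. y k) i j l = loop_nth Y i j l"
      by (rule fls_tendsto_nth)
    then obtain M where M: "loop_nth (\<Sum>k<n. y k) i j l = loop_nth Y i j l" if "n \<ge> M" for n
      unfolding eventually_sequentially by blast
    have "loop_nth (y k) i j l = 0" if "k \<ge> N" for k
      by (rule supp_nth_zero[OF assms(2)]) (use that w in simp)
    then have "(\<Sum>k<max M N. loop_nth (y k) i j l) = (\<Sum>k<N. loop_nth (y k) i j l)"
      by (intro sum.mono_neutral_right) auto
    with M[of "max M N"] nz show False
      by (simp add: fls_nth_sum)
  qed
qed

text \<open>Completeness of the grade filtration; it supplies the Neumann series of
  \<open>unipotent_inverse\<close>.\<close>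

lemma graded_series_exists:
  assumes "\<And>k. supp (\<lambda>g. g \<le> - real k) (y k)"
  shows "\<exists>Y. graded_series y Y"
proof -
  \<comment> \<open>A number of terms that suffices at (i, j, l): term k vanishes there once -k is
    below the weight.\<close>
  define N where "N = (\<lambda>i j l. nat \<lceil>- weight i j l\<rceil> + 1)"
  define Y where "Y = (\<chi> i j. Abs_fls (\<lambda>l. \<Sum>k<N i j l. loop_nth (y k) i j l))"
  \<comment> \<open>All terms have grade at most 0 and so vanish for \<open>l < a\<close>; this
    makes the coefficients those of a Laurent series.\<close>
  obtain a where a: "\<And>i j l. weight i j l \<le> 0 \<Longrightarrow> a \<le> l" using weight_bounded_above by blast
  have "loop_nth (y k) i j l = 0" if "l < a" for i j l k
    by (rule supp_nth_zero[OF assms]) (use that a[of i j l] in force)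
  then have Y: "loop_nth Y i j l = (\<Sum>k<N i j l. loop_nth (y k) i j l)" for i j l
    unfolding Y_def by (simp add: nth_Abs_fls_lower_bound[of a])
  have "loop_nth Y i j l = (\<Sum>k<M. loop_nth (y k) i j l)" if M: "- real M < weight i j l" for i j l M
  proof -
    have "loop_nth (y k) i j l = 0" if "- real k < weight i j l" for k
      by (rule supp_nth_zero[OF assms]) (use that in simp)
    moreover have "- real k < weight i j l" if "k \<ge> N i j l" for k
    proof -
      have "- weight i j l < real (N i j l)" unfolding N_def by linarith
      with that show ?thesis by linarith
    qed
    moreover have "- real k < weight i j l" if "k \<ge> M" for k using M that by linarith
    ultimately show ?thesis
      unfolding Y by (intro sum.mono_neutral_cong) (auto simp: not_less)
  qed
  then have "supp (\<lambda>g. g \<le> - real M) (Y - (\<Sum>k<M. y k))" for M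
    by (intro suppI) (auto simp: fls_nth_sum not_less[symmetric])
  then show ?thesis unfolding graded_series_def by blast
qed

end

section \<open>Exponentials and dressing\<close>

abbreviation neg_grade :: "real \<Rightarrow> bool" where
  "neg_grade g \<equiv> g \<in> \<int> \<and> g \<le> - 1"

text \<open>As \<open>*\<close> is componentwise on vectors, the power of the type class is not the
  matrix power; this is the iteration occurring in \<open>is_exp\<close>.\<close>

definition mat_pow :: "'a::semiring_1 ^ 'n ^ 'n \<Rightarrow> nat \<Rightarrow> 'a ^ 'n ^ 'n" where
  "mat_pow X k = (((**) X) ^^ k) (mat 1)"

lemma mat_pow_0: "mat_pow X 0 = mat 1" and mat_pow_Suc: "mat_pow X (Suc k) = X ** mat_pow X k"
  by (simp_all add: mat_pow_def)

lemma mat_pow_commute: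
  assumes "C ** X = X ** C" shows "C ** mat_pow X k = mat_pow X k ** C"
  by (induction k) (simp_all add: mat_pow_0 mat_pow_Suc matrix_mul_assoc assms, simp add: matrix_mul_assoc[symmetric])

lemma mat_pow_Suc_right: "mat_pow X (Suc k) = mat_pow X k ** X"
  by (simp add: mat_pow_Suc mat_pow_commute)

lemma geometric_sum_mat:
  fixes X :: "'a::ring_1 ^ 'n ^ 'n"
  shows "(mat 1 - X) ** (\<Sum>k<n. mat_pow X k) = mat 1 - mat_pow X n"
    and "(\<Sum>k<n. mat_pow X k) ** (mat 1 - X) = mat 1 - mat_pow X n"
proof -
  show "(mat 1 - X) ** (\<Sum>k<n. mat_pow X k) = mat 1 - mat_pow X n"
    by (induction n) (simp_all add: mat_pow_0 mat_pow_Suc matrix_add_ldistrib matrix_diff_rdistrib)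
  show "(\<Sum>k<n. mat_pow X k) ** (mat 1 - X) = mat 1 - mat_pow X n"
  proof (induction n)
    case (Suc n)
    have "mat_pow X n ** (mat 1 - X) = mat_pow X n - mat_pow X (Suc n)"
      by (simp add: matrix_diff_ldistrib mat_pow_Suc_right)
    then show ?case by (simp add: matrix_add_rdistrib Suc)
  qed (simp add: mat_pow_0)
qed

context loop_grading begin

lemma supp_mat_pow:
  fixes X :: "('r::comm_ring_1, 'n) loop_mat"
  assumes "supp neg_grade X"
  shows "supp (\<lambda>g. g \<in> \<int> \<and> g \<le> - real k) (mat_pow X k)"
proof (induction k)
  case (Suc k)
  show ?case
    unfolding mat_pow_Suc by (rule supp_mult[OF assms Suc]) auto
qed (simp add: mat_pow_0 supp_one)

lemma graded_series_nonpos: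
  assumes "graded_series y Y" "\<And>k. supp (\<lambda>g. g \<in> \<int> \<and> g \<le> - real k) (y k)"
  shows "supp (\<lambda>g. g \<in> \<int>) Y" and "supp neg_grade (Y - y 0)"
proof -
  have y: "supp (\<lambda>g. g \<in> \<int>) (y k)" for k
    using assms(2)[of k] by (rule supp_mono) simp
  then show Y: "supp (\<lambda>g. g \<in> \<int>) Y"
    by (rule graded_series_supp[OF assms(1)])
  have "supp (\<lambda>g. g \<le> - real 1) (Y - (\<Sum>k<1. y k))"
    using assms(1) unfolding graded_series_def by blast
  then have "supp (\<lambda>g. g \<le> - 1) (Y - y 0)" by simp
  then show "supp neg_grade (Y - y 0)"
    by (rule supp_conj[OF supp_diff[OF Y y]])
qed

text \<open>Neumann series: with N = 1 - U the partial geometric sums invert U up to N^n, which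
  sinks below every grade.\<close>

lemma unipotent_inverse:
  fixes U :: "('r::comm_ring_1, 'n) loop_mat"
  assumes U: "supp neg_grade (U - mat 1)"
  obtains V where "U ** V = mat 1" "V ** U = mat 1" "supp neg_grade (V - mat 1)"
proof -
  define N where "N = mat 1 - U"
  have "supp neg_grade N" using supp_minus[OF U] by (simp add: N_def)
  note N = supp_mat_pow[OF this]
  have Nn: "supp (\<lambda>g. g \<le> - real n) (mat_pow N n)" for n
    using N by (rule supp_mono) simp
  obtain V where V: "graded_series (mat_pow N) V"
    using graded_series_exists[of "mat_pow N", OF Nn] by blast
  have UN: "U = mat 1 - N" by (simp add: N_def)
  have U0: "supp (\<lambda>g. g \<le> 0) U"
  proof -
    have "supp (\<lambda>g. g \<le> 0) (U - mat 1)" using U by (rule supp_mono) auto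
    then have "supp (\<lambda>g. g \<le> 0) (U - mat 1 + mat 1)" by (intro supp_add supp_one) auto
    then show ?thesis by simp
  qed
  have tail: "supp (\<lambda>g. g \<le> - real n) (V - (\<Sum>k<n. mat_pow N k))" for n
    using V unfolding graded_series_def by blast
  have "U ** V - mat 1 = 0"
  proof (rule supp_all_zero[of 0])
    fix n
    have "U ** V - mat 1 = U ** (V - (\<Sum>k<n. mat_pow N k)) - mat_pow N n"
      unfolding matrix_diff_ldistrib using geometric_sum_mat(1)[of N n] by (simp add: UN)
    moreover have "supp (\<lambda>g. g \<le> - real n) (U ** (V - (\<Sum>k<n. mat_pow N k)))"
      by (rule supp_mult[OF U0 tail]) simp
    ultimately show "supp (\<lambda>g. g \<le> 0 - real n) (U ** V - mat 1)"
      using Nn by (simp add: supp_diff)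
  qed
  moreover have "V ** U - mat 1 = 0"
  proof (rule supp_all_zero[of 0])
    fix n
    have "V ** U - mat 1 = (V - (\<Sum>k<n. mat_pow N k)) ** U - mat_pow N n"
      unfolding matrix_diff_rdistrib using geometric_sum_mat(2)[of N n] by (simp add: UN)
    moreover have "supp (\<lambda>g. g \<le> - real n) ((V - (\<Sum>k<n. mat_pow N k)) ** U)"
      by (rule supp_mult[OF tail U0]) simp
    ultimately show "supp (\<lambda>g. g \<le> 0 - real n) (V ** U - mat 1)"
      using Nn by (simp add: supp_diff)
  qed
  moreover have "supp neg_grade (V - mat 1)"
    using graded_series_nonpos(2)[OF V N] by (simp add: mat_pow_0)
  ultimately show thesis using that by simp
qed

lemma unipotent_supp:
  fixes U :: "('r::comm_ring_1, 'n) loop_mat"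
  assumes "supp neg_grade (U - mat 1)"
  shows "supp (\<lambda>g. g \<in> \<int> \<and> g \<le> 0) U"
proof -
  have "supp (\<lambda>g. g \<in> \<int> \<and> g \<le> 0) (U - mat 1)" using assms by (rule supp_mono) auto
  then have "supp (\<lambda>g. g \<in> \<int> \<and> g \<le> 0) (U - mat 1 + mat 1)" by (intro supp_add supp_one) auto
  then show ?thesis by simp
qed

text \<open>[C, Y] equals the commutator of C with any tail of the series. As the grades of C are
  bounded above, it lies below every grade.\<close>

lemma graded_series_commute:
  fixes C :: "('r::comm_ring_1, 'n) loop_mat"
  assumes "graded_series y Y" "\<And>k. C ** y k = y k ** C"
  shows "C ** Y = Y ** C"
proof -
  obtain c where C: "supp (\<lambda>g. g \<le> c) C" using supp_bounded_above by blast
  have "C ** Y - Y ** C = 0"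
  proof (rule supp_all_zero[of c])
    fix n
    let ?T = "Y - (\<Sum>k<n. y k)"
    have T: "supp (\<lambda>g. g \<le> - real n) ?T"
      using assms(1) unfolding graded_series_def by blast
    have "C ** Y - Y ** C = C ** ?T - ?T ** C"
      by (simp add: matrix_diff_ldistrib matrix_diff_rdistrib matrix_sum_ldistrib matrix_sum_rdistrib assms(2))
    moreover have "supp (\<lambda>g. g \<le> c - real n) (C ** ?T)" by (rule supp_mult[OF C T]) simp
    moreover have "supp (\<lambda>g. g \<le> c - real n) (?T ** C)" by (rule supp_mult[OF T C]) simp
    ultimately show "supp (\<lambda>g. g \<le> c - real n) (C ** Y - Y ** C)"
      by (simp add: supp_diff)
  qed
  then show ?thesis by simp
qed

end

text \<open>Testing the operator identity on the constant vectors \<open>axis j 1\<close>, which are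
  annihilated by the derivative, gives the matrix equation column by column.\<close>

lemma conj_op_lax_op:
  fixes U V :: "('r::comm_ring_1, 'n::finite) loop_mat"
  assumes "algebra_derivation \<iota> D" "U ** V = mat 1" "V ** U = mat 1"
    and conj: "conj_op U (lax_op D M) = lax_op D M'"
  shows "loop_map D U = U ** M' - M ** U"
proof -
  interpret algebra_derivation \<iota> D by fact
  have entry: "(X *v axis j 1) $ i = X $ i $ j" for X :: "('r, 'n) loop_mat" and i j
    by (simp add: matrix_vector_mult_def axis_def if_distrib cong: if_cong)
  have "loop_map D U $ i $ j + (M ** U) $ i $ j = (U ** M') $ i $ j" for i j
  proof -
    let ?v = "axis j 1 :: 'r fls ^ 'n"
    have V: "matrix_inv U = V" by (rule matrix_inv_eqI) fact+
    have "V *v lax_op D M (U *v ?v) = lax_op D M' ?v"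
      using fun_cong[OF conj, of ?v] by (simp add: conj_op_def V)
    then have "U *v (V *v lax_op D M (U *v ?v)) = U *v lax_op D M' ?v" by simp
    then have "lax_op D M (U *v ?v) = U *v lax_op D M' ?v"
      by (simp add: matrix_vector_mul_assoc assms)
    moreover have "(\<chi> i. fls_map D (?v $ i)) = 0"
      by (simp add: vec_eq_iff fls_eq_iff fls_nth_map axis_def)
    ultimately have "(\<chi> i. fls_map D ((U *v ?v) $ i)) + (M ** U) *v ?v = (U ** M') *v ?v"
      by (simp add: lax_op_def matrix_vector_mul_assoc)
    then have "((\<chi> i. fls_map D ((U *v ?v) $ i)) + (M ** U) *v ?v) $ i = ((U ** M') *v ?v) $ i"
      by simp
    then show ?thesis by (simp add: entry loop_map_def)
  qed
  then show ?thesis by (simp add: vec_eq_iff eq_diff_eq)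
qed

section \<open>The grading operator, homogeneous elements and negative series\<close>

locale graded_algebra = loop_grading \<kappa> h + algebra_hom \<iota>
  for \<kappa> :: real and h :: "'n::finite \<Rightarrow> real" and \<iota> :: "complex \<Rightarrow> 'r::comm_ring_1"
begin

lemma loop_nth_grading_op:
  fixes Y :: "('r, 'n) loop_mat"
  shows "loop_nth (grading_op \<iota> \<kappa> h Y) i j l = \<iota> (of_real (weight i j l)) * loop_nth Y i j l"
proof -
  have "(diag_mat d ** Y) $ i $ j = d i * Y $ i $ j" "(Y ** diag_mat d) $ i $ j = Y $ i $ j * d j" for d
    by (simp_all add: matrix_matrix_mult_def diag_mat_def if_distrib if_distribR cong: if_cong)
  then have "loop_nth (grading_op \<iota> \<kappa> h Y) i j l =
      (- (\<iota> (of_real \<kappa>) * \<iota> (of_int l)) + \<iota> (of_real (h i)) - \<iota> (of_real (h j))) * loop_nth Y i j l"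
    by (simp add: grading_op_def loop_nth_scale lie_def fls_X_times_conv_shift hom_of_int algebra_simps)
  also have "- (\<iota> (of_real \<kappa>) * \<iota> (of_int l)) + \<iota> (of_real (h i)) - \<iota> (of_real (h j)) = \<iota> (of_real (weight i j l))"
    by (simp add: weight_def hom_add hom_mult hom_diff hom_minus)
  finally show ?thesis .
qed

text \<open>The Leibniz rule is the additivity of weights along a matrix product,
  \<open>weight_add\<close>, carried over by \<iota>.\<close>

lemma grading_op_mult:
  fixes X Y :: "('r, 'n) loop_mat"
  shows "grading_op \<iota> \<kappa> h (X ** Y) = grading_op \<iota> \<kappa> h X ** Y + X ** grading_op \<iota> \<kappa> h Y"
proof (rule loop_mat_eqI)
  fix i j l
  obtain a where a: "\<And>i j l. l < a \<Longrightarrow> loop_nth X i j l = 0" using loop_nth_bounded_below[of X] by blast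
  obtain b where b: "\<And>i j l. l < b \<Longrightarrow> loop_nth Y i j l = 0" using loop_nth_bounded_below[of Y] by blast
  note ab = a b
  have w: "\<iota> (of_real (weight i j l)) = \<iota> (of_real (weight i k l')) + \<iota> (of_real (weight k j (l - l')))" for k l'
    by (simp add: weight_add[of i k l' j l, symmetric] hom_add)
  have "loop_nth (grading_op \<iota> \<kappa> h (X ** Y)) i j l =
      (\<Sum>k\<in>UNIV. \<Sum>l'=a..l-b. \<iota> (of_real (weight i j l)) * (loop_nth X i k l' * loop_nth Y k j (l - l')))"
    by (simp add: loop_nth_grading_op loop_nth_mult[of a _ b] ab sum_distrib_left)
  also have "\<dots> = (\<Sum>k\<in>UNIV. \<Sum>l'=a..l-b.
      (\<iota> (of_real (weight i k l')) * loop_nth X i k l') * loop_nth Y k j (l - l')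
      + loop_nth X i k l' * (\<iota> (of_real (weight k j (l - l'))) * loop_nth Y k j (l - l')))"
  proof (intro sum.cong refl)
    show "\<iota> (of_real (weight i j l)) * (loop_nth X i k l' * loop_nth Y k j (l - l')) =
        (\<iota> (of_real (weight i k l')) * loop_nth X i k l') * loop_nth Y k j (l - l')
        + loop_nth X i k l' * (\<iota> (of_real (weight k j (l - l'))) * loop_nth Y k j (l - l'))" for k l'
      by (simp add: w[of k l'] algebra_simps)
  qed
  also have "\<dots> = loop_nth (grading_op \<iota> \<kappa> h X ** Y + X ** grading_op \<iota> \<kappa> h Y) i j l"
    by (simp add: loop_nth_mult[of a _ b] ab loop_nth_grading_op sum.distrib)
  finally show "loop_nth (grading_op \<iota> \<kappa> h (X ** Y)) i j l = loop_nth (grading_op \<iota> \<kappa> h X ** Y + X ** grading_op \<iota> \<kappa> h Y) i j l" .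
qed

lemma grading_op_add: "grading_op \<iota> \<kappa> h (X + Y) = grading_op \<iota> \<kappa> h X + grading_op \<iota> \<kappa> h (Y :: ('r, 'n) loop_mat)"
  and grading_op_diff: "grading_op \<iota> \<kappa> h (X - Y) = grading_op \<iota> \<kappa> h X - grading_op \<iota> \<kappa> h (Y :: ('r, 'n) loop_mat)"
  by (rule loop_mat_eqI, simp add: loop_nth_grading_op algebra_simps)+

lemma grading_op_lie:
  fixes X Y :: "('r, 'n) loop_mat"
  shows "grading_op \<iota> \<kappa> h (lie X Y) = lie (grading_op \<iota> \<kappa> h X) Y + lie X (grading_op \<iota> \<kappa> h Y)"
  by (simp add: lie_def grading_op_diff grading_op_mult)

lemma grading_op_homogeneous:
  "supp (\<lambda>g. g = c) Y \<Longrightarrow> grading_op \<iota> \<kappa> h Y = loop_scale (\<iota> (of_real c)) (Y :: ('r, 'n) loop_mat)"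
  by (rule loop_mat_eqI, unfold loop_nth_grading_op loop_nth_scale supp_def) (metis mult_zero_right)

lemma supp_ext_span:
  assumes "Y \<in> ext_span \<iota> V" "\<And>v. v \<in> V \<Longrightarrow> supp P v"
  shows "supp P Y"
  using assms(1) unfolding ext_span_def
proof (induction rule: loop_module.span_induct_alt)
  case (step c x y)
  then show ?case using assms(2) by (auto intro!: supp_add supp_scale supp_map)
qed simp

lemma commute_ext_span:
  fixes C :: "('r, 'n) loop_mat"
  assumes "Y \<in> ext_span \<iota> V" "\<And>v. v \<in> V \<Longrightarrow> C ** loop_map \<iota> v = loop_map \<iota> v ** C"
  shows "C ** Y = Y ** C"
  using assms(1) unfolding ext_span_def
proof (induction rule: loop_module.span_induct_alt)
  case (step c x y)
  then show ?case using assms(2)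
    by (auto simp: matrix_add_ldistrib matrix_add_rdistrib loop_scale_mult_left loop_scale_mult_right)
qed simp

end

context loop_grading begin

text \<open>Over \<open>complex\<close> a nonzero coefficient cancels from the eigenvalue equation.
  Elements with coefficients in \<open>'r\<close> inherit their support through
  \<open>ext_span\<close> instead.\<close>

lemma homog_supp:
  assumes "Y \<in> homog \<kappa> h V n" shows "supp (\<lambda>g. g = of_int n) Y"
proof -
  interpret graded_algebra \<kappa> h "\<lambda>c. c"
    by unfold_locales (simp add: complex_algebra_def)
  show ?thesis
  proof (rule suppI)
    fix i j l assume nz: "loop_nth Y i j l \<noteq> 0"
    have "loop_nth (grading_op (\<lambda>c. c) \<kappa> h Y) i j l = loop_nth (loop_scale (of_int n) Y) i j l"
      using assms by (simp add: homog_def)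
    then have "complex_of_real (weight i j l) * loop_nth Y i j l = of_int n * loop_nth Y i j l"
      unfolding loop_nth_grading_op loop_nth_scale .
    then have "complex_of_real (weight i j l) = of_int n"
      using nz unfolding mult_cancel_right by blast
    then show "weight i j l = of_int n" 
      by (metis of_real_eq_iff of_real_of_int_eq)
  qed
qed

end

context graded_algebra begin

lemma supp_ext_span_homog:
  assumes "Y \<in> ext_span \<iota> (homog \<kappa> h V n)" shows "supp (\<lambda>g. g = of_int n) Y"
  using assms homog_supp by (rule supp_ext_span)

text \<open>Distinct terms occupy distinct grades, so a position of weight -j sees only
  \<open>u j\<close>. The recursion for the dressing uses this to recover a homogeneous component
  from the limit.\<close>

lemma negative_seriesE:
  assumes "X \<in> negative_series \<iota> \<kappa> h V"
  obtains u where "\<And>j. j \<ge> 1 \<Longrightarrow> u j \<in> ext_span \<iota> (homog \<kappa> h V (- int j))"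
    and "graded_series (\<lambda>j. u (Suc j)) X"
    and "supp neg_grade X"
    and "\<And>j i i' l. j \<ge> 1 \<Longrightarrow> weight i i' l = - real j \<Longrightarrow> loop_nth X i i' l = loop_nth (u j) i i' l"
proof -
  obtain u where u: "\<And>j. j \<ge> 1 \<Longrightarrow> u j \<in> ext_span \<iota> (homog \<kappa> h V (- int j))"
    and "(\<lambda>j. u (Suc j)) sums X"
    using assms unfolding negative_series_def by blast
  have supp_u: "supp (\<lambda>g. g = - real j) (u j)" if "j \<ge> 1" for j
    using supp_ext_span_homog[OF u[OF that]] by simp
  have X: "graded_series (\<lambda>j. u (Suc j)) X"
    by (rule sums_graded_series) (fact, rule supp_mono[OF supp_u], auto)
  show thesis
  proof (rule that[OF u X])
    show "supp neg_grade X"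
      by (rule graded_series_supp[OF X], rule supp_mono[OF supp_u]) auto
    fix j i i' l assume j: "j \<ge> 1" and w: "weight i i' l = - real j"
    have "loop_nth X i i' l = (\<Sum>k<Suc j. loop_nth (u (Suc k)) i i' l)"
      by (rule graded_series_nth[OF X]) (simp add: w)
    \<comment> \<open>The series is indexed from 0, so \<open>u j\<close> is its term number j -
      1.\<close>
    also have "\<dots> = (\<Sum>k\<in>{j - 1}. loop_nth (u (Suc k)) i i' l)"
    proof (rule sum.mono_neutral_right)
      show "\<forall>k\<in>{..<Suc j} - {j - 1}. loop_nth (u (Suc k)) i i' l = 0"
      proof
        fix k assume "k \<in> {..<Suc j} - {j - 1}"
        then show "loop_nth (u (Suc k)) i i' l = 0"
          by (intro supp_nth_zero[OF supp_u]) (auto simp: w)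
      qed
    qed (use j in auto)
    finally show "loop_nth X i i' l = loop_nth (u j) i i' l" using j by simp
  qed
qed

lemma is_exp_series:
  assumes "is_exp \<iota> X U" "supp neg_grade X"
  shows "graded_series (\<lambda>k. loop_scale (\<iota> (1 / fact k)) (mat_pow X k)) U"
proof (rule sums_graded_series)
  show "(\<lambda>k. loop_scale (\<iota> (1 / fact k)) (mat_pow X k)) sums U"
    using assms(1) by (simp add: is_exp_def mat_pow_def)
  show "supp (\<lambda>g. g \<le> - real k) (loop_scale (\<iota> (1 / fact k)) (mat_pow X k))" for k
    by (rule supp_scale, rule supp_mono[OF supp_mat_pow[OF assms(2)]]) simp
qed

lemma is_exp_unipotent:
  assumes "is_exp \<iota> X U" "supp neg_grade X"
  shows "supp neg_grade (U - mat 1)"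
proof -
  have "supp neg_grade (U - loop_scale (\<iota> (1 / fact 0)) (mat_pow X 0))"
    by (rule graded_series_nonpos(2)[OF is_exp_series[OF assms]])
      (intro supp_scale supp_mat_pow[OF assms(2)])
  then show ?thesis by (simp add: mat_pow_0 hom_one)
qed

lemma is_exp_commute:
  fixes C :: "('r, 'n) loop_mat"
  assumes "is_exp \<iota> X U" "supp neg_grade X" "C ** X = X ** C"
  shows "C ** U = U ** C"
  by (rule graded_series_commute[OF is_exp_series[OF assms(1,2)]])
    (simp add: loop_scale_mult_left loop_scale_mult_right mat_pow_commute[OF assms(3)])

lemma negative_series_commute:
  fixes C :: "('r, 'n) loop_mat"
  assumes "X \<in> negative_series \<iota> \<kappa> h V" "\<And>v. v \<in> V \<Longrightarrow> C ** loop_map \<iota> v = loop_map \<iota> v ** C"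
  shows "C ** X = X ** C"
proof -
  obtain u where u: "\<And>j. j \<ge> 1 \<Longrightarrow> u j \<in> ext_span \<iota> (homog \<kappa> h V (- int j))"
    and X: "graded_series (\<lambda>j. u (Suc j)) X"
    using negative_seriesE[OF assms(1)] by metis
  show ?thesis
  proof (rule graded_series_commute[OF X])
    show "C ** u (Suc k) = u (Suc k) ** C" for k
      by (rule commute_ext_span[OF u]) (use assms(2) in \<open>auto simp: homog_def\<close>)
  qed
qed

lemma lie_zero_commute:
  assumes "lie c v = 0"
  shows "loop_map \<iota> c ** loop_map \<iota> v = loop_map \<iota> v ** loop_map \<iota> (c :: (complex, 'n) loop_mat)"
  using loop_map_lie[of c v] assms by (simp add: lie_def loop_map_zero)

end

section \<open>The conservation law\<close>

context graded_algebra begin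

lemma derivation_graded_trace:
  assumes "derivation \<iota> D"
  shows "D (graded_trace \<kappa> h Y) = graded_trace \<kappa> h (loop_map D Y)"
proof -
  interpret algebra_derivation \<iota> D by unfold_locales fact
  show ?thesis by (simp add: graded_trace_eq D_sum loop_nth_map)
qed

text \<open>
  Commutativity of the flows is not assumed.  The equation \<open>D B = [B, L] + Z\<close>, with \<open>Z\<close> of grade zero and
  hence annihilated by the grading operator, takes the place of the zero curvature condition.
\<close>

lemma conservation_law:
  fixes T V A :: "('r, 'n) loop_mat" and E bm bn :: "(complex, 'n) loop_mat"
  defines "W \<equiv> \<lambda>c. T ** loop_map \<iota> c ** V"
  assumes D: "derivation \<iota> D" and d: "derivation \<iota> d"
    and TV: "T ** V = mat 1" "V ** T = mat 1"
    and supp_TV: "supp (\<lambda>g. g \<in> \<int>) T" "supp (\<lambda>g. g \<in> \<int>) V"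
    and supp_E: "supp (\<lambda>g. g = 1) E" and supp_A: "supp (\<lambda>g. g = 0) A"
    and supp_bm: "supp (\<lambda>g. g \<in> \<int>) bm"
    and comm: "lie E bm = 0" "lie E bn = 0" "lie bm bn = 0"
    and dressing: "loop_map D T = T ** loop_map \<iota> E - (loop_map \<iota> E + A) ** T"
    and flow_x: "loop_map D T = grade_part \<kappa> h (\<lambda>g. g < 0) (W E) ** T"
    and flow_t: "loop_map d T = grade_part \<kappa> h (\<lambda>g. g < 0) (W bm) ** T"
  shows "d (- graded_trace \<kappa> h (loop_map \<iota> E ** W bn))
      + D (graded_trace \<kappa> h (grading_op \<iota> \<kappa> h (grade_part \<kappa> h (\<lambda>g. g \<ge> 0) (W bm)) ** W bn)) = 0"
proof -
  interpret D: algebra_derivation \<iota> D by unfold_locales fact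
  interpret d: algebra_derivation \<iota> d by unfold_locales fact
  let ?Q = "grading_op \<iota> \<kappa> h" and ?tr = "graded_trace \<kappa> h"
  let ?E = "loop_map \<iota> E"
  define L where "L = ?E + A"
  define B where "B = grade_part \<kappa> h (\<lambda>g. g \<ge> 0) (W bm)"
  define N where "N = grade_part \<kappa> h (\<lambda>g. g < 0) (W bm)"
  have BN: "W bm = B + N"
    unfolding B_def N_def by (rule grade_part_nonneg_plus_neg[symmetric])
  have W_mult: "W a ** W b = W (a ** b)" for a b
  proof -
    have "W a ** W b = T ** loop_map \<iota> a ** (V ** T) ** loop_map \<iota> b ** V"
      by (simp add: W_def matrix_mul_assoc)
    then show ?thesis by (simp add: TV W_def loop_map_mult matrix_mul_assoc)
  qed
  have W_lie: "lie (W a) (W b) = 0" if "lie a b = 0" for a b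
    using that by (simp add: lie_def W_mult)
  \<comment> \<open>Comparison of the dressing equation with the x-flow: the negative part of W_E is
    W_E - L, so its nonnegative part is L itself.\<close>
  have WE: "grade_part \<kappa> h (\<lambda>g. g < 0) (W E) = W E - L"
  proof -
    have "grade_part \<kappa> h (\<lambda>g. g < 0) (W E) ** (T ** V) = (T ** ?E - L ** T) ** V"
      using flow_x dressing by (simp add: matrix_mul_assoc L_def)
    also have "\<dots> = W E - L ** (T ** V)"
      by (simp add: W_def matrix_diff_rdistrib matrix_mul_assoc)
    finally show ?thesis by (simp add: TV)
  qed
  have DW: "loop_map D (W c) = lie (W c) L" if "lie E c = 0" for c
  proof -
    have "loop_map D (W c) = lie (W E - L) (W c)"
      unfolding WE[symmetric] unfolding W_def by (rule D.DD_conjugate[OF TV flow_x[unfolded W_def]])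
    \<comment> \<open>W_E commutes with W_c because E commutes with c; only the bracket with L
      survives.\<close>
    then show ?thesis by (simp add: lie_diff_left W_lie[OF that] lie_anticomm[of L])
  qed
  have dW: "loop_map d (W bn) = - lie B (W bn)"
  proof -
    have "loop_map d (W bn) = lie N (W bn)"
      using d.DD_conjugate[OF TV flow_t, of bn] by (simp add: W_def N_def)
    moreover have "lie (B + N) (W bn) = 0" unfolding BN[symmetric] by (rule W_lie) fact
    ultimately show ?thesis by (simp add: lie_add_left eq_neg_iff_add_eq_0 add.commute)
  qed
  have supp_L: "supp (\<lambda>g. g \<in> \<int> \<and> 0 \<le> g \<and> g \<le> 1) L"
    unfolding L_def by (intro supp_add supp_map supp_mono[OF supp_E] supp_mono[OF supp_A]) auto
  have supp_W: "supp (\<lambda>g. g \<in> \<int>) (W bm)"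
    unfolding W_def
    by (rule supp_mult[OF supp_mult[OF supp_TV(1) supp_map[OF _ supp_bm], where R = "\<lambda>g. g \<in> \<int>"] supp_TV(2)]) auto
  \<comment> \<open>[N, L] has integral grades below 1, so its nonnegative part is purely of grade
    0.\<close>
  define Z where "Z = grade_part \<kappa> h (\<lambda>g. g \<ge> 0) (lie N L)"
  have "supp (\<lambda>g. g \<in> \<int> \<and> g < 0) N"
    unfolding N_def by (intro supp_conj grade_part_supp supp_grade_part supp_W)
  then have "supp (\<lambda>g. g \<in> \<int> \<and> g < 1) (lie N L)"
    by (rule supp_lie[OF _ supp_L]) auto
  then have "supp (\<lambda>g. (g \<in> \<int> \<and> g < 1) \<and> g \<ge> 0) Z"
    unfolding Z_def by (rule supp_conj[OF supp_grade_part grade_part_supp])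
  then have "supp (\<lambda>g. g = 0) Z"
    by (rule supp_mono) (auto elim!: Ints_cases)
  then have QZ: "?Q Z = 0"
    by (simp add: grading_op_homogeneous)
  have QL: "?Q L = ?E"
    using grading_op_homogeneous[OF supp_map[OF _ supp_E]] grading_op_homogeneous[OF supp_A]
    by (simp add: L_def grading_op_add hom_one)
  have DB: "loop_map D B = lie B L + Z"
  proof -
    have B: "supp (\<lambda>g. g \<ge> 0) B" unfolding B_def by (rule grade_part_supp)
    have BL: "supp (\<lambda>g. g \<ge> 0) (lie B L)" by (rule supp_lie[OF B supp_L]) auto
    have "loop_map D B = grade_part \<kappa> h (\<lambda>g. g \<ge> 0) (lie B L + lie N L)"
    proof -
      have "loop_map D B = grade_part \<kappa> h (\<lambda>g. g \<ge> 0) (loop_map D (W bm))"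
        unfolding B_def by (simp add: grade_part_map)
      then show ?thesis unfolding DW[OF comm(1)] by (simp add: BN lie_add_left)
    qed
    then show ?thesis by (simp add: grade_part_add grade_part_id[OF BL] Z_def)
  qed
  have QDB: "?Q (loop_map D B) = lie (?Q B) L + lie B ?E"
    by (simp add: DB grading_op_add grading_op_lie QZ QL)
  have QD: "?Q (loop_map D B) = loop_map D (?Q B)"
    by (rule loop_mat_eqI) (simp add: loop_nth_grading_op loop_nth_map D.D_mult)
  have "D (?tr (?Q B ** W bn)) = ?tr ((lie (?Q B) L + lie B ?E) ** W bn) + ?tr (?Q B ** lie (W bn) L)"
    by (simp add: derivation_graded_trace[OF D] D.DD_mult QD[symmetric] QDB DW[OF comm(2)] graded_trace_add)
  \<comment> \<open>By invariance of the trace the two terms containing L cancel.\<close>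
  also have "\<dots> = ?tr (lie B ?E ** W bn)"
    by (simp add: matrix_add_rdistrib graded_trace_add graded_trace_lie lie_anticomm[of "W bn" L]
        matrix_minus_right graded_trace_minus)
  also have "\<dots> = - ?tr (?E ** lie B (W bn))"
    by (simp add: lie_anticomm[of B ?E] matrix_minus_left graded_trace_minus graded_trace_lie)
  finally have DQ: "D (?tr (?Q B ** W bn)) = - ?tr (?E ** lie B (W bn))" .
  have "d (- ?tr (?E ** W bn)) = ?tr (?E ** lie B (W bn))"
    by (simp add: d.D_minus derivation_graded_trace[OF d] d.DD_mult d.DD_const dW matrix_minus_right graded_trace_minus)
  with DQ show ?thesis by (simp add: B_def)
qed

section \<open>Matrix form of the dressing hypotheses\<close>

lemma dressing_UD:
  assumes "dressing_U \<iota> D \<kappa> h G E A U Km" and "derivation \<iota> D"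
  obtains X V where "X \<in> negative_series \<iota> \<kappa> h (ad_im G E)" "is_exp \<iota> X U" "supp neg_grade (U - mat 1)"
    "U ** V = mat 1" "V ** U = mat 1" "matrix_inv U = V" "supp neg_grade (V - mat 1)"
    "loop_map D U = U ** (loop_map \<iota> E + Km) - (loop_map \<iota> E + A) ** U"
proof -
  have D: "algebra_derivation \<iota> D" by unfold_locales fact
  obtain X where X: "X \<in> negative_series \<iota> \<kappa> h (ad_im G E)" "is_exp \<iota> X U"
    using assms(1) unfolding dressing_U_def by blast
  then have "supp neg_grade X" using negative_seriesE by blast
  with X(2) have U: "supp neg_grade (U - mat 1)" by (rule is_exp_unipotent)
  then obtain V where V: "U ** V = mat 1" "V ** U = mat 1" "supp neg_grade (V - mat 1)"
    by (rule unipotent_inverse)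
  from assms(1) have "conj_op U (lax_op D (loop_map \<iota> E + A)) = lax_op D (loop_map \<iota> E + Km)"
    by (simp add: dressing_U_def)
  from conj_op_lax_op[OF D V(1,2) this] show thesis
    using that[OF X U V(1,2) matrix_inv_eqI[OF V(1,2)] V(3)] by simp
qed

text \<open>The exponent of S is a series in the kernel of ad E. Every element of the centre of that
  kernel commutes with the exponent, hence with S.\<close>

lemma dressing_SD:
  assumes "dressing_S \<iota> D \<kappa> h G E Km S" and "derivation \<iota> D"
  obtains R where "supp neg_grade (S - mat 1)"
    "S ** R = mat 1" "R ** S = mat 1" "supp neg_grade (R - mat 1)"
    "loop_map D S = S ** loop_map \<iota> E - (loop_map \<iota> E + Km) ** S"
    "\<forall>c\<in>lie_center (ad_ker G E). loop_map \<iota> c ** S = S ** loop_map \<iota> c"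
proof -
  have D: "algebra_derivation \<iota> D" by unfold_locales fact
  obtain X where X: "X \<in> negative_series \<iota> \<kappa> h (ad_ker G E)" "is_exp \<iota> X S"
    using assms(1) unfolding dressing_S_def by blast
  then have supp_X: "supp neg_grade X" using negative_seriesE by blast
  with X(2) have S: "supp neg_grade (S - mat 1)" by (rule is_exp_unipotent)
  then obtain R where R: "S ** R = mat 1" "R ** S = mat 1" "supp neg_grade (R - mat 1)"
    by (rule unipotent_inverse)
  have SD: "loop_map D S = S ** loop_map \<iota> E - (loop_map \<iota> E + Km) ** S"
    by (rule conj_op_lax_op[OF D R(1,2)]) (use assms(1) in \<open>simp add: dressing_S_def\<close>)
  have "loop_map \<iota> c ** S = S ** loop_map \<iota> c" if "c \<in> lie_center (ad_ker G E)" for c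
    by (rule is_exp_commute[OF X(2) supp_X negative_series_commute[OF X(1) lie_zero_commute]])
      (use that in \<open>simp add: lie_center_def\<close>)
  with S R SD show thesis by (intro that[of R]) auto
qed

lemma dressed_US:
  assumes "U ** V = mat 1" "V ** U = mat 1" "S ** R = mat 1" "R ** S = mat 1"
    and "loop_map \<iota> c ** S = S ** loop_map \<iota> c"
  shows "dressed \<iota> (U ** S) c = dressed \<iota> U (c :: (complex, 'n) loop_mat)"
    and "(U ** S) ** (R ** V) = mat 1" "(R ** V) ** (U ** S) = mat 1"
proof -
  have "(U ** S) ** (R ** V) = U ** (S ** R) ** V" "(R ** V) ** (U ** S) = R ** (V ** U) ** S"
    by (simp_all add: matrix_mul_assoc)
  then show US: "(U ** S) ** (R ** V) = mat 1" "(R ** V) ** (U ** S) = mat 1"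
    by (simp_all add: assms)
  have "U ** S ** loop_map \<iota> c ** (R ** V) = U ** (S ** loop_map \<iota> c) ** (R ** V)"
    by (simp add: matrix_mul_assoc)
  also have "\<dots> = U ** loop_map \<iota> c ** (S ** R) ** V"
    unfolding assms(5)[symmetric] by (simp add: matrix_mul_assoc)
  finally show "dressed \<iota> (U ** S) c = dressed \<iota> U c"
    by (simp add: dressed_def matrix_inv_eqI[OF US] matrix_inv_eqI[OF assms(1,2)] assms(3))
qed

lemma dressed_dressing:
  assumes "dressing_U \<iota> D \<kappa> h G E A U Km" "dressing_S \<iota> D \<kappa> h G E Km S" "derivation \<iota> D"
    and c: "c \<in> lie_center (ad_ker G E)"
  shows "dressed \<iota> (U ** S) c = dressed \<iota> U c"
proof -
  obtain X V where "X \<in> negative_series \<iota> \<kappa> h (ad_im G E)" "is_exp \<iota> X U" "supp neg_grade (U - mat 1)"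
    and UV: "U ** V = mat 1" "V ** U = mat 1" and "matrix_inv U = V" "supp neg_grade (V - mat 1)"
      "loop_map D U = U ** (loop_map \<iota> E + Km) - (loop_map \<iota> E + A) ** U"
    by (rule dressing_UD[OF assms(1,3)])
  obtain R where "supp neg_grade (S - mat 1)"
    and SR: "S ** R = mat 1" "R ** S = mat 1" and "supp neg_grade (R - mat 1)"
      "loop_map D S = S ** loop_map \<iota> E - (loop_map \<iota> E + Km) ** S"
    and S: "\<forall>c\<in>lie_center (ad_ker G E). loop_map \<iota> c ** S = S ** loop_map \<iota> c"
    by (rule dressing_SD[OF assms(2,3)])
  show ?thesis by (rule dressed_US(1)[OF UV SR S[rule_format, OF c]])
qed

theorem dressing_conservation_law:
  fixes U S A Km :: "('r, 'n) loop_mat"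
  assumes D: "derivation \<iota> D"
    and E: "E \<in> homog \<kappa> h G 1" and A: "A \<in> ext_span \<iota> (homog \<kappa> h M 0)"
    and b: "flow_constants \<kappa> h G E I b"
    and U: "dressing_U \<iota> D \<kappa> h G E A U Km" and S: "dressing_S \<iota> D \<kappa> h G E Km S"
    and \<delta>: "isospectral_flows \<iota> D \<kappa> h I b (U ** S) \<delta>"
    and m: "m \<in> I" and n: "n \<in> I"
  shows "\<delta> m (conserved_density \<iota> \<kappa> h E U (b n)) + D (conserved_flux \<iota> \<kappa> h (U ** S) U (b m) (b n)) = 0"
proof -
  interpret D: algebra_derivation \<iota> D by unfold_locales fact
  obtain X V where "X \<in> negative_series \<iota> \<kappa> h (ad_im G E)" "is_exp \<iota> X U"
    and U_unip: "supp neg_grade (U - mat 1)"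
    and UV: "U ** V = mat 1" "V ** U = mat 1" and "matrix_inv U = V" and V_unip: "supp neg_grade (V - mat 1)"
    and DU: "loop_map D U = U ** (loop_map \<iota> E + Km) - (loop_map \<iota> E + A) ** U"
    by (rule dressing_UD[OF U D])
  obtain R where S_unip: "supp neg_grade (S - mat 1)"
    and SR: "S ** R = mat 1" "R ** S = mat 1" and R_unip: "supp neg_grade (R - mat 1)"
    and DS: "loop_map D S = S ** loop_map \<iota> E - (loop_map \<iota> E + Km) ** S"
    and comm_S: "\<forall>c\<in>lie_center (ad_ker G E). loop_map \<iota> c ** S = S ** loop_map \<iota> c"
    by (rule dressing_SD[OF S D])
  note SC = comm_S[rule_format]
  have b_center: "b N \<in> lie_center (ad_ker G E)" if "N \<in> I" for N
    using b that by (auto simp: flow_constants_def homog_def)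
  have b1: "1 \<in> I" "b 1 = E" using b by (auto simp: flow_constants_def)
  have b_comm: "lie (b i) (b j) = 0" if "i \<in> I" "j \<in> I" for i j
    using b_center[OF that(1)] b_center[OF that(2)] by (simp add: lie_center_def)
  have supp_b: "supp (\<lambda>g. g = of_int (int m)) (b m)"
    by (rule homog_supp) (use b m in \<open>auto simp: flow_constants_def\<close>)
  have supp_A: "supp (\<lambda>g. g = 0) A"
    using supp_ext_span_homog[OF A] by simp
  have T: "(U ** S) ** (R ** V) = mat 1" "(R ** V) ** (U ** S) = mat 1"
    using dressed_US(2,3)[OF UV(1,2) SR(1,2) SC[OF b_center[OF m]]] by auto
  note dressed_T = dressed_US(1)[OF UV(1,2) SR(1,2) SC[OF b_center]]
  have dT: "dressed \<iota> (U ** S) c = (U ** S) ** loop_map \<iota> c ** (R ** V)" for c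
    by (simp add: dressed_def matrix_inv_eqI[OF T])
  \<comment> \<open>The terms U K^- S coming from the two dressing equations cancel.\<close>
  have DT: "loop_map D (U ** S) = (U ** S) ** loop_map \<iota> E - (loop_map \<iota> E + A) ** (U ** S)"
    by (simp add: D.DD_mult DU DS matrix_ring_simps)
  have supp_int: "supp (\<lambda>g. g \<in> \<int>) Y" if "supp neg_grade (Y - mat 1)" for Y :: "('r, 'n) loop_mat"
    by (rule supp_mono[OF unipotent_supp[OF that]]) simp
  have flows: "loop_map (\<delta> N) (U ** S) = grade_part \<kappa> h (\<lambda>g. g < 0) ((U ** S) ** loop_map \<iota> (b N) ** (R ** V)) ** (U ** S)"
    and derivs: "derivation \<iota> (\<delta> N)" if "N \<in> I" for N
    using \<delta> that dT by (auto simp: isospectral_flows_def)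
  have \<delta>1: "\<delta> 1 = D" using \<delta> by (simp add: isospectral_flows_def)
  have "\<delta> m (- graded_trace \<kappa> h (loop_map \<iota> E ** ((U ** S) ** loop_map \<iota> (b n) ** (R ** V))))
    + D (graded_trace \<kappa> h (grading_op \<iota> \<kappa> h (grade_part \<kappa> h (\<lambda>g. g \<ge> 0) ((U ** S) ** loop_map \<iota> (b m) ** (R ** V)))
        ** ((U ** S) ** loop_map \<iota> (b n) ** (R ** V)))) = 0"
  proof (rule conservation_law[OF D derivs[OF m] T])
    show "supp (\<lambda>g. g \<in> \<int>) (U ** S)" "supp (\<lambda>g. g \<in> \<int>) (R ** V)"
      by (rule supp_mult[OF supp_int[OF U_unip] supp_int[OF S_unip]]
          supp_mult[OF supp_int[OF R_unip] supp_int[OF V_unip]], simp)+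
    show "supp (\<lambda>g. g = 1) E" using homog_supp[OF E] by simp
    show "supp (\<lambda>g. g \<in> \<int>) (b m)" by (rule supp_mono[OF supp_b]) simp
    show "lie E (b m) = 0" "lie E (b n) = 0" "lie (b m) (b n) = 0"
      using b_comm[OF b1(1) m] b_comm[OF b1(1) n] b_comm[OF m n] b1(2) by auto
    \<comment> \<open>As \<open>b 1 = E\<close> and \<open>\<delta> 1 = D\<close>, the flow of index
      1 is the x-derivative.\<close>
    show "loop_map D (U ** S) = grade_part \<kappa> h (\<lambda>g. g < 0) ((U ** S) ** loop_map \<iota> E ** (R ** V)) ** (U ** S)"
      using flows[OF b1(1)] b1(2) \<delta>1 by simp
  qed (fact supp_A DT flows[OF m])+
  then show ?thesis
    unfolding conserved_density_def conserved_flux_def Let_def dT[symmetric] dressed_T[OF n] .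
qed

end

section \<open>Differential polynomials\<close>

definition jet_variable ::
    "('r \<Rightarrow> 'r) \<Rightarrow> ('r::comm_ring_1, 'n::finite) loop_mat \<Rightarrow> ('n \<times> 'n \<times> int) \<times> nat \<Rightarrow> 'r" where
  "jet_variable D A = (\<lambda>((i, j, k), l). (D ^^ l) (loop_nth A i j (- k)))"

definition jet_monomial ::
    "('r \<Rightarrow> 'r) \<Rightarrow> ('r::comm_ring_1, 'n::finite) loop_mat \<Rightarrow> ((('n \<times> 'n \<times> int) \<times> nat) \<Rightarrow>\<^sub>0 nat) \<Rightarrow> 'r" where
  "jet_monomial D A \<mu> = (\<Prod>v\<in>Poly_Mapping.keys \<mu>. jet_variable D A v ^ Poly_Mapping.lookup \<mu> v)"

lemma jet_monomial_superset:
  assumes "finite S" "Poly_Mapping.keys \<mu> \<subseteq> S"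
  shows "jet_monomial D A \<mu> = (\<Prod>v\<in>S. jet_variable D A v ^ Poly_Mapping.lookup \<mu> v)"
  unfolding jet_monomial_def
  by (rule prod.mono_neutral_left) (use assms in \<open>auto simp: in_keys_iff\<close>)

lemma jet_monomial_add: "jet_monomial D A (\<mu> + \<nu>) = jet_monomial D A \<mu> * jet_monomial D A \<nu>"
proof -
  let ?S = "Poly_Mapping.keys \<mu> \<union> Poly_Mapping.keys \<nu>"
  have "jet_monomial D A (\<mu> + \<nu>) = (\<Prod>v\<in>?S. jet_variable D A v ^ Poly_Mapping.lookup (\<mu> + \<nu>) v)"
    by (rule jet_monomial_superset) (auto dest: keys_add[THEN subsetD])
  then show ?thesis
    by (simp add: lookup_add power_add prod.distrib jet_monomial_superset[of ?S])
qed

lemma diff_poly_eval_eq: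
  "diff_poly_eval \<iota> D A p = (\<Sum>\<mu>\<in>Poly_Mapping.keys p. \<iota> (Poly_Mapping.lookup p \<mu>) * jet_monomial D A \<mu>)"
  unfolding diff_poly_eval_def jet_monomial_def jet_variable_def loop_coeff_def nth_map_matrix
  by (intro sum.cong prod.cong arg_cong2[where f = "(*)"] refl) auto

context algebra_hom begin

text \<open>Coefficients may cancel in a sum, so its keys can be fewer than the union of the keys;
  sums are compared over a common finite superset.\<close>

lemma diff_poly_eval_superset:
  assumes "finite S" "Poly_Mapping.keys p \<subseteq> S"
  shows "diff_poly_eval \<iota> D A p = (\<Sum>\<mu>\<in>S. \<iota> (Poly_Mapping.lookup p \<mu>) * jet_monomial D A \<mu>)"
  unfolding diff_poly_eval_eq
  by (rule sum.mono_neutral_left) (use assms in \<open>auto simp: in_keys_iff\<close>)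

lemma diff_poly_eval_add:
  "diff_poly_eval \<iota> D A (p + q) = diff_poly_eval \<iota> D A p + diff_poly_eval \<iota> D A q"
proof -
  let ?S = "Poly_Mapping.keys p \<union> Poly_Mapping.keys q"
  have "diff_poly_eval \<iota> D A (p + q) = (\<Sum>\<mu>\<in>?S. \<iota> (Poly_Mapping.lookup (p + q) \<mu>) * jet_monomial D A \<mu>)"
    by (rule diff_poly_eval_superset) (auto dest: keys_add[THEN subsetD])
  then show ?thesis
    by (simp add: lookup_add hom_add distrib_right sum.distrib diff_poly_eval_superset[of ?S])
qed

lemma diff_poly_eval_single:
  "diff_poly_eval \<iota> D A (Poly_Mapping.single \<mu> c) = \<iota> c * jet_monomial D A \<mu>"
  by (subst diff_poly_eval_superset[of "{\<mu>}"]) auto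

lemma diff_poly_eval_sum:
  "diff_poly_eval \<iota> D A (\<Sum>x\<in>S. p x) = (\<Sum>x\<in>S. diff_poly_eval \<iota> D A (p x))"
  by (induction S rule: infinite_finite_induct) (auto simp: diff_poly_eval_add diff_poly_eval_eq[of _ _ _ 0])

text \<open>Different pairs of exponents may have the same sum. Expanding both factors into
  monomials and using additivity avoids any description of the keys of \<open>p * q\<close>.\<close>

lemma diff_poly_eval_mult:
  "diff_poly_eval \<iota> D A (p * q) = diff_poly_eval \<iota> D A p * diff_poly_eval \<iota> D A q"
proof -
  have sum_singles: "r = (\<Sum>\<mu>\<in>Poly_Mapping.keys r. Poly_Mapping.single \<mu> (Poly_Mapping.lookup r \<mu>))"
    for r :: "'b diff_poly"
    by (rule poly_mapping_eqI)
      (auto simp: lookup_sum lookup_single when_def in_keys_iff)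
  have "p * q = (\<Sum>\<mu>\<in>Poly_Mapping.keys p. \<Sum>\<nu>\<in>Poly_Mapping.keys q.
      Poly_Mapping.single (\<mu> + \<nu>) (Poly_Mapping.lookup p \<mu> * Poly_Mapping.lookup q \<nu>))"
    by (subst sum_singles[of p], subst sum_singles[of q]) (simp add: sum_product mult_single)
  then have "diff_poly_eval \<iota> D A (p * q) = (\<Sum>\<mu>\<in>Poly_Mapping.keys p. \<Sum>\<nu>\<in>Poly_Mapping.keys q.
      (\<iota> (Poly_Mapping.lookup p \<mu>) * jet_monomial D A \<mu>) * (\<iota> (Poly_Mapping.lookup q \<nu>) * jet_monomial D A \<nu>))"
    by (simp add: diff_poly_eval_sum diff_poly_eval_single hom_mult jet_monomial_add mult_ac)
  then show ?thesis
    by (simp add: diff_poly_eval_eq sum_product)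
qed

end

text \<open>
  The index \<open>\<omega>\<close> will range over all dressing data, so that a single differential polynomial serves all of them.
\<close>

inductive local_function ::
    "'w set \<Rightarrow> ('w \<Rightarrow> complex \<Rightarrow> 'r) \<Rightarrow> ('w \<Rightarrow> 'r \<Rightarrow> 'r) \<Rightarrow> ('w \<Rightarrow> ('r::comm_ring_1, 'n::finite) loop_mat) \<Rightarrow> ('w \<Rightarrow> 'r) \<Rightarrow> bool"
  for \<Omega> \<iota> D A where
  const: "local_function \<Omega> \<iota> D A (\<lambda>\<omega>. \<iota> \<omega> c)"
| jet: "local_function \<Omega> \<iota> D A (\<lambda>\<omega>. (D \<omega> ^^ k) (loop_nth (A \<omega>) i j l))"
| add: "local_function \<Omega> \<iota> D A f \<Longrightarrow> local_function \<Omega> \<iota> D A g \<Longrightarrow> local_function \<Omega> \<iota> D A (\<lambda>\<omega>. f \<omega> + g \<omega>)"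
| mult: "local_function \<Omega> \<iota> D A f \<Longrightarrow> local_function \<Omega> \<iota> D A g \<Longrightarrow> local_function \<Omega> \<iota> D A (\<lambda>\<omega>. f \<omega> * g \<omega>)"
| cong: "local_function \<Omega> \<iota> D A f \<Longrightarrow> (\<And>\<omega>. \<omega> \<in> \<Omega> \<Longrightarrow> g \<omega> = f \<omega>) \<Longrightarrow> local_function \<Omega> \<iota> D A g"

locale differential_family =
  fixes \<Omega> :: "'w set" and \<iota> :: "'w \<Rightarrow> complex \<Rightarrow> 'r::comm_ring_1"
    and D :: "'w \<Rightarrow> 'r \<Rightarrow> 'r" and A :: "'w \<Rightarrow> ('r, 'n::finite) loop_mat"
  assumes algebra_derivation: "\<And>\<omega>. \<omega> \<in> \<Omega> \<Longrightarrow> algebra_derivation (\<iota> \<omega>) (D \<omega>)"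
begin

abbreviation "loc \<equiv> local_function \<Omega> \<iota> D A"

lemma algebra_hom: "\<omega> \<in> \<Omega> \<Longrightarrow> algebra_hom (\<iota> \<omega>)"
  using algebra_derivation by (simp add: algebra_derivation_def)

text \<open>Outside \<Omega> nothing is known of \<iota>, so 0 need not equal
  \<open>\<iota> \<omega> 0\<close> there; the rule \<open>cong\<close> asks for agreement on
  \<Omega> only.\<close>

lemma loc_zero: "loc (\<lambda>\<omega>. 0)"
  by (rule cong[OF const[of _ _ _ _ 0]]) (simp add: algebra_hom.hom_zero[OF algebra_hom])

lemma loc_minus: "loc f \<Longrightarrow> loc (\<lambda>\<omega>. - f \<omega>)"
  by (rule cong[OF mult[OF const[of _ _ _ _ "-1"]]])
    (simp_all add: algebra_hom.hom_minus[OF algebra_hom] algebra_hom.hom_one[OF algebra_hom])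

lemma loc_diff: "loc f \<Longrightarrow> loc g \<Longrightarrow> loc (\<lambda>\<omega>. f \<omega> - g \<omega>)"
  using add[OF _ loc_minus, of f g] by simp

lemma loc_sum: "(\<And>x. x \<in> S \<Longrightarrow> loc (f x)) \<Longrightarrow> loc (\<lambda>\<omega>. \<Sum>x\<in>S. f x \<omega>)"
  by (induction S rule: infinite_finite_induct) (auto intro: loc_zero add)

lemma loc_D: "loc f \<Longrightarrow> loc (\<lambda>\<omega>. D \<omega> (f \<omega>))"
proof (induction rule: local_function.induct)
  case (const c)
  show ?case
    by (rule cong[OF loc_zero]) (simp add: algebra_derivation.D_const[OF algebra_derivation])
next
  case (jet k i j l)
  show ?case
    using local_function.jet[of \<Omega> \<iota> D A "Suc k" i j l] by simp
next
  case (add f g)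
  show ?case
    by (rule cong[OF local_function.add[OF add.IH]])
      (simp add: algebra_derivation.D_add[OF algebra_derivation])
next
  case (mult f g)
  show ?case
    by (rule cong[OF local_function.add[OF local_function.mult[OF mult.IH(1) mult.hyps(2)] local_function.mult[OF mult.hyps(1) mult.IH(2)]]])
      (simp add: algebra_derivation.D_mult[OF algebra_derivation])
next
  case (cong f g)
  show ?case by (rule local_function.cong[OF cong.IH]) (simp add: cong.hyps)
qed

text \<open>Each case builds its polynomial without reference to \<omega>, so the witness precedes
  the quantifier over \<Omega>.\<close>

lemma loc_diff_poly: "loc f \<Longrightarrow> \<exists>p. \<forall>\<omega>\<in>\<Omega>. f \<omega> = diff_poly_eval (\<iota> \<omega>) (D \<omega>) (A \<omega>) p"
proof (induction rule: local_function.induct)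
  case (const c)
  show ?case
    by (rule exI[of _ "Poly_Mapping.single 0 c"])
      (simp add: algebra_hom.diff_poly_eval_single[OF algebra_hom] jet_monomial_def)
next
  case (jet k i j l)
  show ?case
    \<comment> \<open>Coefficient \<open>l\<close> belongs to the power \<lambda>^(-l), by which the
      variables of \<open>diff_poly\<close> are labelled.\<close>
    by (rule exI[of _ "Poly_Mapping.single (Poly_Mapping.single ((i, j, - l), k) 1) 1"])
      (simp add: algebra_hom.diff_poly_eval_single[OF algebra_hom] algebra_hom.hom_one[OF algebra_hom]
        jet_monomial_def jet_variable_def)
next
  case (add f g)
  then obtain p q where "\<forall>\<omega>\<in>\<Omega>. f \<omega> = diff_poly_eval (\<iota> \<omega>) (D \<omega>) (A \<omega>) p" "\<forall>\<omega>\<in>\<Omega>. g \<omega> = diff_poly_eval (\<iota> \<omega>) (D \<omega>) (A \<omega>) q"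
    by blast
  then show ?case
    by (intro exI[of _ "p + q"]) (simp add: algebra_hom.diff_poly_eval_add[OF algebra_hom])
next
  case (mult f g)
  then obtain p q where "\<forall>\<omega>\<in>\<Omega>. f \<omega> = diff_poly_eval (\<iota> \<omega>) (D \<omega>) (A \<omega>) p" "\<forall>\<omega>\<in>\<Omega>. g \<omega> = diff_poly_eval (\<iota> \<omega>) (D \<omega>) (A \<omega>) q"
    by blast
  then show ?case
    by (intro exI[of _ "p * q"]) (simp add: algebra_hom.diff_poly_eval_mult[OF algebra_hom])
next
  case (cong f g)
  then show ?case by simp
qed

end

section \<open>Semisimplicity\<close>

text \<open>The sign of the exponent is due to the series variable being \<open>\<lambda>\<inverse>\<close>.\<close>

definition laurent_eval :: "complex \<Rightarrow> complex fls \<Rightarrow> complex" where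
  "laurent_eval z f = (\<Sum>l | fls_nth f l \<noteq> 0. z powi (- l) * fls_nth f l)"

definition laurent_poly :: "complex fls \<Rightarrow> bool" where
  "laurent_poly f \<longleftrightarrow> finite {l. fls_nth f l \<noteq> 0}"

lemma laurent_poly_finite: "laurent_poly f \<Longrightarrow> finite {l. fls_nth f l \<noteq> 0}"
  by (simp add: laurent_poly_def)

lemma laurent_eval_superset:
  assumes "finite S" "{l. fls_nth f l \<noteq> 0} \<subseteq> S"
  shows "laurent_eval z f = (\<Sum>l\<in>S. z powi (- l) * fls_nth f l)"
  unfolding laurent_eval_def by (rule sum.mono_neutral_left) (use assms in auto)

lemma fls_times_nth_support:
  fixes f g :: "complex fls"
  assumes "laurent_poly f"
  shows "fls_nth (f * g) n = (\<Sum>k | fls_nth f k \<noteq> 0. fls_nth f k * fls_nth g (n - k))"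
proof -
  have "fls_nth (f * g) n = (\<Sum>k=fls_subdegree f..n - fls_subdegree g. fls_nth f k * fls_nth g (n - k))"
    by (rule fls_times_nth_bounded) auto
  also have "\<dots> = (\<Sum>k | fls_nth f k \<noteq> 0. fls_nth f k * fls_nth g (n - k))"
  proof (rule sum.mono_neutral_cong)
    fix k assume "k \<in> {k. fls_nth f k \<noteq> 0} - {fls_subdegree f..n - fls_subdegree g}"
    then have "fls_subdegree f \<le> k" "n - k < fls_subdegree g"
      using fls_subdegree_leI[of f k] by auto
    then show "fls_nth f k * fls_nth g (n - k) = 0" by simp
  qed (use laurent_poly_finite[OF assms] in auto)
  finally show ?thesis .
qed

lemma laurent_poly_add: "laurent_poly f \<Longrightarrow> laurent_poly g \<Longrightarrow> laurent_poly (f + g)"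
  and laurent_poly_diff: "laurent_poly f \<Longrightarrow> laurent_poly g \<Longrightarrow> laurent_poly (f - g)"
  unfolding laurent_poly_def
  by (rule finite_subset[of _ "{l. fls_nth f l \<noteq> 0} \<union> {l. fls_nth g l \<noteq> 0}"]; force)+

lemma laurent_poly_mult_subset:
  assumes "laurent_poly f"
  shows "{n. fls_nth (f * g) n \<noteq> 0} \<subseteq> (\<lambda>(k, l). k + l) ` ({k. fls_nth f k \<noteq> 0} \<times> {l. fls_nth g l \<noteq> 0})"
proof
  fix n assume "n \<in> {n. fls_nth (f * g) n \<noteq> 0}"
  then have "(\<Sum>k | fls_nth f k \<noteq> 0. fls_nth f k * fls_nth g (n - k)) \<noteq> 0"
    by (simp add: fls_times_nth_support[OF assms])
  then obtain k where "fls_nth f k \<noteq> 0" "fls_nth g (n - k) \<noteq> 0"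
    by (auto elim: sum.not_neutral_contains_not_neutral)
  then show "n \<in> (\<lambda>(k, l). k + l) ` ({k. fls_nth f k \<noteq> 0} \<times> {l. fls_nth g l \<noteq> 0})"
    by (intro image_eqI[of _ _ "(k, n - k)"]) auto
qed

lemma laurent_poly_mult: "laurent_poly f \<Longrightarrow> laurent_poly g \<Longrightarrow> laurent_poly (f * g)"
  unfolding laurent_poly_def[of "f * g"]
  by (rule finite_subset[OF laurent_poly_mult_subset]) (auto dest: laurent_poly_finite)

lemma laurent_poly_sum: "(\<And>x. x \<in> S \<Longrightarrow> laurent_poly (f x)) \<Longrightarrow> laurent_poly (\<Sum>x\<in>S. f x)"
  by (induction S rule: infinite_finite_induct) (auto intro: laurent_poly_add simp: laurent_poly_def[of 0])

lemma laurent_eval_add: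
  assumes "laurent_poly f" "laurent_poly g"
  shows "laurent_eval z (f + g) = laurent_eval z f + laurent_eval z g"
proof -
  let ?S = "{l. fls_nth f l \<noteq> 0} \<union> {l. fls_nth g l \<noteq> 0}"
  have "finite ?S" using assms by (simp add: laurent_poly_finite)
  moreover have "{l. fls_nth (f + g) l \<noteq> 0} \<subseteq> ?S" by auto
  ultimately show ?thesis
    by (simp add: laurent_eval_superset[of ?S] distrib_left sum.distrib)
qed

lemma laurent_eval_diff:
  assumes "laurent_poly f" "laurent_poly g"
  shows "laurent_eval z (f - g) = laurent_eval z f - laurent_eval z g"
  using laurent_eval_add[OF laurent_poly_diff[OF assms] assms(2), of z] by simp

lemma laurent_eval_mult:
  assumes f: "laurent_poly f" and g: "laurent_poly g" and z: "z \<noteq> 0"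
  shows "laurent_eval z (f * g) = laurent_eval z f * laurent_eval z g"
proof -
  let ?F = "{k. fls_nth f k \<noteq> 0}" and ?G = "{l. fls_nth g l \<noteq> 0}"
  let ?S = "(\<lambda>(k, l). k + l) ` (?F \<times> ?G)"
  have S: "finite ?S" using f g by (simp add: laurent_poly_finite)
  have "laurent_eval z (f * g) = (\<Sum>n\<in>?S. z powi (- n) * (\<Sum>k\<in>?F. fls_nth f k * fls_nth g (n - k)))"
    using laurent_eval_superset[OF S laurent_poly_mult_subset[OF f], of z]
    by (simp add: fls_times_nth_support[OF f])
  also have "\<dots> = (\<Sum>k\<in>?F. \<Sum>n\<in>?S. z powi (- n) * (fls_nth f k * fls_nth g (n - k)))"
    unfolding sum_distrib_left by (rule sum.swap)
  also have "\<dots> = (\<Sum>k\<in>?F. z powi (- k) * fls_nth f k * laurent_eval z g)"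
  proof (rule sum.cong[OF refl])
    fix k assume k: "k \<in> ?F"
    have "(\<Sum>n\<in>?S. z powi (- n) * (fls_nth f k * fls_nth g (n - k)))
        = z powi (- k) * fls_nth f k * (\<Sum>n\<in>?S. z powi (- (n - k)) * fls_nth g (n - k))"
      unfolding sum_distrib_left
    proof (rule sum.cong[OF refl])
      fix n
      have "z powi (- n) = z powi (- k) * z powi (- (n - k))"
        using z by (simp add: power_int_add[symmetric])
      then show "z powi (- n) * (fls_nth f k * fls_nth g (n - k))
          = z powi (- k) * fls_nth f k * (z powi (- (n - k)) * fls_nth g (n - k))"
        by (simp only: mult_ac)
    qed
    \<comment> \<open>Translated by -k, the set \<open>?S\<close> still covers the support of
      g.\<close>
    also have "(\<Sum>n\<in>?S. z powi (- (n - k)) * fls_nth g (n - k))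
        = (\<Sum>l\<in>(\<lambda>n. n - k) ` ?S. z powi (- l) * fls_nth g l)"
      by (subst sum.reindex) (auto intro: inj_onI)
    also have "\<dots> = laurent_eval z g"
    proof (rule laurent_eval_superset[symmetric])
      show "?G \<subseteq> (\<lambda>n. n - k) ` ?S"
      proof
        fix l assume "l \<in> ?G"
        with k have "k + l \<in> ?S" by force
        then show "l \<in> (\<lambda>n. n - k) ` ?S" by (rule image_eqI[rotated]) simp
      qed
    qed (use S in simp)
    finally show "(\<Sum>n\<in>?S. z powi (- n) * (fls_nth f k * fls_nth g (n - k))) = z powi (- k) * fls_nth f k * laurent_eval z g" .
  qed
  also have "\<dots> = laurent_eval z f * laurent_eval z g"
    by (simp add: laurent_eval_def[of z f] sum_distrib_right)
  finally show ?thesis .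
qed

lemma laurent_eval_sum:
  "(\<And>x. x \<in> S \<Longrightarrow> laurent_poly (f x)) \<Longrightarrow> laurent_eval z (\<Sum>x\<in>S. f x) = (\<Sum>x\<in>S. laurent_eval z (f x))"
  by (induction S rule: infinite_finite_induct)
    (auto simp: laurent_eval_add laurent_poly_sum laurent_eval_def[of _ 0])

text \<open>With m the largest exponent of \<lambda>^(-1), the factor z^m clears the negative powers
  of z. The resulting polynomial vanishes off 0, hence identically.\<close>

lemma laurent_eval_zero:
  assumes f: "laurent_poly f" and zero: "\<And>z. z \<noteq> 0 \<Longrightarrow> laurent_eval z f = 0"
  shows "f = 0"
proof (rule ccontr)
  assume "f \<noteq> 0"
  let ?F = "{k. fls_nth f k \<noteq> 0}"
  define m where "m = Max ?F"
  have m: "k \<le> m" if "k \<in> ?F" for k using laurent_poly_finite[OF f] that by (simp add: m_def)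
  define p where "p = (\<Sum>k\<in>?F. monom (fls_nth f k) (nat (m - k)))"
  have "poly p z = 0" if z: "z \<noteq> 0" for z
  proof -
    have "poly p z = (\<Sum>k\<in>?F. z powi m * (z powi (- k) * fls_nth f k))"
      unfolding p_def poly_sum poly_monom
    proof (rule sum.cong[OF refl])
      fix k assume k: "k \<in> ?F"
      have "z ^ nat (m - k) = z powi (m - k)" using m[OF k] by (simp add: power_int_def)
      also have "\<dots> = z powi m * z powi (- k)" using z by (simp add: power_int_add[symmetric])
      finally show "fls_nth f k * z ^ nat (m - k) = z powi m * (z powi (- k) * fls_nth f k)" by simp
    qed
    also have "\<dots> = z powi m * laurent_eval z f" by (simp add: laurent_eval_def sum_distrib_left)
    finally show ?thesis using zero[OF z] by simp
  qed
  \<comment> \<open>The factor \<open>[:0, 1:]\<close> takes care of the point 0, where the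
    hypothesis says nothing.\<close>
  then have "poly (p * [:0, 1:]) z = 0" for z by (cases "z = 0") auto
  then have "p * [:0, 1:] = 0" using poly_all_0_iff_0 by blast
  then have "p = 0" by simp
  obtain l where l: "l \<in> ?F" using \<open>f \<noteq> 0\<close> by (auto simp: fls_eq_iff)
  have "coeff p (nat (m - l)) = (\<Sum>k\<in>?F. if k = l then fls_nth f k else 0)"
    unfolding p_def coeff_sum coeff_monom
  proof (rule sum.cong[OF refl])
    fix k assume "k \<in> ?F"
    then show "(if nat (m - k) = nat (m - l) then fls_nth f k else 0) = (if k = l then fls_nth f k else 0)"
      using m[of k] m[OF l] by auto
  qed
  also have "\<dots> = fls_nth f l" using laurent_poly_finite[OF f] l by (simp add: sum.delta)
  finally show False using \<open>p = 0\<close> l by simp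
qed

section \<open>Evaluation of matrices at values of the loop parameter\<close>

definition laurent_mat :: "(complex, 'n::finite) loop_mat \<Rightarrow> bool" where
  "laurent_mat Y \<longleftrightarrow> (\<forall>i j. laurent_poly (Y $ i $ j))"

lemma loop_coeff_support:
  "{k. loop_coeff Y k \<noteq> 0} = (\<Union>(i, j)\<in>UNIV. uminus ` {l. loop_nth Y i j l \<noteq> 0})"
proof -
  have "loop_coeff Y k \<noteq> 0 \<longleftrightarrow> (\<exists>i j. loop_nth Y i j (- k) \<noteq> 0)" for k
    by (simp add: loop_coeff_def vec_eq_iff)
  moreover have "(\<exists>i j. loop_nth Y i j (- k) \<noteq> 0) \<longleftrightarrow> k \<in> (\<Union>(i, j)\<in>UNIV. uminus ` {l. loop_nth Y i j l \<noteq> 0})" for k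
    by (auto simp: image_iff) (metis minus_minus, blast)
  ultimately show ?thesis by blast
qed

lemma laurent_mat_iff: "laurent_mat Y \<longleftrightarrow> finite {k. loop_coeff Y k \<noteq> 0}"
  unfolding loop_coeff_support by (auto simp: laurent_mat_def laurent_poly_def finite_image_iff)

lemma loop_eval_nth:
  assumes "laurent_mat Y"
  shows "loop_eval z Y $ i $ j = laurent_eval z (Y $ i $ j)"
proof -
  let ?K = "{k. loop_coeff Y k \<noteq> 0}"
  have K: "finite ?K" using assms laurent_mat_iff by blast
  have "loop_eval z Y $ i $ j = (\<Sum>k\<in>?K. z powi k * loop_nth Y i j (- k))"
    by (simp add: loop_eval_def mscale_def loop_coeff_def)
  also have "\<dots> = (\<Sum>l\<in>uminus ` ?K. z powi (- l) * loop_nth Y i j l)"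
    by (subst sum.reindex) auto
  also have "\<dots> = laurent_eval z (Y $ i $ j)"
  proof (rule laurent_eval_superset[symmetric])
    show "{l. loop_nth Y i j l \<noteq> 0} \<subseteq> uminus ` ?K"
    proof
      fix l assume "l \<in> {l. loop_nth Y i j l \<noteq> 0}"
      then have "loop_coeff Y (- l) $ i $ j \<noteq> 0" by (simp add: loop_coeff_def)
      then have "- l \<in> ?K" by auto
      then show "l \<in> uminus ` ?K" by (rule image_eqI[rotated]) simp
    qed
  qed (use K in simp)
  finally show ?thesis .
qed

lemma laurent_mat_mult: "laurent_mat X \<Longrightarrow> laurent_mat Y \<Longrightarrow> laurent_mat (X ** Y)"
  by (auto simp: laurent_mat_def matrix_matrix_mult_def intro!: laurent_poly_sum laurent_poly_mult)

lemma laurent_mat_lie: "laurent_mat X \<Longrightarrow> laurent_mat Y \<Longrightarrow> laurent_mat (lie X Y)"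
  using laurent_mat_mult[of X Y] laurent_mat_mult[of Y X]
  by (simp add: laurent_mat_def lie_def laurent_poly_diff)

lemma loop_eval_mult:
  assumes "laurent_mat X" "laurent_mat Y" "z \<noteq> 0"
  shows "loop_eval z (X ** Y) = loop_eval z X ** loop_eval z Y"
  using assms
  by (simp add: vec_eq_iff loop_eval_nth laurent_mat_mult)
    (simp add: laurent_mat_def matrix_matrix_mult_def loop_eval_nth laurent_eval_sum laurent_poly_mult laurent_eval_mult)

lemma loop_eval_lie:
  assumes "laurent_mat X" "laurent_mat Y" "z \<noteq> 0"
  shows "loop_eval z (lie X Y) = lie (loop_eval z X) (loop_eval z Y)"
proof -
  have "loop_eval z (lie X Y) = loop_eval z (X ** Y) - loop_eval z (Y ** X)"
    using assms laurent_mat_lie[OF assms(1,2)] laurent_mat_mult[OF assms(1,2)] laurent_mat_mult[OF assms(2,1)]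
    by (simp add: vec_eq_iff loop_eval_nth) (simp add: laurent_mat_def lie_def laurent_eval_diff)
  then show ?thesis using assms by (simp add: loop_eval_mult lie_def)
qed

text \<open>In a basis diagonalizing M, ad M multiplies entry (i, j) by d_i - d_j, and the cube of a
  number vanishes only with the number.\<close>

lemma diagonalizable_lie_cubed:
  fixes M Z :: "complex ^ 'n ^ 'n"
  assumes "diagonalizable M" "lie M (lie M (lie M Z)) = 0"
  shows "lie M Z = 0"
proof -
  obtain P Q :: "complex ^ 'n ^ 'n" and d where PQ: "P ** Q = mat 1" "Q ** P = mat 1" and MP: "M ** P = P ** diag_mat d"
    using assms(1) unfolding diagonalizable_def invertible_def by blast
  have QM: "Q ** M = diag_mat d ** Q"
  proof -
    have "Q ** (M ** P) ** Q = Q ** (P ** diag_mat d) ** Q" by (simp add: MP)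
    then have "Q ** M ** (P ** Q) = (Q ** P) ** diag_mat d ** Q" by (simp add: matrix_mul_assoc)
    then show ?thesis by (simp add: PQ)
  qed
  have diag: "(diag_mat d ** Y) $ i $ j = d i * Y $ i $ j" "(Y ** diag_mat d) $ i $ j = Y $ i $ j * d j"
    for Y :: "complex ^ 'n ^ 'n" and i j
    by (simp_all add: matrix_matrix_mult_def diag_mat_def if_distrib if_distribR cong: if_cong)
  have conj: "(Q ** lie M Y ** P) $ i $ j = (d i - d j) * (Q ** Y ** P) $ i $ j" for Y i j
  proof -
    have "Q ** lie M Y ** P = (Q ** M) ** Y ** P - Q ** Y ** (M ** P)"
      by (simp add: lie_def matrix_diff_ldistrib matrix_diff_rdistrib matrix_mul_assoc)
    also have "\<dots> = diag_mat d ** (Q ** Y ** P) - (Q ** Y ** P) ** diag_mat d"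
      by (simp add: QM MP matrix_mul_assoc)
    finally show ?thesis by (simp add: diag left_diff_distrib)
  qed
  have "(Q ** lie M (lie M (lie M Z)) ** P) $ i $ j = 0" for i j using assms(2) by simp
  then have "(Q ** lie M Z ** P) $ i $ j = 0" for i j
    by (simp add: conj)
  then have "Q ** lie M Z ** P = 0" by (simp add: vec_eq_iff)
  then have "P ** (Q ** lie M Z ** P) ** Q = 0" by simp
  then have "(P ** Q) ** lie M Z ** (P ** Q) = 0" by (simp add: matrix_mul_assoc)
  then show ?thesis by (simp add: PQ)
qed

text \<open>Evaluation at a nonzero z respects brackets, so the hypothesis passes to matrices over
  \<open>complex\<close>; \<open>laurent_eval_zero\<close> brings the conclusion back.\<close>

lemma semisimple_lie_cubed:
  fixes E Z :: "(complex, 'n::finite) loop_mat"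
  assumes "semisimple_element E" and E: "laurent_mat E" and Z: "laurent_mat Z"
    and "lie E (lie E (lie E Z)) = 0"
  shows "lie E Z = 0"
proof -
  have L: "laurent_mat (lie E Z)" "laurent_mat (lie E (lie E Z))"
    using E Z by (simp_all add: laurent_mat_lie)
  have "laurent_eval z (lie E Z $ i $ j) = 0" if z: "z \<noteq> 0" for z i j
  proof -
    note eval = loop_eval_lie[OF E Z z] loop_eval_lie[OF E L(1) z] loop_eval_lie[OF E L(2) z]
    have "lie (loop_eval z E) (lie (loop_eval z E) (lie (loop_eval z E) (loop_eval z Z))) = loop_eval z 0"
      unfolding assms(4)[symmetric] eval ..
    also have "\<dots> = 0" by (simp add: vec_eq_iff loop_eval_def loop_coeff_def)
    finally have cubed: "lie (loop_eval z E) (lie (loop_eval z E) (lie (loop_eval z E) (loop_eval z Z))) = 0" .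
    have "diagonalizable (loop_eval z E)"
      using assms(1) z unfolding semisimple_element_def by blast
    then have "lie (loop_eval z E) (loop_eval z Z) = 0"
      using cubed by (rule diagonalizable_lie_cubed)
    then show ?thesis
      unfolding loop_eval_nth[OF L(1), symmetric] eval(1) by simp
  qed
  then have "lie E Z $ i $ j = 0" for i j
    using laurent_eval_zero L(1) unfolding laurent_mat_def by blast
  then show ?thesis by (simp add: vec_eq_iff)
qed

section \<open>A constant left inverse of (ad E)^2\<close>

interpretation loop_pair: vector_space_pair
  "loop_scale :: complex \<Rightarrow> (complex, 'n::finite) loop_mat \<Rightarrow> _" "loop_scale :: complex \<Rightarrow> (complex, 'n) loop_mat \<Rightarrow> _"
  by unfold_locales

lemma lie_scale_right: "lie X (loop_scale c Y) = loop_scale c (lie X (Y :: ('r::comm_ring_1, 'n::finite) loop_mat))"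
  by (simp add: lie_def loop_scale_mult_left loop_scale_mult_right loop_module.scale_right_diff_distrib)

lemma lie_zero_right [simp]: "lie X 0 = 0"
  by (simp add: lie_def)

text \<open>Over a field, a linear map injective on a subspace has a linear left inverse there. The
  subspace \<open>V\<close> is the image under ad E of all Laurent matrices; it contains
  \<open>ad_im G E\<close> whenever G consists of such matrices.\<close>

lemma ad_square_left_inverse:
  fixes E :: "(complex, 'n::finite) loop_mat"
  assumes "semisimple_element E" and E: "laurent_mat E"
  obtains g where "Vector_Spaces.linear loop_scale loop_scale g"
    and "\<And>Z. laurent_mat Z \<Longrightarrow> g (lie E (lie E (lie E Z))) = lie E Z"
proof -
  define V where "V = lie E ` {Z. laurent_mat Z}"
  define f where "f = (\<lambda>Y. lie E (lie E Y))"
  have lin: "Vector_Spaces.linear loop_scale loop_scale f"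
    by unfold_locales (simp_all add: f_def lie_add_right lie_scale_right)
  have V: "loop_module.subspace V"
  proof (rule loop_module.subspaceI)
    show "0 \<in> V" unfolding V_def by (rule image_eqI[of _ _ 0]) (auto simp: laurent_mat_def laurent_poly_def)
    show "x + y \<in> V" if xy: "x \<in> V" "y \<in> V" for x y
    proof -
      obtain X Y where "x = lie E X" "laurent_mat X" "y = lie E Y" "laurent_mat Y"
        using xy unfolding V_def by blast
      then show ?thesis
        unfolding V_def by (intro image_eqI[of _ _ "X + Y"]) (auto simp: lie_add_right laurent_mat_def laurent_poly_add)
    qed
    show "loop_scale c x \<in> V" if x: "x \<in> V" for c x
    proof -
      obtain X where X: "x = lie E X" "laurent_mat X"
        using x unfolding V_def by blast
      have "laurent_mat (loop_scale c X)"
        unfolding laurent_mat_def laurent_poly_def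
      proof (intro allI)
        fix i j
        have "finite {l. loop_nth X i j l \<noteq> 0}" using X(2) by (simp add: laurent_mat_def laurent_poly_def)
        then show "finite {l. loop_nth (loop_scale c X) i j l \<noteq> 0}"
          by (rule rev_finite_subset) (auto simp: loop_nth_scale)
      qed
      then show ?thesis
        unfolding V_def X(1) by (intro image_eqI[of _ _ "loop_scale c X"]) (auto simp: lie_scale_right)
    qed
  qed
  have "inj_on f V"
  proof (rule inj_onI)
    fix x y assume x: "x \<in> V" and y: "y \<in> V" and eq: "f x = f y"
    have "x - y \<in> V" using loop_module.subspace_diff[OF V x y] .
    then obtain Z where Z: "x - y = lie E Z" "laurent_mat Z" unfolding V_def by blast
    have "lie E (lie E (lie E Z)) = 0"
      unfolding Z(1)[symmetric] using eq by (simp add: f_def lie_diff_right)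
    then have "lie E Z = 0" using semisimple_lie_cubed[OF assms(1) E Z(2)] by blast
    with Z(1) show "x = y" by simp
  qed
  from loop_pair.linear_exists_left_inverse_on[OF lin V this]
  obtain g where g: "Vector_Spaces.linear loop_scale loop_scale g" "\<forall>v\<in>V. g (f v) = v"
    by blast
  show thesis
    by (rule that[OF g(1)]) (use g(2) in \<open>auto simp: V_def f_def\<close>)
qed

text \<open>The elementary matrix e_ij times \<lambda>^(-l).\<close>

definition matrix_unit :: "'n::finite \<Rightarrow> 'n \<Rightarrow> int \<Rightarrow> (complex, 'n) loop_mat" where
  "matrix_unit i j l = (\<chi> a b. if a = i \<and> b = j then Abs_fls (\<lambda>m. if m = l then 1 else 0) else 0)"

lemma loop_nth_matrix_unit: "loop_nth (matrix_unit i j l) a b m = (if a = i \<and> b = j \<and> m = l then 1 else 0)"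
  by (simp add: matrix_unit_def)

context loop_grading begin

definition grade_indices :: "real \<Rightarrow> ('n \<times> 'n \<times> int) set" where
  "grade_indices c = {(i, j, l). weight i j l = c}"

lemma finite_grade_indices: "finite (grade_indices c)"
proof -
  obtain a where a: "\<forall>i j l. c \<le> weight i j l \<longrightarrow> l \<le> a" using weight_bounded_below by blast
  obtain b where b: "\<forall>i j l. weight i j l \<le> c \<longrightarrow> b \<le> l" using weight_bounded_above by blast
  have "grade_indices c \<subseteq> UNIV \<times> UNIV \<times> {b..a}"
    unfolding grade_indices_def using a b by fastforce
  then show ?thesis by (rule finite_subset) simp
qed

text \<open>Finitely many matrix units span a grade, so a linear map can be applied term by term
  without any continuity.\<close>

lemma homogeneous_sum_matrix_units:
  assumes "supp (\<lambda>g. g = c) Y"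
  shows "Y = (\<Sum>(i, j, l)\<in>grade_indices c. loop_scale (loop_nth Y i j l) (matrix_unit i j l))"
proof (rule loop_mat_eqI)
  fix a b m
  have "loop_nth (\<Sum>(i, j, l)\<in>grade_indices c. loop_scale (loop_nth Y i j l) (matrix_unit i j l)) a b m
      = (\<Sum>t\<in>grade_indices c. if t = (a, b, m) then loop_nth Y a b m else 0)"
    unfolding sum_component fls_nth_sum
    by (rule sum.cong) (auto simp: loop_nth_scale loop_nth_matrix_unit split: if_splits)
  also have "\<dots> = (if (a, b, m) \<in> grade_indices c then loop_nth Y a b m else 0)"
    using finite_grade_indices by (simp add: sum.delta')
  also have "\<dots> = loop_nth Y a b m"
    using supp_nth_zero[OF assms, of a b m] by (auto simp: grade_indices_def)
  finally show "loop_nth Y a b m = loop_nth (\<Sum>(i, j, l)\<in>grade_indices c. loop_scale (loop_nth Y i j l) (matrix_unit i j l)) a b m" ..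
qed

text \<open>The \<tau> are the entries of the left inverse on matrix units. One choice serves all Z
  and all grades, and being complex numbers they can be carried into \<open>'r\<close> by any
  \<iota>.\<close>

lemma ad_square_inverse_coefficients:
  fixes E :: "(complex, 'n) loop_mat"
  assumes "semisimple_element E" and E: "laurent_mat E"
  shows "\<exists>\<tau>. \<forall>Z c i j l. laurent_mat Z \<longrightarrow> supp (\<lambda>g. g = c) (lie E (lie E (lie E Z))) \<longrightarrow>
    loop_nth (lie E Z) i j l =
      (\<Sum>(a, b, m)\<in>grade_indices c. \<tau> i j l a b m * loop_nth (lie E (lie E (lie E Z))) a b m)"
proof -
  obtain g where g: "Vector_Spaces.linear loop_scale loop_scale g"
    and inv: "\<And>Z. laurent_mat Z \<Longrightarrow> g (lie E (lie E (lie E Z))) = lie E Z"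
    using ad_square_left_inverse[OF assms] by blast
  interpret g: Vector_Spaces.linear loop_scale loop_scale g by (rule g)
  show ?thesis
  proof (intro exI allI impI)
    fix Z c i j l assume Z: "laurent_mat Z" and supp: "supp (\<lambda>g. g = c) (lie E (lie E (lie E Z)))"
    let ?W = "lie E (lie E (lie E Z))"
    have "lie E Z = g ?W" using inv[OF Z] by simp
    also have "\<dots> = (\<Sum>(a, b, m)\<in>grade_indices c. loop_scale (loop_nth ?W a b m) (g (matrix_unit a b m)))"
      by (subst homogeneous_sum_matrix_units[OF supp])
        (simp add: g.sum g.scale case_prod_unfold)
    finally have "loop_nth (lie E Z) i j l =
        loop_nth (\<Sum>(a, b, m)\<in>grade_indices c. loop_scale (loop_nth ?W a b m) (g (matrix_unit a b m))) i j l"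
      by (rule arg_cong[where f = "\<lambda>Y. loop_nth Y i j l"])
    then show "loop_nth (lie E Z) i j l =
        (\<Sum>(a, b, m)\<in>grade_indices c. loop_nth (g (matrix_unit a b m)) i j l * loop_nth ?W a b m)"
      unfolding sum_component fls_nth_sum by (simp add: loop_nth_scale case_prod_unfold mult.commute)
  qed
qed

end

section \<open>Locality\<close>

locale graded_family = differential_family \<Omega> \<iota> D A + loop_grading \<kappa> h
  for \<Omega> :: "'w set" and \<iota> :: "'w \<Rightarrow> complex \<Rightarrow> 'r::comm_ring_1" and D :: "'w \<Rightarrow> 'r \<Rightarrow> 'r"
    and A :: "'w \<Rightarrow> ('r, 'n::finite) loop_mat" and \<kappa> :: real and h :: "'n \<Rightarrow> real"
begin

text \<open>\<open>c\<close> records how deep the recursion has come: nothing is claimed about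
  entries of weight below \<open>c\<close>.\<close>

definition loc_above :: "real \<Rightarrow> ('w \<Rightarrow> ('r, 'n) loop_mat) \<Rightarrow> bool" where
  "loc_above c Y \<longleftrightarrow> (\<forall>i j l. c \<le> weight i j l \<longrightarrow> loc (\<lambda>\<omega>. loop_nth (Y \<omega>) i j l))"

definition supp_all :: "(real \<Rightarrow> bool) \<Rightarrow> ('w \<Rightarrow> ('r, 'n) loop_mat) \<Rightarrow> bool" where
  "supp_all P Y \<longleftrightarrow> (\<forall>\<omega>\<in>\<Omega>. supp P (Y \<omega>))"

lemma graded_algebra: "\<omega> \<in> \<Omega> \<Longrightarrow> graded_algebra \<kappa> (\<iota> \<omega>)"
  using algebra_hom by (simp add: graded_algebra_def loop_grading_axioms)

lemma loc_aboveD: "loc_above c Y \<Longrightarrow> c \<le> weight i j l \<Longrightarrow> loc (\<lambda>\<omega>. loop_nth (Y \<omega>) i j l)"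
  by (simp add: loc_above_def)

lemma loc_above_mono: "loc_above c Y \<Longrightarrow> c \<le> c' \<Longrightarrow> loc_above c' Y"
  unfolding loc_above_def by (meson order_trans)

lemma loc_above_cong: "loc_above c Y \<Longrightarrow> (\<And>\<omega>. \<omega> \<in> \<Omega> \<Longrightarrow> Z \<omega> = Y \<omega>) \<Longrightarrow> loc_above c Z"
  unfolding loc_above_def by (intro allI impI) (rule local_function.cong, blast, simp)

lemma loc_outside_supp:
  assumes "supp_all P Y" "\<not> P (weight i j l)"
  shows "loc (\<lambda>\<omega>. loop_nth (Y \<omega>) i j l)"
proof (rule local_function.cong[OF loc_zero])
  show "loop_nth (Y \<omega>) i j l = 0" if "\<omega> \<in> \<Omega>" for \<omega>
    by (rule supp_nth_zero[of P]) (use assms that in \<open>auto simp: supp_all_def\<close>)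
qed

lemma loc_above_outside_supp: "supp_all (\<lambda>g. g < c) Y \<Longrightarrow> loc_above c Y"
  unfolding loc_above_def by (auto intro: loc_outside_supp)

lemma loc_above_add: "loc_above c X \<Longrightarrow> loc_above c Y \<Longrightarrow> loc_above c (\<lambda>\<omega>. X \<omega> + Y \<omega>)"
  and loc_above_diff: "loc_above c X \<Longrightarrow> loc_above c Y \<Longrightarrow> loc_above c (\<lambda>\<omega>. X \<omega> - Y \<omega>)"
  by (simp_all add: loc_above_def local_function.add loc_diff)

lemma loc_above_const: "loc_above c (\<lambda>\<omega>. loop_map (\<iota> \<omega>) C)"
  unfolding loc_above_def
proof (intro allI impI)
  fix i j l
  show "loc (\<lambda>\<omega>. loop_nth (loop_map (\<iota> \<omega>) C) i j l)"
    by (rule local_function.cong[OF local_function.const[of _ _ _ _ "loop_nth C i j l"]])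
      (simp add: loop_nth_map algebra_hom.hom_zero[OF algebra_hom])
qed

lemma loc_above_one: "loc_above c (\<lambda>\<omega>. mat 1)"
proof (rule loc_above_cong[OF loc_above_const[of _ "mat 1"]])
  show "mat 1 = loop_map (\<iota> \<omega>) (mat 1)" if "\<omega> \<in> \<Omega>" for \<omega>
    using that
    by (intro loop_mat_eqI)
      (simp add: loop_nth_map algebra_hom.hom_zero[OF algebra_hom] algebra_hom.hom_one[OF algebra_hom] mat_def)
qed

lemma loc_above_base: "loc_above c A"
  unfolding loc_above_def using local_function.jet[of \<Omega> \<iota> D A 0] by simp

lemma loc_above_D: "loc_above c Y \<Longrightarrow> loc_above c (\<lambda>\<omega>. loop_map (D \<omega>) (Y \<omega>))"
  unfolding loc_above_def
proof (intro allI impI)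
  fix i j l assume "\<forall>i j l. c \<le> weight i j l \<longrightarrow> loc (\<lambda>\<omega>. loop_nth (Y \<omega>) i j l)" "c \<le> weight i j l"
  then have "loc (\<lambda>\<omega>. D \<omega> (loop_nth (Y \<omega>) i j l))" by (intro loc_D) blast
  then show "loc (\<lambda>\<omega>. loop_nth (loop_map (D \<omega>) (Y \<omega>)) i j l)"
    by (rule local_function.cong) (simp add: loop_nth_map algebra_derivation.D_zero[OF algebra_derivation])
qed

text \<open>In a contribution to weight at least \<open>c\<close> the second factor has weight at
  most \<open>y\<close>, so the first has weight at least c - y, where X is local; likewise with the
  factors exchanged.\<close>

lemma loc_above_mult:
  assumes X: "supp_all (\<lambda>g. g \<le> x) X" "loc_above a X" and Y: "supp_all (\<lambda>g. g \<le> y) Y" "loc_above b Y"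
    and c: "a + y \<le> c" "b + x \<le> c"
  shows "loc_above c (\<lambda>\<omega>. X \<omega> ** Y \<omega>)"
  unfolding loc_above_def
proof (intro allI impI)
  fix i j l assume w: "c \<le> weight i j l"
  \<comment> \<open>Exponent bounds read off from the supports hold for all \<omega> at once, so the
    range of the sum is independent of \<omega>.\<close>
  obtain p where p: "\<forall>i j l. weight i j l \<le> x \<longrightarrow> p \<le> l" using weight_bounded_above by blast
  obtain q where q: "\<forall>i j l. weight i j l \<le> y \<longrightarrow> q \<le> l" using weight_bounded_above by blast
  have "loc (\<lambda>\<omega>. \<Sum>k\<in>UNIV. \<Sum>l'=p..l-q. loop_nth (X \<omega>) i k l' * loop_nth (Y \<omega>) k j (l - l'))"
  proof (rule loc_sum, rule loc_sum)
    fix k l'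
    note w_add = weight_add[of i k l' j l]
    show "loc (\<lambda>\<omega>. loop_nth (X \<omega>) i k l' * loop_nth (Y \<omega>) k j (l - l'))"
    proof (cases "weight i k l' \<le> x \<and> weight k j (l - l') \<le> y")
      case True
      then show ?thesis
        by (intro local_function.mult loc_aboveD[OF X(2)] loc_aboveD[OF Y(2)]) (use w w_add c in linarith)+
    next
      case False
      show ?thesis
      proof (rule local_function.cong[OF loc_zero])
        fix \<omega> assume "\<omega> \<in> \<Omega>"
        then have "supp (\<lambda>g. g \<le> x) (X \<omega>)" "supp (\<lambda>g. g \<le> y) (Y \<omega>)"
          using X(1) Y(1) by (simp_all add: supp_all_def)
        then have "loop_nth (X \<omega>) i k l' = 0 \<or> loop_nth (Y \<omega>) k j (l - l') = 0"
          using False supp_nth_zero by blast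
        then show "loop_nth (X \<omega>) i k l' * loop_nth (Y \<omega>) k j (l - l') = 0" by auto
      qed
    qed
  qed
  then show "loc (\<lambda>\<omega>. loop_nth (X \<omega> ** Y \<omega>) i j l)"
  proof (rule local_function.cong)
    fix \<omega> assume \<omega>: "\<omega> \<in> \<Omega>"
    show "loop_nth (X \<omega> ** Y \<omega>) i j l = (\<Sum>k\<in>UNIV. \<Sum>l'=p..l-q. loop_nth (X \<omega>) i k l' * loop_nth (Y \<omega>) k j (l - l'))"
    proof (rule loop_nth_mult)
      fix i j l
      show "loop_nth (X \<omega>) i j l = 0" if "l < p"
        by (rule supp_nth_zero[of "\<lambda>g. g \<le> x"]) (use X(1) \<omega> p that in \<open>force simp: supp_all_def\<close>)+
      show "loop_nth (Y \<omega>) i j l = 0" if "l < q"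
        by (rule supp_nth_zero[of "\<lambda>g. g \<le> y"]) (use Y(1) \<omega> q that in \<open>force simp: supp_all_def\<close>)+
    qed
  qed
qed

lemma loc_above_lie:
  assumes X: "supp_all (\<lambda>g. g \<le> x) X" "loc_above a X" and Y: "supp_all (\<lambda>g. g \<le> y) Y" "loc_above b Y"
    and c: "a + y \<le> c" "b + x \<le> c"
  shows "loc_above c (\<lambda>\<omega>. lie (X \<omega>) (Y \<omega>))"
  unfolding lie_def by (intro loc_above_diff loc_above_mult[OF X Y c] loc_above_mult[OF Y X c(2,1)])

end

section \<open>The recursion for the dressing exponent\<close>

locale dressing_family = graded_family \<Omega> \<iota> D A \<kappa> h
  for \<Omega> :: "'w set" and \<iota> :: "'w \<Rightarrow> complex \<Rightarrow> 'r::comm_ring_1" and D :: "'w \<Rightarrow> 'r \<Rightarrow> 'r"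
    and A :: "'w \<Rightarrow> ('r, 'n::finite) loop_mat" and \<kappa> :: real and h :: "'n \<Rightarrow> real" +
  fixes G :: "(complex, 'n) loop_mat set" and E :: "(complex, 'n) loop_mat"
    and X U K :: "'w \<Rightarrow> ('r, 'n) loop_mat"
  assumes G: "\<And>Y. Y \<in> G \<Longrightarrow> laurent_mat Y" and E: "E \<in> homog \<kappa> h G 1" and semisimple: "semisimple_element E"
    and supp_A: "\<And>\<omega>. \<omega> \<in> \<Omega> \<Longrightarrow> supp (\<lambda>g. g = 0) (A \<omega>)"
    and X: "\<And>\<omega>. \<omega> \<in> \<Omega> \<Longrightarrow> X \<omega> \<in> negative_series (\<iota> \<omega>) \<kappa> h (ad_im G E)"
    and U: "\<And>\<omega>. \<omega> \<in> \<Omega> \<Longrightarrow> is_exp (\<iota> \<omega>) (X \<omega>) (U \<omega>)"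
    and K: "\<And>\<omega>. \<omega> \<in> \<Omega> \<Longrightarrow> K \<omega> \<in> negative_series (\<iota> \<omega>) \<kappa> h (ad_ker G E)"
    and dressing: "\<And>\<omega>. \<omega> \<in> \<Omega> \<Longrightarrow> loop_map (D \<omega>) (U \<omega>) =
      U \<omega> ** (loop_map (\<iota> \<omega>) E + K \<omega>) - (loop_map (\<iota> \<omega>) E + A \<omega>) ** U \<omega>"
begin

abbreviation "EE \<omega> \<equiv> loop_map (\<iota> \<omega>) E"

text \<open>The part of exp X of order at least two; in each grade it involves only components of X
  of higher grade.\<close>

definition "R \<omega> = U \<omega> - mat 1 - X \<omega>"

lemma laurent_E: "laurent_mat E"
  using E G by (auto simp: homog_def)

lemma supp_E: "\<omega> \<in> \<Omega> \<Longrightarrow> supp (\<lambda>g. g = 1) (EE \<omega>)"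
  using homog_supp[OF E] by (intro supp_map) (auto simp: algebra_hom.hom_zero[OF algebra_hom])

lemma supp_X: "\<omega> \<in> \<Omega> \<Longrightarrow> supp neg_grade (X \<omega>)"
  using graded_algebra.negative_seriesE[OF graded_algebra X] by blast

lemma supp_K: "\<omega> \<in> \<Omega> \<Longrightarrow> supp neg_grade (K \<omega>)"
  using graded_algebra.negative_seriesE[OF graded_algebra K] by blast

lemma U_series: "\<omega> \<in> \<Omega> \<Longrightarrow> graded_series (\<lambda>k. loop_scale (\<iota> \<omega> (1 / fact k)) (mat_pow (X \<omega>) k)) (U \<omega>)"
  by (rule graded_algebra.is_exp_series[OF graded_algebra U supp_X])

lemma U_unipotent: "\<omega> \<in> \<Omega> \<Longrightarrow> supp neg_grade (U \<omega> - mat 1)"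
  by (rule graded_algebra.is_exp_unipotent[OF graded_algebra U supp_X])

lemma supp_R: "\<omega> \<in> \<Omega> \<Longrightarrow> supp (\<lambda>g. g \<le> - 2) (R \<omega>)"
proof -
  assume \<omega>: "\<omega> \<in> \<Omega>"
  have "supp (\<lambda>g. g \<le> - real 2) (U \<omega> - (\<Sum>k<2. loop_scale (\<iota> \<omega> (1 / fact k)) (mat_pow (X \<omega>) k)))"
    using U_series[OF \<omega>] unfolding graded_series_def by blast
  then show ?thesis
    by (simp add: R_def numeral_2_eq_2 mat_pow_0 mat_pow_Suc algebra_hom.hom_one[OF algebra_hom[OF \<omega>]] diff_diff_add)
qed

lemma EK: "\<omega> \<in> \<Omega> \<Longrightarrow> lie (EE \<omega>) (K \<omega>) = 0"
proof -
  assume \<omega>: "\<omega> \<in> \<Omega>"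
  interpret graded_algebra \<kappa> h "\<iota> \<omega>" by (rule graded_algebra) fact
  have "EE \<omega> ** K \<omega> = K \<omega> ** EE \<omega>"
    by (rule negative_series_commute[OF K[OF \<omega>]]) (rule lie_zero_commute, simp add: ad_ker_def)
  then show ?thesis by (simp add: lie_def)
qed

text \<open>The dressing equation solved for [E, X] - K^-. The term [E, R] stays on this side
  because R is of second order in X.\<close>

definition "F \<omega> = (U \<omega> - mat 1) ** K \<omega> - loop_map (D \<omega>) (U \<omega> - mat 1) - A \<omega> ** U \<omega> - lie (EE \<omega>) (R \<omega>)"

lemma recursion: "\<omega> \<in> \<Omega> \<Longrightarrow> lie (EE \<omega>) (X \<omega>) - K \<omega> = F \<omega>"
proof -
  assume \<omega>: "\<omega> \<in> \<Omega>"
  interpret algebra_derivation "\<iota> \<omega>" "D \<omega>" by (rule algebra_derivation) fact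
  have "U \<omega> = mat 1 + X \<omega> + R \<omega>" by (simp add: R_def)
  then have UE: "lie (EE \<omega>) (U \<omega>) = lie (EE \<omega>) (X \<omega>) + lie (EE \<omega>) (R \<omega>)"
    by (simp add: lie_def matrix_ring_simps)
  have "F \<omega> = - K \<omega> + lie (EE \<omega>) (U \<omega>) - lie (EE \<omega>) (R \<omega>)"
    by (simp add: F_def DD_diff DD_one dressing[OF \<omega>] lie_def matrix_ring_simps)
  then show ?thesis by (simp add: UE)
qed

text \<open>Each further factor has grade at most -1 and pushes the unknown part of X one grade
  further down.\<close>

lemma loc_mat_pow:
  assumes "loc_above (- real n) X"
  shows "loc_above (- real n - real k) (\<lambda>\<omega>. mat_pow (X \<omega>) (Suc k))"
proof (induction k)
  case 0
  then show ?case using assms by (simp add: mat_pow_Suc mat_pow_0)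
next
  case (Suc k)
  show ?case
    unfolding mat_pow_Suc[of _ "Suc k"]
  proof (rule loc_above_mult[OF _ assms _ Suc])
    show "supp_all (\<lambda>g. g \<le> - 1) X"
      unfolding supp_all_def by (auto intro: supp_mono[OF supp_X])
    show "supp_all (\<lambda>g. g \<le> - real (Suc k)) (\<lambda>\<omega>. mat_pow (X \<omega>) (Suc k))"
      unfolding supp_all_def by (auto intro: supp_mono[OF supp_mat_pow[OF supp_X]])
  qed auto
qed

text \<open>R starts with X^2, so it is known one grade deeper than X. This extra grade pays for the
  factor E in [E, R].\<close>

lemma loc_R:
  assumes "loc_above (- real n) X"
  shows "loc_above (- real n - 1) R"
  unfolding loc_above_def
proof (intro allI impI)
  fix i j l assume w: "- real n - 1 \<le> weight i j l"
  let ?c = "\<lambda>\<omega> k. \<iota> \<omega> (1 / fact (k + 2)) * loop_nth (mat_pow (X \<omega>) (k + 2)) i j l"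
  have "loc (\<lambda>\<omega>. \<Sum>k<n. ?c \<omega> k)"
    by (intro loc_sum local_function.mult local_function.const)
      (use w in \<open>auto intro!: loc_aboveD[OF loc_mat_pow[OF assms, of "Suc _"], simplified]\<close>)
  then show "loc (\<lambda>\<omega>. loop_nth (R \<omega>) i j l)"
  proof (rule local_function.cong)
    fix \<omega> assume \<omega>: "\<omega> \<in> \<Omega>"
    \<comment> \<open>Powers from n + 2 on lie in grades at most -n - 2 and do not reach this
      position.\<close>
    have "loop_nth (U \<omega>) i j l = (\<Sum>k<n + 2. loop_nth (loop_scale (\<iota> \<omega> (1 / fact k)) (mat_pow (X \<omega>) k)) i j l)"
      by (rule graded_series_nth[OF U_series[OF \<omega>]]) (use w in simp)
    also have "\<dots> = loop_nth (mat 1) i j l + loop_nth (X \<omega>) i j l + (\<Sum>k<n. ?c \<omega> k)"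
    proof -
      have split: "(\<Sum>k<n + 2. f k) = f 0 + f 1 + (\<Sum>k<n. f (k + 2))" for f :: "nat \<Rightarrow> 'r"
        by (simp add: sum.lessThan_Suc_shift add.assoc del: sum.lessThan_Suc)
      show ?thesis
        unfolding split by (simp add: loop_nth_scale mat_pow_0 mat_pow_Suc algebra_hom.hom_one[OF algebra_hom[OF \<omega>]])
    qed
    finally show "loop_nth (R \<omega>) i j l = (\<Sum>k<n. ?c \<omega> k)"
      by (simp add: R_def)
  qed
qed

text \<open>K enters only multiplied by U - 1, which lowers grades by at least one; hence K need be
  known only down to -n + 1.\<close>

lemma loc_F:
  assumes X: "loc_above (- real n) X" and K: "loc_above (- real n + 1) K"
  shows "loc_above (- real n) F"
proof -
  have U': "loc_above (- real n) (\<lambda>\<omega>. U \<omega> - mat 1)"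
    by (rule loc_above_cong[OF loc_above_add[OF X loc_above_mono[OF loc_R[OF X]]]]) (simp_all add: R_def)
  have U: "loc_above (- real n) U"
    by (rule loc_above_cong[OF loc_above_add[OF U' loc_above_one]]) simp
  have supp_U': "supp_all (\<lambda>g. g \<le> - 1) (\<lambda>\<omega>. U \<omega> - mat 1)"
    unfolding supp_all_def by (auto intro: supp_mono[OF U_unipotent])
  have supp_U: "supp_all (\<lambda>g. g \<le> 0) U"
    unfolding supp_all_def by (auto intro: supp_mono[OF unipotent_supp[OF U_unipotent]])
  have "loc_above (- real n) (\<lambda>\<omega>. (U \<omega> - mat 1) ** K \<omega>)"
  proof (rule loc_above_mult[OF supp_U' U' _ K])
    show "supp_all (\<lambda>g. g \<le> - 1) K"
      unfolding supp_all_def by (auto intro: supp_mono[OF supp_K])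
  qed auto
  moreover have "loc_above (- real n) (\<lambda>\<omega>. A \<omega> ** U \<omega>)"
  proof (rule loc_above_mult[OF _ loc_above_base supp_U U])
    show "supp_all (\<lambda>g. g \<le> 0) A"
      unfolding supp_all_def by (auto intro: supp_mono[OF supp_A])
  qed auto
  moreover have "loc_above (- real n) (\<lambda>\<omega>. lie (EE \<omega>) (R \<omega>))"
  proof (rule loc_above_lie[OF _ loc_above_const[of "- real n"] _ loc_R[OF X]])
    show "supp_all (\<lambda>g. g \<le> 1) EE"
      unfolding supp_all_def by (auto intro: supp_mono[OF supp_E])
    show "supp_all (\<lambda>g. g \<le> - 2) R"
      unfolding supp_all_def by (auto intro: supp_R)
  qed auto
  ultimately show ?thesis
    unfolding F_def by (intro loc_above_diff loc_above_D U')
qed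

lemma supp_F: "\<omega> \<in> \<Omega> \<Longrightarrow> supp (\<lambda>g. g \<le> 0) (F \<omega>)"
  unfolding recursion[symmetric]
  by (intro supp_diff supp_lie[OF supp_E supp_X] supp_mono[OF supp_K]) auto

text \<open>The only new integral weight is -n - 1. There X is recovered from (ad E)^2 X = [E, F] in
  grade -n + 1, and as E has grade 1, F is needed only down to -n.\<close>

lemma loc_X_step:
  assumes F: "loc_above (- real n) F" and X_n: "loc_above (- real n) X"
  shows "loc_above (- real (Suc n)) X"
  unfolding loc_above_def
proof (intro allI impI)
  fix i j l assume w: "- real (Suc n) \<le> weight i j l"
  obtain \<tau> where "\<forall>Z c i j l. laurent_mat Z \<longrightarrow> supp (\<lambda>g. g = c) (lie E (lie E (lie E Z))) \<longrightarrow>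
    loop_nth (lie E Z) i j l =
      (\<Sum>(a, b, m)\<in>grade_indices c. \<tau> i j l a b m * loop_nth (lie E (lie E (lie E Z))) a b m)"
    using ad_square_inverse_coefficients[OF semisimple laurent_E] by blast
  note \<tau> = this[rule_format]
  \<comment> \<open>Grade -(n + 1), moved up by two commutators with E.\<close>
  define J where "J = grade_indices (- real n + 1)"
  consider "- real n \<le> weight i j l" | "\<not> weight i j l \<in> \<int>" | "weight i j l = - real (Suc n)"
  proof -
    have "weight i j l = - real (Suc n)"
      if lt: "\<not> - real n \<le> weight i j l" and int: "weight i j l \<in> \<int>"
    proof -
      obtain k where k: "weight i j l = of_int k" using int by (auto elim: Ints_cases)
      with lt w have "k < - int n" "- int (Suc n) \<le> k" by linarith+
      then have "k = - int (Suc n)" by linarith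
      then show ?thesis using k by simp
    qed
    then show thesis using that by blast
  qed
  then show "loc (\<lambda>\<omega>. loop_nth (X \<omega>) i j l)"
  proof cases
    case 1
    then show ?thesis by (rule loc_aboveD[OF X_n])
  next
    case 2
    then show ?thesis
      by (rule loc_outside_supp[rotated]) (auto simp: supp_all_def intro: supp_mono[OF supp_X])
  next
    case 3
    have EF: "loc_above (- real n + 1) (\<lambda>\<omega>. lie (EE \<omega>) (F \<omega>))"
    proof (rule loc_above_lie[OF _ loc_above_const _ F])
      show "supp_all (\<lambda>g. g \<le> 1) EE"
        unfolding supp_all_def by (auto intro: supp_mono[OF supp_E])
      show "supp_all (\<lambda>g. g \<le> 0) F"
        unfolding supp_all_def by (auto intro: supp_F)
      show "(- real n + 1) + 0 \<le> - real n + 1" by simp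
    qed simp
    have "loc (\<lambda>\<omega>. \<Sum>(a, b, m)\<in>J. \<iota> \<omega> (\<tau> i j l a b m) * loop_nth (lie (EE \<omega>) (F \<omega>)) a b m)"
      unfolding case_prod_unfold
      by (intro loc_sum local_function.mult local_function.const loc_aboveD[OF EF])
        (auto simp: J_def grade_indices_def)
    then show ?thesis
    proof (rule local_function.cong)
      fix \<omega> assume \<omega>: "\<omega> \<in> \<Omega>"
      interpret graded_algebra \<kappa> h "\<iota> \<omega>" by (rule graded_algebra) fact
      let ?ad2 = "\<lambda>Y. lie (EE \<omega>) (lie (EE \<omega>) Y)"
      let ?V = "homog \<kappa> h (ad_im G E) (- int (Suc n))"
      have ad2: "supp (\<lambda>g. Q (g - 2)) (?ad2 Y)" if "supp Q Y" for Q and Y :: "('r, 'n) loop_mat"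
        by (rule supp_lie[OF supp_E[OF \<omega>] supp_lie[OF supp_E[OF \<omega>] that, where R = "\<lambda>g. Q (g - 1)"]])
          (auto simp: algebra_simps)
      obtain u where u: "\<And>j. j \<ge> 1 \<Longrightarrow> u j \<in> ext_span (\<iota> \<omega>) (homog \<kappa> h (ad_im G E) (- int j))"
        and Xu: "\<And>j i i' l. j \<ge> 1 \<Longrightarrow> weight i i' l = - real j \<Longrightarrow> loop_nth (X \<omega>) i i' l = loop_nth (u j) i i' l"
        by (rule negative_seriesE[OF X[OF \<omega>]]) blast
      \<comment> \<open>Both sides are linear over the coefficient ring, so the identity passes from
        complex generators in the image of ad E to their span.\<close>
      have span: "loop_nth Y i j l = (\<Sum>(a, b, m)\<in>J. \<iota> \<omega> (\<tau> i j l a b m) * loop_nth (?ad2 Y) a b m)"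
        if "Y \<in> ext_span (\<iota> \<omega>) ?V" for Y
        using that unfolding ext_span_def
      proof (induction rule: loop_module.span_induct_alt)
        case base
        then show ?case by simp
      next
        case (step c x y)
        then obtain v where v: "v \<in> ?V" "x = loop_map (\<iota> \<omega>) v" by blast
        then obtain Z where Z: "v = lie E Z" "laurent_mat Z" using G by (auto simp: homog_def ad_im_def)
        have "supp (\<lambda>g. g = of_int (- int (Suc n))) v" by (rule homog_supp[OF v(1)])
        then have "supp (\<lambda>g. g = - real n + 1) (lie E (lie E v))"
          using homog_supp[OF E]
          by (intro supp_lie[where P = "\<lambda>g. g = 1" and Q = "\<lambda>g. g = - real n"]
                supp_lie[where P = "\<lambda>g. g = 1" and Q = "\<lambda>g. g = of_int (- int (Suc n))"]) auto
        then have "loop_nth v i j l = (\<Sum>(a, b, m)\<in>J. \<tau> i j l a b m * loop_nth (lie E (lie E v)) a b m)"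
          unfolding Z(1) J_def by (rule \<tau>[OF Z(2)])
        then have x: "loop_nth x i j l = (\<Sum>(a, b, m)\<in>J. \<iota> \<omega> (\<tau> i j l a b m) * loop_nth (?ad2 x) a b m)"
          by (simp add: v(2) loop_map_lie[symmetric] loop_nth_map hom_sum hom_mult case_prod_unfold)
        have "?ad2 (loop_scale c x + y) = loop_scale c (?ad2 x) + ?ad2 y"
          by (simp add: lie_add_right lie_scale_right)
        then show ?case
          by (simp add: loop_nth_scale x step.IH case_prod_unfold distrib_left sum.distrib sum_distrib_left mult.left_commute)
      qed
      \<comment> \<open>The other components of X land in other grades under (ad E)^2, so in grade
        -n + 1 the component \<open>u (Suc n)\<close> may be replaced by X.\<close>
      have "supp (\<lambda>g. g \<noteq> - real (Suc n)) (X \<omega> - u (Suc n))"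
        by (rule suppI) (use Xu[of "Suc n"] in auto)
      from ad2[OF this] have "loop_nth (?ad2 (X \<omega> - u (Suc n))) a b m = 0" if "(a, b, m) \<in> J" for a b m
        by (rule supp_nth_zero) (use that in \<open>auto simp: J_def grade_indices_def\<close>)
      then have ad2_u: "loop_nth (?ad2 (u (Suc n))) a b m = loop_nth (?ad2 (X \<omega>)) a b m" if "(a, b, m) \<in> J" for a b m
        using that by (simp add: lie_diff_right)
      have ad2_X: "?ad2 (X \<omega>) = lie (EE \<omega>) (F \<omega>)"
        by (simp add: recursion[OF \<omega>, symmetric] lie_diff_right EK[OF \<omega>])
      have "loop_nth (X \<omega>) i j l = loop_nth (u (Suc n)) i j l"
        using 3 by (intro Xu) auto
      also have "\<dots> = (\<Sum>(a, b, m)\<in>J. \<iota> \<omega> (\<tau> i j l a b m) * loop_nth (?ad2 (u (Suc n))) a b m)"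
        by (rule span[OF u]) simp
      also have "\<dots> = (\<Sum>(a, b, m)\<in>J. \<iota> \<omega> (\<tau> i j l a b m) * loop_nth (lie (EE \<omega>) (F \<omega>)) a b m)"
        by (rule sum.cong) (auto simp: ad2_u ad2_X)
      finally show "loop_nth (X \<omega>) i j l = (\<Sum>(a, b, m)\<in>J. \<iota> \<omega> (\<tau> i j l a b m) * loop_nth (lie (EE \<omega>) (F \<omega>)) a b m)" .
    qed
  qed
qed

text \<open>X runs one grade ahead of K: once X is known in grade -n - 1, K is [E, X] - F in grade
  -n. At n = 0 both claims concern weights above the supports.\<close>

lemma loc_XK: "loc_above (- real n) X \<and> loc_above (- real n + 1) K"
proof (induction n)
  case 0
  have "loc_above 0 X"
    by (rule loc_above_outside_supp) (auto simp: supp_all_def intro: supp_mono[OF supp_X])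
  moreover have "loc_above 1 K"
    by (rule loc_above_outside_supp) (auto simp: supp_all_def intro: supp_mono[OF supp_K])
  ultimately show ?case by simp
next
  case (Suc n)
  then have F: "loc_above (- real n) F" by (intro loc_F) auto
  have X_Suc: "loc_above (- real (Suc n)) X" by (rule loc_X_step[OF F]) (use Suc in auto)
  have EX: "loc_above (- real n) (\<lambda>\<omega>. lie (EE \<omega>) (X \<omega>))"
  proof (rule loc_above_lie[OF _ loc_above_const _ X_Suc])
    show "supp_all (\<lambda>g. g \<le> 1) EE"
      unfolding supp_all_def by (auto intro: supp_mono[OF supp_E])
    show "supp_all (\<lambda>g. g \<le> - 1) X"
      unfolding supp_all_def by (auto intro: supp_mono[OF supp_X])
    show "- real n + - 1 \<le> - real n" by simp
  qed simp
  have "loc_above (- real n) K"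
    by (rule loc_above_cong[OF loc_above_diff[OF EX F]]) (simp add: recursion[symmetric])
  with X_Suc show ?case by simp
qed

lemma loc_above_all: "(\<And>n. loc_above (- real n) Y) \<Longrightarrow> loc_above c Y"
  by (meson loc_above_mono real_arch_simple minus_le_iff)

lemma loc_U: "loc_above c U"
proof (rule loc_above_all)
  fix n
  have X: "loc_above (- real n) X" using loc_XK by blast
  have "loc_above (- real n) (\<lambda>\<omega>. X \<omega> + R \<omega>)"
    by (intro loc_above_add X loc_above_mono[OF loc_R[OF X]]) simp
  then show "loc_above (- real n) U"
    by (rule loc_above_cong[OF loc_above_add[OF _ loc_above_one]]) (simp add: R_def)
qed

lemma inverse_U:
  assumes "\<omega> \<in> \<Omega>"
  shows "U \<omega> ** matrix_inv (U \<omega>) = mat 1" "supp neg_grade (matrix_inv (U \<omega>) - mat 1)"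
  by (rule unipotent_inverse[OF U_unipotent[OF assms]], metis matrix_inv_eqI)+

text \<open>The inverse satisfies V = 1 - (U - 1) V. As U - 1 has grade at most -1, this determines
  V grade by grade, starting above its support.\<close>

lemma loc_inverse_U: "loc_above c (\<lambda>\<omega>. matrix_inv (U \<omega>))"
proof (rule loc_above_all)
  let ?V = "\<lambda>\<omega>. matrix_inv (U \<omega>)"
  have supp_V: "supp_all (\<lambda>g. g \<le> 0) ?V"
    unfolding supp_all_def by (auto intro: supp_mono[OF unipotent_supp[OF inverse_U(2)]])
  have supp_U': "supp_all (\<lambda>g. g \<le> - 1) (\<lambda>\<omega>. U \<omega> - mat 1)"
    unfolding supp_all_def by (auto intro: supp_mono[OF U_unipotent])
  show "loc_above (- real n) ?V" for n
  proof (induction n)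
    case 0
    have "loc_above 1 ?V"
      by (rule loc_above_outside_supp) (use supp_V in \<open>auto simp: supp_all_def intro: supp_mono\<close>)
    have "loc_above 0 (\<lambda>\<omega>. (U \<omega> - mat 1) ** ?V \<omega>)"
      by (rule loc_above_mult[OF supp_U' loc_above_diff[OF loc_U[of 0] loc_above_one] supp_V \<open>loc_above 1 ?V\<close>]) auto
    then have "loc_above 0 ?V"
      by (rule loc_above_cong[OF loc_above_diff[OF loc_above_one]]) (simp add: matrix_diff_rdistrib inverse_U)
    then show ?case by simp
  next
    case (Suc n)
    have "loc_above (- real (Suc n)) (\<lambda>\<omega>. (U \<omega> - mat 1) ** ?V \<omega>)"
      by (rule loc_above_mult[OF supp_U' loc_above_diff[OF loc_U[of "- real (Suc n)"] loc_above_one] supp_V Suc]) auto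
    then show ?case
      by (rule loc_above_cong[OF loc_above_diff[OF loc_above_one]]) (simp add: matrix_diff_rdistrib inverse_U)
  qed
qed

text \<open>U and its inverse have no positive grades, so only finitely many grades contribute to
  each entry. The offset \<open>c - k\<close> compensates the grade of B.\<close>

lemma dressed_local:
  fixes k :: int
  assumes "supp (\<lambda>g. g = k) B"
  shows "supp_all (\<lambda>g. g \<le> k) (\<lambda>\<omega>. dressed (\<iota> \<omega>) (U \<omega>) B)" and "loc_above c (\<lambda>\<omega>. dressed (\<iota> \<omega>) (U \<omega>) B)"
proof -
  have U: "supp_all (\<lambda>g. g \<le> 0) U"
    unfolding supp_all_def by (auto intro: supp_mono[OF unipotent_supp[OF U_unipotent]])
  have V: "supp_all (\<lambda>g. g \<le> 0) (\<lambda>\<omega>. matrix_inv (U \<omega>))"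
    unfolding supp_all_def by (auto intro: supp_mono[OF unipotent_supp[OF inverse_U(2)]])
  have B: "supp_all (\<lambda>g. g \<le> k) (\<lambda>\<omega>. loop_map (\<iota> \<omega>) B)"
    unfolding supp_all_def
    by (auto intro!: supp_map supp_mono[OF assms] simp: algebra_hom.hom_zero[OF algebra_hom])
  have UB: "supp_all (\<lambda>g. g \<le> k) (\<lambda>\<omega>. U \<omega> ** loop_map (\<iota> \<omega>) B)"
    using U B unfolding supp_all_def by (auto intro: supp_mult[of "\<lambda>g. g \<le> 0" _ "\<lambda>g. g \<le> k"])
  show "supp_all (\<lambda>g. g \<le> k) (\<lambda>\<omega>. dressed (\<iota> \<omega>) (U \<omega>) B)"
    using UB V unfolding supp_all_def dressed_def by (auto intro: supp_mult[of "\<lambda>g. g \<le> k" _ "\<lambda>g. g \<le> 0"])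
  have "loc_above c (\<lambda>\<omega>. U \<omega> ** loop_map (\<iota> \<omega>) B)" for c
    by (rule loc_above_mult[OF U loc_U[of "c - k"] B loc_above_const[of c]]) auto
  then show "loc_above c (\<lambda>\<omega>. dressed (\<iota> \<omega>) (U \<omega>) B)"
    unfolding dressed_def by (rule loc_above_mult[OF UB _ V loc_inverse_U[of "c - k"], of c]) auto
qed

lemma loc_graded_trace: "loc_above 0 Y \<Longrightarrow> loc (\<lambda>\<omega>. graded_trace \<kappa> h (Y \<omega>))"
  unfolding graded_trace_eq by (intro loc_sum loc_aboveD) auto

lemma density_local:
  fixes k :: int
  assumes B: "supp (\<lambda>g. g = k) B"
  shows "loc (\<lambda>\<omega>. conserved_density (\<iota> \<omega>) \<kappa> h E (U \<omega>) B)"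
  unfolding conserved_density_def
proof (intro loc_minus loc_graded_trace)
  have "supp_all (\<lambda>g. g \<le> 1) EE"
    unfolding supp_all_def by (auto intro: supp_mono[OF supp_E])
  then show "loc_above 0 (\<lambda>\<omega>. EE \<omega> ** dressed (\<iota> \<omega>) (U \<omega>) B)"
    by (rule loc_above_mult[OF _ loc_above_const[of "- k"] dressed_local(1)[OF B] dressed_local(2)[OF B, of "- 1"]]) auto
qed

text \<open>The flux with U in place of \<Theta>; \<open>dressed_dressing\<close> justifies the
  replacement. Projection and grading operator multiply each entry by a constant and so preserve
  locality.\<close>

lemma flux_local:
  fixes k k' :: int
  assumes B: "supp (\<lambda>g. g = k) B" and B': "supp (\<lambda>g. g = k') B'"
  shows "loc (\<lambda>\<omega>. graded_trace \<kappa> h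
    (grading_op (\<iota> \<omega>) \<kappa> h (grade_part \<kappa> h (\<lambda>g. g \<ge> 0) (dressed (\<iota> \<omega>) (U \<omega>) B)) ** dressed (\<iota> \<omega>) (U \<omega>) B'))"
proof (rule loc_graded_trace)
  let ?Y = "\<lambda>\<omega>. grading_op (\<iota> \<omega>) \<kappa> h (grade_part \<kappa> h (\<lambda>g. g \<ge> 0) (dressed (\<iota> \<omega>) (U \<omega>) B))"
  have nth: "loop_nth (?Y \<omega>) i j l =
      (if weight i j l \<ge> 0 then \<iota> \<omega> (of_real (weight i j l)) * loop_nth (dressed (\<iota> \<omega>) (U \<omega>) B) i j l else 0)"
    if "\<omega> \<in> \<Omega>" for \<omega> i j l
    by (simp add: graded_algebra.loop_nth_grading_op[OF graded_algebra[OF that]] loop_nth_grade_part)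
  have "supp_all (\<lambda>g. g \<le> k) ?Y"
    unfolding supp_all_def
  proof (intro ballI suppI)
    fix \<omega> i j l assume \<omega>: "\<omega> \<in> \<Omega>" and "loop_nth (?Y \<omega>) i j l \<noteq> 0"
    then have "loop_nth (dressed (\<iota> \<omega>) (U \<omega>) B) i j l \<noteq> 0" by (auto simp: nth split: if_splits)
    then show "weight i j l \<le> k"
      using dressed_local(1)[OF B] \<omega> unfolding supp_all_def by (auto dest: suppD)
  qed
  moreover have "loc_above (- k') ?Y"
    unfolding loc_above_def
  proof (intro allI impI)
    fix i j l
    show "loc (\<lambda>\<omega>. loop_nth (?Y \<omega>) i j l)"
    proof (cases "weight i j l \<ge> 0")
      case True
      then show ?thesis
        by (intro local_function.cong[OF local_function.mult[OF local_function.const loc_aboveD[OF dressed_local(2)[OF B, of 0], of i j l]]])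
          (auto simp: nth)
    next
      case False
      then show ?thesis by (intro local_function.cong[OF loc_zero]) (simp add: nth)
    qed
  qed
  ultimately show "loc_above 0 (\<lambda>\<omega>. ?Y \<omega> ** dressed (\<iota> \<omega>) (U \<omega>) B')"
    by (rule loc_above_mult[OF _ _ dressed_local(1)[OF B'] dressed_local(2)[OF B', of "- k"]]) auto
qed

end

text \<open>The components are \<open>\<iota>\<close>, \<open>D\<close>, \<open>A\<close>, \<open>U\<close>, \<open>K\<^sup>-\<close> and a logarithm \<open>X\<close> of \<open>U\<close>.\<close>

type_synonym ('r, 'n) dressing_data =
  "(complex \<Rightarrow> 'r) \<times> ('r \<Rightarrow> 'r) \<times> ('r, 'n) loop_mat \<times> ('r, 'n) loop_mat \<times> ('r, 'n) loop_mat \<times> ('r, 'n) loop_mat"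

text \<open>The polynomials are quantified before the data: one formula in the jets of
  \<open>A\<close> serves every choice of \<iota>, derivation, field and dressing.\<close>

theorem mainTheorem8:
  fixes \<gg> :: "(complex ^ 'n ^ 'n) set"
    and \<sigma> :: "complex ^ 'n ^ 'n \<Rightarrow> complex ^ 'n ^ 'n"
    and r :: nat
    and G :: "(complex, 'n) loop_mat set"
    and \<kappa> :: real
    and h :: "'n \<Rightarrow> real"
    and E :: "(complex, 'n) loop_mat"
    and I :: "nat set"
    and b :: "nat \<Rightarrow> (complex, 'n) loop_mat"
  assumes "simple_lie_algebra \<gg>"
    and "finite_order_automorphism \<gg> \<sigma> r"
    and "G = affine_algebra \<gg> \<sigma> r"
    and "\<kappa> > 0"
    and "integral_gradation \<kappa> h G"
    and "E \<in> homog \<kappa> h G 1"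
    and "semisimple_element E"
    and "flow_constants \<kappa> h G E I b"
  shows "\<exists>(p :: nat \<Rightarrow> 'n diff_poly) (q :: nat \<Rightarrow> nat \<Rightarrow> 'n diff_poly).
    \<forall>(\<iota> :: complex \<Rightarrow> 'r::comm_ring_1) D A U Km.
      complex_algebra \<iota> \<longrightarrow> derivation \<iota> D \<longrightarrow>
      A \<in> ext_span \<iota> (homog \<kappa> h (ad_im G E) 0) \<longrightarrow>
      dressing_U \<iota> D \<kappa> h G E A U Km \<longrightarrow>
        (\<forall>n\<in>I. conserved_density \<iota> \<kappa> h E U (b n) = diff_poly_eval \<iota> D A (p n)) \<and>
        (\<forall>S. dressing_S \<iota> D \<kappa> h G E Km S \<longrightarrow>
          (\<forall>m\<in>I. \<forall>n\<in>I. conserved_flux \<iota> \<kappa> h (U ** S) U (b m) (b n) = diff_poly_eval \<iota> D A (q m n)) \<and>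
          (\<forall>\<delta>. isospectral_flows \<iota> D \<kappa> h I b (U ** S) \<delta> \<longrightarrow>
            (\<forall>m\<in>I. \<forall>n\<in>I.
              \<delta> m (conserved_density \<iota> \<kappa> h E U (b n)) + D (conserved_flux \<iota> \<kappa> h (U ** S) U (b m) (b n)) = 0)))"
proof -
  interpret loop_grading \<kappa> h by unfold_locales fact
  \<comment> \<open>\<open>dressing_U\<close> only asserts that a logarithm of U exists. The family
    needs a definite one for each datum, so it becomes a component.\<close>
  define \<Omega> :: "('r, 'n) dressing_data set" where "\<Omega> = {(\<iota>, D, A, U, Km, X). complex_algebra \<iota> \<and> derivation \<iota> D \<and>
    A \<in> ext_span \<iota> (homog \<kappa> h (ad_im G E) 0) \<and> dressing_U \<iota> D \<kappa> h G E A U Km \<and>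
    X \<in> negative_series \<iota> \<kappa> h (ad_im G E) \<and> is_exp \<iota> X U}"
  define \<iota> :: "('r, 'n) dressing_data \<Rightarrow> _" where "\<iota> = fst"
  define D :: "('r, 'n) dressing_data \<Rightarrow> _" where "D = fst \<circ> snd"
  define A :: "('r, 'n) dressing_data \<Rightarrow> _" where "A = fst \<circ> snd \<circ> snd"
  define U :: "('r, 'n) dressing_data \<Rightarrow> _" where "U = fst \<circ> snd \<circ> snd \<circ> snd"
  define Km :: "('r, 'n) dressing_data \<Rightarrow> _" where "Km = fst \<circ> snd \<circ> snd \<circ> snd \<circ> snd"
  define X :: "('r, 'n) dressing_data \<Rightarrow> _" where "X = snd \<circ> snd \<circ> snd \<circ> snd \<circ> snd"
  note proj = \<iota>_def D_def A_def U_def Km_def X_def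
  have \<Omega>: "complex_algebra (\<iota> \<omega>)" "derivation (\<iota> \<omega>) (D \<omega>)"
    "A \<omega> \<in> ext_span (\<iota> \<omega>) (homog \<kappa> h (ad_im G E) 0)"
    "dressing_U (\<iota> \<omega>) (D \<omega>) \<kappa> h G E (A \<omega>) (U \<omega>) (Km \<omega>)"
    "X \<omega> \<in> negative_series (\<iota> \<omega>) \<kappa> h (ad_im G E)" "is_exp (\<iota> \<omega>) (X \<omega>) (U \<omega>)" if "\<omega> \<in> \<Omega>" for \<omega>
    using that by (auto simp: \<Omega>_def proj)
  have hom: "algebra_hom (\<iota> \<omega>)" if "\<omega> \<in> \<Omega>" for \<omega>
    using \<Omega>(1)[OF that] by unfold_locales
  have graded: "graded_algebra \<kappa> (\<iota> \<omega>)" if "\<omega> \<in> \<Omega>" for \<omega>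
    by (simp add: graded_algebra_def hom[OF that] loop_grading_axioms)
  interpret dressing_family \<Omega> \<iota> D A \<kappa> h G E X U Km
  proof
    show "laurent_mat Y" if "Y \<in> G" for Y
      using that assms(3) by (simp add: laurent_mat_iff affine_algebra_def)
    fix \<omega> assume \<omega>: "\<omega> \<in> \<Omega>"
    show "complex_algebra (\<iota> \<omega>)" "derivation (\<iota> \<omega>) (D \<omega>)"
      using \<Omega>[OF \<omega>] by auto
    show "supp (\<lambda>g. g = 0) (A \<omega>)"
      using graded_algebra.supp_ext_span_homog[OF graded[OF \<omega>] \<Omega>(3)[OF \<omega>]] by simp
    show "Km \<omega> \<in> negative_series (\<iota> \<omega>) \<kappa> h (ad_ker G E)"
      using \<Omega>(4)[OF \<omega>] by (simp add: dressing_U_def)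
    show "loop_map (D \<omega>) (U \<omega>) = U \<omega> ** (loop_map (\<iota> \<omega>) E + Km \<omega>) - (loop_map (\<iota> \<omega>) E + A \<omega>) ** U \<omega>"
      by (rule graded_algebra.dressing_UD[OF graded[OF \<omega>] \<Omega>(4,2)[OF \<omega>]])
  qed (use assms \<Omega> in auto)
  have supp_b: "supp (\<lambda>g. g = of_int (int n)) (b n)" if "n \<in> I" for n
    by (rule homog_supp) (use assms(8) that in \<open>auto simp: flow_constants_def\<close>)
  \<comment> \<open>Locality over all of \<Omega> gives one polynomial for each n before any datum
    is chosen.\<close>
  have "\<forall>n\<in>I. \<exists>p. \<forall>\<omega>\<in>\<Omega>. conserved_density (\<iota> \<omega>) \<kappa> h E (U \<omega>) (b n) = diff_poly_eval (\<iota> \<omega>) (D \<omega>) (A \<omega>) p"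
    by (intro ballI loc_diff_poly density_local[OF supp_b])
  then obtain p where p: "\<And>n \<omega>. n \<in> I \<Longrightarrow> \<omega> \<in> \<Omega> \<Longrightarrow>
      conserved_density (\<iota> \<omega>) \<kappa> h E (U \<omega>) (b n) = diff_poly_eval (\<iota> \<omega>) (D \<omega>) (A \<omega>) (p n)"
    by metis
  have "\<forall>m\<in>I. \<forall>n\<in>I. \<exists>q. \<forall>\<omega>\<in>\<Omega>. graded_trace \<kappa> h
      (grading_op (\<iota> \<omega>) \<kappa> h (grade_part \<kappa> h (\<lambda>g. g \<ge> 0) (dressed (\<iota> \<omega>) (U \<omega>) (b m))) ** dressed (\<iota> \<omega>) (U \<omega>) (b n))
      = diff_poly_eval (\<iota> \<omega>) (D \<omega>) (A \<omega>) q"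
    by (intro ballI loc_diff_poly flux_local[OF supp_b supp_b])
  then obtain q where q: "\<And>m n \<omega>. m \<in> I \<Longrightarrow> n \<in> I \<Longrightarrow> \<omega> \<in> \<Omega> \<Longrightarrow> graded_trace \<kappa> h
      (grading_op (\<iota> \<omega>) \<kappa> h (grade_part \<kappa> h (\<lambda>g. g \<ge> 0) (dressed (\<iota> \<omega>) (U \<omega>) (b m))) ** dressed (\<iota> \<omega>) (U \<omega>) (b n))
      = diff_poly_eval (\<iota> \<omega>) (D \<omega>) (A \<omega>) (q m n)"
    by metis
  show ?thesis
  proof (rule exI[of _ p], rule exI[of _ q], intro allI impI conjI ballI)
    fix \<iota>' :: "complex \<Rightarrow> 'r" and D' A' U' Km'
    assume hyps: "complex_algebra \<iota>'" "derivation \<iota>' D'" "A' \<in> ext_span \<iota>' (homog \<kappa> h (ad_im G E) 0)"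
      "dressing_U \<iota>' D' \<kappa> h G E A' U' Km'"
    \<comment> \<open>Any logarithm of \<open>U'\<close> turns the given data into a point of
      \<Omega>; the polynomials fixed above do not depend on which one.\<close>
    then obtain X' where "X' \<in> negative_series \<iota>' \<kappa> h (ad_im G E)" "is_exp \<iota>' X' U'"
      unfolding dressing_U_def by blast
    with hyps have \<omega>: "(\<iota>', D', A', U', Km', X') \<in> \<Omega>" by (simp add: \<Omega>_def)
    interpret fiber: graded_algebra \<kappa> h \<iota>' using graded[OF \<omega>] by (simp add: proj)
    show "conserved_density \<iota>' \<kappa> h E U' (b n) = diff_poly_eval \<iota>' D' A' (p n)" if "n \<in> I" for n
      using p[OF that \<omega>] by (simp add: proj)
    fix S assume S: "dressing_S \<iota>' D' \<kappa> h G E Km' S"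
    show "conserved_flux \<iota>' \<kappa> h (U' ** S) U' (b m) (b n) = diff_poly_eval \<iota>' D' A' (q m n)"
      if m: "m \<in> I" and n: "n \<in> I" for m n
    proof -
      have "b m \<in> lie_center (ad_ker G E)"
        using assms(8) m by (auto simp: flow_constants_def homog_def)
      then have "dressed \<iota>' (U' ** S) (b m) = dressed \<iota>' U' (b m)"
        by (rule fiber.dressed_dressing[OF hyps(4) S hyps(2)])
      then show ?thesis
        using q[OF m n \<omega>] by (simp add: conserved_flux_def proj)
    qed
    fix \<delta> m n assume "isospectral_flows \<iota>' D' \<kappa> h I b (U' ** S) \<delta>" "m \<in> I" "n \<in> I"
    then show "\<delta> m (conserved_density \<iota>' \<kappa> h E U' (b n)) + D' (conserved_flux \<iota>' \<kappa> h (U' ** S) U' (b m) (b n)) = 0"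
      by (rule fiber.dressing_conservation_law[OF hyps(2) assms(6) hyps(3) assms(8) hyps(4) S])
  qed
qed

end
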